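(* Let $\Bbbk$ be a perfect field with algebraic closure $\overline{\Bbbk}$. The category of non-singular projective curves in $\mathbb{P}^2_{\overline{\Bbbk}}$ with morphisms of varieties is isomorphic (as a category) to the category $\mathcal{GR}^{\mathrm{sm}}_{(0,1,1)}(V)$, whose objects are the smooth quiver Grassmannians $\mathrm{Gr}_{(0,1,1)}(V_d^f)$ (for all integers $d\ge 0$ and all $f$ such that the associated degree-$d$ homogeneous polynomial $\nu_d^{-1}(f)$ is irreducible) and whose morphisms are all morphisms of projective varieties.
   Context: A projective variety in $\mathbb{P}^n_{\overline{\Bbbk}}$ is the vanishing set of a prime homogeneous ideal of $\overline{\Bbbk}[x_0,\dots,x_n]$; a projective curve is a projective variety in $\mathbb{P}^2_{\overline{\Bbbk}}$ of dimension one; a variety is non-singular (smooth) if at every point the dimension of its tangent space equals its dimension. Morphisms of varieties are everywhere-defined rational maps. Quiver: $Q$ has vertices $1,2,3$, one arrow $2\to 1$ and three arrows $2\to 3$. For a finite-dimensional representation $W$ of $Q$ and a dimension vector $\mathbf e$, the quiver Grassmannian $\mathrm{Gr}_{\mathbf e}(W)=\mathrm{Gr}^Q_{\mathbf e}(W)$ is the projective variety of subrepresentations of $W$ of dimension vector $\mathbf e$. The representation $V_d^f$: for an integer $d\ge 0$ let $M_{2,d}$ be the set of $m=(m_0,m_1,m_2)\in\mathbb{N}^3$ with $m_0+m_1+m_2=d$, so $|M_{2,d}|=M=\binom{d+2}{2}$ and $|M_{2,d-1}|=M'=\binom{d+1}{2}$. Let $e_0,e_1,e_2$ be the standard basis vectors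 of $\mathbb{N}^3$. Let $\nu_d:\mathbb{P}^2_{\overline{\Bbbk}}\to\mathbb{P}^{M-1}_{\overline{\Bbbk}}$, $[x_0,x_1,x_2]\mapsto[x_0^{m_0}x_1^{m_1}x_2^{m_2}]_{m\in M_{2,d}}$, be the $d$-uple Veronese embedding. For a linear form $f=\sum_{m\in M_{2,d}}c_m x_m$ on $\overline{\Bbbk}^{M_{2,d}}$, write $\nu_d^{-1}(f)=\sum_m c_m x_0^{m_0}x_1^{m_1}x_2^{m_2}\in\overline{\Bbbk}[x_0,x_1,x_2]$ for the corresponding homogeneous polynomial of degree $d$. If $\nu_d^{-1}(f)$ is irreducible, $V_d^f$ is the $\overline{\Bbbk}$-representation of $Q$ with spaces $\overline{\Bbbk}$, $\overline{\Bbbk}^{M_{2,d}}$, $\overline{\Bbbk}^{M_{2,d-1}}$ at the vertices $1,2,3$ (dimension vector $(1,M,M')$), with the map $f$ on the arrow $2\to1$ and the maps $\varphi_i:(x_m)_{m\in M_{2,d}}\mapsto(x_{n+e_i})_{n\in M_{2,d-1}}$, $i=0,1,2$, on the three arrows $2\to 3$ (i.e. $\varphi_i$ is the $i$th column of the matrix $A_d(x)$ with $(n,i)$ entry $x_{n+e_i}$). A point of $\mathrm{Gr}_{(0,1,1)}(V_d^f)$ is a pair of lines $L\subset\overline{\Bbbk}^{M_{2,d}}$, $L'\subset\overline{\Bbbk}^{M_{2,d-1}}$ with $f(L)=0$ and $\varphi_i(L)\subset L'$ for all $i$; $\mathrm{Gr}_{(0,1,1)}(V_d^f)$ is identified with the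 subvariety of $\mathbb{P}^{M-1}_{\overline{\Bbbk}}$ consisting of the lines $L$. $\mathcal{GR}_{(0,1,1)}(V)$ is the category with objects the $\mathrm{Gr}_{(0,1,1)}(V_d^f)$ for all $d\in\mathbb{Z}^{\ge0}$ and all $f$ with $\nu_d^{-1}(f)$ irreducible, with morphisms those of projective varieties; $\mathcal{GR}^{\mathrm{sm}}_{(0,1,1)}(V)$ is its full subcategory of smooth objects. *)

theory Defs
  imports
    "HOL-Algebra.Algebraic_Closure_Type"
    "HOL-Library.Poly_Mapping"
    "HOL-Library.Function_Algebras"
    "HOL-Library.Numeral_Type"
    "HOL-Library.Extended_Nat"
    "Graph_Theory.Digraph"
begin

no_notation var (\<open>X\<index>\<close>)

section \<open>Perfect fields\<close>

text \<open>Every irreducible polynomial is separable: it has no repeated root in the algebraic closure.\<close>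

definition perfect_field :: "'k::field itself \<Rightarrow> bool" where
  "perfect_field _ \<longleftrightarrow>
     (\<forall>p::'k poly. Factorial_Ring.irreducible p \<longrightarrow> rsquarefree (map_poly to_ac p))"


section \<open>Categories\<close>

record ('o, 'm) cat =
  Obj :: "'o set"
  Hom :: "'o \<Rightarrow> 'o \<Rightarrow> 'm set"
  Ident :: "'o \<Rightarrow> 'm"
  Comp :: "'o \<Rightarrow> 'o \<Rightarrow> 'o \<Rightarrow> 'm \<Rightarrow> 'm \<Rightarrow> 'm"

text \<open>\<open>Comp C X Y Z g f\<close> is the composite of \<open>f : X \<rightarrow> Y\<close> followed by \<open>g : Y \<rightarrow> Z\<close>.
  As hom-sets are indexed by their end points, they need not be disjoint.\<close>

locale category =
  fixes C :: "('o, 'm) cat"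
  assumes Ident_in: "X \<in> Obj C \<Longrightarrow> Ident C X \<in> Hom C X X"
    and Comp_in: "\<lbrakk>X \<in> Obj C; Y \<in> Obj C; Z \<in> Obj C; f \<in> Hom C X Y; g \<in> Hom C Y Z\<rbrakk>
      \<Longrightarrow> Comp C X Y Z g f \<in> Hom C X Z"
    and Ident_left: "\<lbrakk>X \<in> Obj C; Y \<in> Obj C; f \<in> Hom C X Y\<rbrakk> \<Longrightarrow> Comp C X Y Y (Ident C Y) f = f"
    and Ident_right: "\<lbrakk>X \<in> Obj C; Y \<in> Obj C; f \<in> Hom C X Y\<rbrakk> \<Longrightarrow> Comp C X X Y f (Ident C X) = f"
    and Comp_assoc: "\<lbrakk>W \<in> Obj C; X \<in> Obj C; Y \<in> Obj C; Z \<in> Obj C;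
        f \<in> Hom C W X; g \<in> Hom C X Y; h \<in> Hom C Y Z\<rbrakk>
      \<Longrightarrow> Comp C W X Z (Comp C X Y Z h g) f = Comp C W Y Z h (Comp C W X Y g f)"

definition isomorphism_of_categories ::
    "('o, 'm) cat \<Rightarrow> ('p, 'n) cat \<Rightarrow> ('o \<Rightarrow> 'p) \<Rightarrow> ('o \<Rightarrow> 'o \<Rightarrow> 'm \<Rightarrow> 'n) \<Rightarrow> bool" where
  "isomorphism_of_categories C D F G \<longleftrightarrow>
     bij_betw F (Obj C) (Obj D) \<and>
     (\<forall>X\<in>Obj C. \<forall>Y\<in>Obj C. bij_betw (G X Y) (Hom C X Y) (Hom D (F X) (F Y))) \<and>
     (\<forall>X\<in>Obj C. G X X (Ident C X) = Ident D (F X)) \<and>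
     (\<forall>X\<in>Obj C. \<forall>Y\<in>Obj C. \<forall>Z\<in>Obj C. \<forall>f\<in>Hom C X Y. \<forall>g\<in>Hom C Y Z.
        G X Z (Comp C X Y Z g f) = Comp D (F X) (F Y) (F Z) (G Y Z g) (G X Y f))"

definition isomorphic_categories :: "('o, 'm) cat \<Rightarrow> ('p, 'n) cat \<Rightarrow> bool" where
  "isomorphic_categories C D \<longleftrightarrow>
     category C \<and> category D \<and> (\<exists>F G. isomorphism_of_categories C D F G)"

definition full_subcategory :: "('o, 'm) cat \<Rightarrow> ('o \<Rightarrow> bool) \<Rightarrow> ('o, 'm) cat" where
  "full_subcategory C P = C\<lparr>Obj := {X \<in> Obj C. P X}\<rparr>"


section \<open>Coordinate vector spaces\<close>

text \<open>For a finite set \<open>S\<close>, the space \<open>K\<^sup>S\<close> consists of the functions vanishing outside \<open>S\<close>.\<close>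

definition vscale :: "'a::field \<Rightarrow> ('i \<Rightarrow> 'a) \<Rightarrow> 'i \<Rightarrow> 'a" where
  "vscale c v = (\<lambda>i. c * v i)"

global_interpretation vec: vector_space vscale
  by standard (auto simp: vscale_def fun_eq_iff algebra_simps)

definition coord_space :: "'i set \<Rightarrow> ('i \<Rightarrow> 'a::field) set" where
  "coord_space S = {v. \<forall>i. i \<notin> S \<longrightarrow> v i = 0}"


section \<open>Multivariate polynomials\<close>

text \<open>A monomial with variables indexed by \<open>'i\<close> is its exponent vector \<open>'i \<Rightarrow>\<^sub>0 nat\<close>.\<close>

type_synonym 'i expo = "'i \<Rightarrow>\<^sub>0 nat"
type_synonym ('i, 'a) mpoly = "('i \<Rightarrow>\<^sub>0 nat) \<Rightarrow>\<^sub>0 'a"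

definition tdeg :: "'i expo \<Rightarrow> nat" where
  "tdeg m = (\<Sum>i\<in>Poly_Mapping.keys m. Poly_Mapping.lookup m i)"

definition peval :: "('i, 'a::field) mpoly \<Rightarrow> ('i \<Rightarrow> 'a) \<Rightarrow> 'a" where
  "peval F v = (\<Sum>m\<in>Poly_Mapping.keys F. Poly_Mapping.lookup F m *
     (\<Prod>i\<in>Poly_Mapping.keys m. v i ^ Poly_Mapping.lookup m i))"

text \<open>In \<open>pdiff\<close>, subtraction of exponents truncates at 0, but then the coefficient is 0.\<close>

definition pdiff :: "'i \<Rightarrow> ('i, 'a::field) mpoly \<Rightarrow> ('i, 'a) mpoly" where
  "pdiff i F = (\<Sum>m\<in>Poly_Mapping.keys F. Poly_Mapping.single (m - Poly_Mapping.single i 1)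
     (of_nat (Poly_Mapping.lookup m i) * Poly_Mapping.lookup F m))"

definition homogeneous :: "nat \<Rightarrow> ('i, 'a::field) mpoly \<Rightarrow> bool" where
  "homogeneous d F \<longleftrightarrow> (\<forall>m\<in>Poly_Mapping.keys F. tdeg m = d)"

definition poly_ring :: "'i set \<Rightarrow> ('i, 'a::field) mpoly ring" where
  "poly_ring S = \<lparr>carrier = {F. \<forall>m\<in>Poly_Mapping.keys F. Poly_Mapping.keys m \<subseteq> S},
     monoid.mult = (*), one = 1, ring.zero = 0, add = (+)\<rparr>"

definition homogeneous_ideal :: "'i set \<Rightarrow> ('i, 'a::field) mpoly set \<Rightarrow> bool" where
  "homogeneous_ideal S J \<longleftrightarrow>
     ideal J (poly_ring S) \<and> J = genideal (poly_ring S) {F \<in> J. \<exists>d. homogeneous d F}"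


section \<open>Projective varieties\<close>

text \<open>Points of \<open>\<P>(K\<^sup>S)\<close> are the lines through the origin in \<open>K\<^sup>S\<close>.\<close>

type_synonym ('i, 'a) point = "('i \<Rightarrow> 'a) set"

definition proj_space :: "'i set \<Rightarrow> ('i, 'a::field) point set" where
  "proj_space S = {L. vec.subspace L \<and> L \<subseteq> coord_space S \<and> vec.dim L = 1}"

definition vanishes_at :: "('i, 'a::field) mpoly \<Rightarrow> ('i, 'a) point \<Rightarrow> bool" where
  "vanishes_at F L \<longleftrightarrow> (\<forall>v\<in>L. peval F v = 0)"

definition vanishing_set :: "'i set \<Rightarrow> ('i, 'a::field) mpoly set \<Rightarrow> ('i, 'a) point set" where
  "vanishing_set S J =
     {L \<in> proj_space S. \<forall>F\<in>J. (\<exists>d. homogeneous d F) \<longrightarrow> vanishes_at F L}"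

definition projective_variety :: "'i set \<Rightarrow> ('i, 'a::field) point set \<Rightarrow> bool" where
  "projective_variety S X \<longleftrightarrow>
     finite S \<and>
     (\<exists>J. primeideal J (poly_ring S) \<and> homogeneous_ideal S J \<and> X = vanishing_set S J)"

text \<open>Dimension is the supremum of lengths of chains of irreducible closed subsets. Note that the
  irrelevant ideal is prime and cuts out the empty set, which does not count in chains.\<close>

definition variety_dim :: "'i set \<Rightarrow> ('i, 'a::field) point set \<Rightarrow> enat" where
  "variety_dim S X = Sup {enat n | n. \<exists>Z :: nat \<Rightarrow> ('i, 'a) point set.
     (\<forall>k\<le>n. projective_variety S (Z k) \<and> Z k \<noteq> {} \<and> Z k \<subseteq> X) \<and>
     (\<forall>k<n. Z k \<subset> Z (Suc k))}"

text \<open>The tangent space at the point \<open>L\<close> is taken projectively, in the ambient \<open>\<P>(K\<^sup>S)\<close>: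
  it is the linear subvariety whose affine cone is \<open>tangent_cone\<close>, the common kernel of the
  differentials at \<open>L\<close> of the equations of \<open>X\<close>. The cone contains \<open>L\<close> by the Euler relation and
  its vector space dimension exceeds that of the tangent space by one.\<close>

definition tangent_cone ::
    "'i set \<Rightarrow> ('i, 'a::field) point set \<Rightarrow> ('i, 'a) point \<Rightarrow> ('i \<Rightarrow> 'a) set" where
  "tangent_cone S X L = {w \<in> coord_space S.
     \<forall>F\<in>carrier (poly_ring S). (\<exists>d. homogeneous d F) \<longrightarrow> (\<forall>P\<in>X. vanishes_at F P) \<longrightarrow>
       (\<forall>v\<in>L - {0}. (\<Sum>i\<in>S. peval (pdiff i F) v * w i) = 0)}"

definition smooth :: "'i set \<Rightarrow> ('i, 'a::field) point set \<Rightarrow> bool" where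
  "smooth S X \<longleftrightarrow> (\<forall>L\<in>X. enat (vec.dim (tangent_cone S X L)) = variety_dim S X + 1)"

definition projective_plane_curve :: "(3, 'a::field) point set \<Rightarrow> bool" where
  "projective_plane_curve X \<longleftrightarrow> projective_variety UNIV X \<and> variety_dim UNIV X = 1"


section \<open>Morphisms of varieties\<close>

text \<open>A tuple \<open>\<phi> = [\<phi> j]\<^sub>j\<close> of homogeneous polynomials of the same degree represents a rational map.\<close>

definition defined_at :: "('j \<Rightarrow> ('i, 'a::field) mpoly) \<Rightarrow> ('i, 'a) point \<Rightarrow> bool" where
  "defined_at \<phi> L \<longleftrightarrow> (\<exists>j. \<not> vanishes_at (\<phi> j) L)"

definition value_at :: "('j \<Rightarrow> ('i, 'a::field) mpoly) \<Rightarrow> ('i, 'a) point \<Rightarrow> ('j, 'a) point" where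
  "value_at \<phi> L = vec.span ((\<lambda>v j. peval (\<phi> j) v) ` L)"

definition rational_rep :: "'i set \<Rightarrow> ('i, 'a::field) point set \<Rightarrow> 'j set \<Rightarrow> ('j, 'a) point set \<Rightarrow>
    ('j \<Rightarrow> ('i, 'a) mpoly) \<Rightarrow> bool" where
  "rational_rep S X T Y \<phi> \<longleftrightarrow>
     (\<exists>d. \<forall>j\<in>T. \<phi> j \<in> carrier (poly_ring S) \<and> homogeneous d (\<phi> j)) \<and>
     (\<forall>j. j \<notin> T \<longrightarrow> \<phi> j = 0) \<and>
     (\<exists>L\<in>X. defined_at \<phi> L) \<and>
     (\<forall>L\<in>X. defined_at \<phi> L \<longrightarrow> value_at \<phi> L \<in> Y)"

definition rational_equiv ::
    "('i, 'a::field) point set \<Rightarrow> ('j \<Rightarrow> ('i, 'a) mpoly) \<Rightarrow> ('j \<Rightarrow> ('i, 'a) mpoly) \<Rightarrow> bool" where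
  "rational_equiv X \<phi> \<psi> \<longleftrightarrow> (\<forall>i j. \<forall>L\<in>X. vanishes_at (\<phi> i * \<psi> j - \<phi> j * \<psi> i) L)"

definition rational_maps :: "'i set \<Rightarrow> ('i, 'a::field) point set \<Rightarrow> 'j set \<Rightarrow> ('j, 'a) point set \<Rightarrow>
    ('j \<Rightarrow> ('i, 'a) mpoly) set set" where
  "rational_maps S X T Y =
     {{\<psi>. rational_rep S X T Y \<psi> \<and> rational_equiv X \<phi> \<psi>} | \<phi>. rational_rep S X T Y \<phi>}"

text \<open>A morphism is a rational map with, at each point, a representative defined there; it is
  recorded as the induced map on points.\<close>

definition variety_morphisms :: "'i set \<Rightarrow> ('i, 'a::field) point set \<Rightarrow> 'j set \<Rightarrow> ('j, 'a) point set \<Rightarrow>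
    (('i, 'a) point \<Rightarrow> ('j, 'a) point) set" where
  "variety_morphisms S X T Y = {g \<in> X \<rightarrow>\<^sub>E Y. \<exists>R\<in>rational_maps S X T Y.
     \<forall>L\<in>X. \<exists>\<phi>\<in>R. defined_at \<phi> L \<and> g L = value_at \<phi> L}"

text \<open>An object is a subset of a projective space together with the index set of the ambient
  homogeneous coordinates.\<close>

type_synonym ('i, 'a) variety_cat =
  "('i set \<times> ('i, 'a) point set, ('i, 'a) point \<Rightarrow> ('i, 'a) point) cat"

definition variety_category ::
    "('i set \<times> ('i, 'a::field) point set) set \<Rightarrow> ('i, 'a) variety_cat" where
  "variety_category \<O> = \<lparr>Obj = \<O>,
     Hom = (\<lambda>(S, X) (T, Y). variety_morphisms S X T Y),
     Ident = (\<lambda>(S, X). restrict id X),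
     Comp = (\<lambda>(S, X) _ _ g f. compose X g f)\<rparr>"

definition smooth_plane_curves :: "(3, 'a::field) variety_cat" where
  "smooth_plane_curves =
     variety_category {(UNIV, X) | X. projective_plane_curve X \<and> smooth UNIV X}"


section \<open>Quiver Grassmannians\<close>

text \<open>A quiver is a finite directed multigraph.\<close>

record ('v, 'e, 'i, 'a) quiver_rep =
  rep_space :: "'v \<Rightarrow> ('i \<Rightarrow> 'a) set"
  rep_map :: "'e \<Rightarrow> ('i \<Rightarrow> 'a) \<Rightarrow> ('i \<Rightarrow> 'a)"

definition representation ::
    "('v, 'e) pre_digraph \<Rightarrow> ('v, 'e, 'i, 'a::field) quiver_rep \<Rightarrow> bool" where
  "representation Q W \<longleftrightarrow>
     (\<forall>v\<in>verts Q. vec.subspace (rep_space W v) \<and> (\<exists>B. finite B \<and> rep_space W v \<subseteq> vec.span B)) \<and>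
     (\<forall>a\<in>arcs Q. Vector_Spaces.linear vscale vscale (rep_map W a) \<and>
        rep_map W a ` rep_space W (tail Q a) \<subseteq> rep_space W (head Q a))"

definition subrepresentation ::
    "('v, 'e) pre_digraph \<Rightarrow> ('v, 'e, 'i, 'a::field) quiver_rep \<Rightarrow> ('v \<Rightarrow> ('i \<Rightarrow> 'a) set) \<Rightarrow> bool"
  where
  "subrepresentation Q W U \<longleftrightarrow>
     (\<forall>v\<in>verts Q. vec.subspace (U v) \<and> U v \<subseteq> rep_space W v) \<and>
     (\<forall>a\<in>arcs Q. rep_map W a ` U (tail Q a) \<subseteq> U (head Q a))"

definition quiver_Grassmannian :: "('v, 'e) pre_digraph \<Rightarrow> ('v, 'e, 'i, 'a::field) quiver_rep \<Rightarrow>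
    ('v \<Rightarrow> nat) \<Rightarrow> ('v \<Rightarrow> ('i \<Rightarrow> 'a) set) set" where
  "quiver_Grassmannian Q W e =
     {U \<in> extensional (verts Q). subrepresentation Q W U \<and> (\<forall>v\<in>verts Q. vec.dim (U v) = e v)}"


section \<open>The representations attached to plane curves\<close>

datatype vertex = Vertex1 | Vertex2 | Vertex3

datatype arrow = Arrow_f | Arrow_phi 3

definition quiverQ :: "(vertex, arrow) pre_digraph" where
  "quiverQ = \<lparr>verts = UNIV, arcs = UNIV, tail = (\<lambda>_. Vertex2),
     head = case_arrow Vertex1 (\<lambda>_. Vertex3)\<rparr>"

definition monomials :: "nat \<Rightarrow> 3 expo set" where
  "monomials d = {m. tdeg m = d}"

text \<open>A linear form \<open>\<Sum>\<^sub>m c m x\<^sub>m\<close> on \<open>K\<^bsup>monomials d\<^esup>\<close> is given by its coefficients \<open>c\<close>;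
  \<open>form_polynomial d c\<close> is its pullback \<open>\<Sum>\<^sub>m c m x\<^sup>m\<close> under the Veronese embedding.\<close>

definition linear_form :: "nat \<Rightarrow> (3 expo \<Rightarrow> 'a::field) \<Rightarrow> (3 expo \<Rightarrow> 'a) \<Rightarrow> 'a" where
  "linear_form d c v = (\<Sum>m\<in>monomials d. c m * v m)"

definition form_polynomial :: "nat \<Rightarrow> (3 expo \<Rightarrow> 'a::field) \<Rightarrow> (3, 'a) mpoly" where
  "form_polynomial d c = (\<Sum>m\<in>monomials d. Poly_Mapping.single m (c m))"

text \<open>The one-dimensional space at the first vertex is encoded by the single coordinate
  \<open>0\<close>. The index set at the third vertex consists of the exponents of degree \<open>d - 1\<close>;
  it is empty for \<open>d = 0\<close>.\<close>

definition repV :: "nat \<Rightarrow> (3 expo \<Rightarrow> 'a::field) \<Rightarrow> (vertex, arrow, 3 expo, 'a) quiver_rep" where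
  "repV d c = \<lparr>
     rep_space = case_vertex (coord_space {0}) (coord_space (monomials d))
       (coord_space {n. tdeg n + 1 = d}),
     rep_map = case_arrow
       (\<lambda>v n. if n = 0 then linear_form d c v else 0)
       (\<lambda>i v n. if tdeg n + 1 = d then v (n + Poly_Mapping.single i 1) else 0)\<rparr>"

text \<open>The quiver Grassmannian for the dimension vector \<open>(0, 1, 1)\<close>, identified with a subset of
  \<open>\<P>(K\<^bsup>monomials d\<^esup>)\<close> via the component at the second vertex.\<close>

definition GrV :: "nat \<Rightarrow> (3 expo \<Rightarrow> 'a::field) \<Rightarrow> (3 expo, 'a) point set" where
  "GrV d c = (\<lambda>U. U Vertex2) ` quiver_Grassmannian quiverQ (repV d c) (case_vertex 0 1 1)"

definition GR_category :: "(3 expo, 'a::field) variety_cat" where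
  "GR_category = variety_category
     {(monomials d, GrV d c) | d c. Factorial_Ring.irreducible (form_polynomial d c)}"

definition GR_smooth_category :: "(3 expo, 'a::field) variety_cat" where
  "GR_smooth_category = full_subcategory GR_category (\<lambda>(S, X). smooth S X)"

lemma tdeg_alt: "tdeg m = (\<Sum>i\<in>UNIV. Poly_Mapping.lookup m i)" for m :: "3 expo"
  unfolding tdeg_def by (rule sum.mono_neutral_left) (auto simp: in_keys_iff)

lemma finite_monomials: "finite (monomials d)"
proof -
  have "monomials d \<subseteq> (\<lambda>g. Abs_poly_mapping g) ` (UNIV \<rightarrow>\<^sub>E {..d})"
  proof
    fix m assume "m \<in> monomials d"
    then have "Poly_Mapping.lookup m i \<le> d" for i
      using member_le_sum[of i UNIV "Poly_Mapping.lookup m"] by (auto simp: monomials_def tdeg_alt)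
    then show "m \<in> (\<lambda>g. Abs_poly_mapping g) ` (UNIV \<rightarrow>\<^sub>E {..d})"
      by (intro image_eqI[of _ _ "Poly_Mapping.lookup m"]) auto
  qed
  then show ?thesis
    by (rule finite_subset) (auto intro!: finite_PiE finite_imageI)
qed

lemma coord_space_subspace: "vec.subspace (coord_space S)"
  by (auto simp: vec.subspace_def coord_space_def vscale_def)

lemma coord_space_fin_dim:
  fixes S :: "'i set"
  assumes "finite S"
  shows "\<exists>B. finite B \<and> (coord_space S :: ('i \<Rightarrow> 'a::field) set) \<subseteq> vec.span B"
proof (intro exI conjI subsetI)
  let ?b = "\<lambda>i j::'i. if j = i then (1::'a) else 0"
  show "finite (?b ` S)" using assms by simp
  fix v :: "'i \<Rightarrow> 'a" assume v: "v \<in> coord_space S"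
  have s: "(\<Sum>i\<in>A. vscale (v i) (?b i)) j = (\<Sum>i\<in>A. vscale (v i) (?b i) j)" for A j
    by (induction A rule: infinite_finite_induct) auto
  have "v = (\<Sum>i\<in>S. vscale (v i) (?b i))"
  proof
    fix j
    have "(\<Sum>i\<in>S. vscale (v i) (?b i) j) = v j"
      using v assms by (auto simp: vscale_def coord_space_def if_distrib[of "\<lambda>x. _ * x"] cong: if_cong)
    then show "v j = (\<Sum>i\<in>S. vscale (v i) (?b i)) j" by (simp only: s)
  qed
  then show "v \<in> vec.span (?b ` S)"
    by (metis (no_types, lifting) vec.span_sum vec.span_scale vec.span_base imageI)
qed

lemma representation_repV: "representation quiverQ (repV d c)"
proof -
  have "{n. tdeg n + 1 = d} \<subseteq> monomials (d - 1)"
    by (auto simp: monomials_def)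
  then have "finite {n :: 3 expo. tdeg n + 1 = d}"
    using finite_monomials finite_subset by blast
  then have 1: "vec.subspace (rep_space (repV d c) v) \<and>
      (\<exists>B. finite B \<and> rep_space (repV d c) v \<subseteq> vec.span B)" for v
    by (cases v) (auto simp: repV_def coord_space_subspace finite_monomials intro!: coord_space_fin_dim)
  have 2: "Vector_Spaces.linear vscale vscale (rep_map (repV d c) a)" for a
    by (cases a; unfold_locales)
      (auto simp: repV_def vscale_def fun_eq_iff linear_form_def algebra_simps sum.distrib sum_distrib_left)
  have 3: "rep_map (repV d c) a ` rep_space (repV d c) (tail quiverQ a)
      \<subseteq> rep_space (repV d c) (head quiverQ a)" for a
    by (cases a) (auto simp: repV_def quiverQ_def coord_space_def)
  show ?thesis using 1 2 3 by (simp add: representation_def)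
qed

end

theory Submission
  imports Defs "HOL-Computational_Algebra.Polynomial_Factorial"
begin

text \<open>A non-singular plane curve is the zero set of an irreducible form \<open>F\<close>, whose degree \<open>d\<close> is
  determined by the curve (Nullstellensatz and unique factorization). The rank condition satisfied
  by the lines \<open>L\<close> in \<open>GrV d c\<close> cuts out the Veronese surface, and the linear form cuts out of it the
  image of the curve, so \<open>GrV d c\<close> is the image of the curve under the \<open>d\<close>-uple embedding \<open>\<nu>\<^sub>d\<close>. Since
  \<open>\<nu>\<^sub>d\<close> is an isomorphism onto its image, which preserves dimensions and tangent spaces, the functor
  \<open>X \<mapsto> \<nu>\<^sub>d X\<close>, \<open>g \<mapsto> \<nu>\<^sub>e \<circ> g \<circ> \<nu>\<^sub>d\<inverse>\<close> is an isomorphism of categories.\<close>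

section \<open>Substitution homomorphisms\<close>

text \<open>The obstacle is that the definitions speak of prime homogeneous ideals, of common
  kernels of partial derivatives and of classes of representatives, none of which is easily carried
  along a map. Each is replaced by a description through points and forms. Nonempty varieties become
  \<open>irreducible_closed\<close> sets; this equivalence needs the Nullstellensatz in the form
  that a prime ideal has a zero at which a given polynomial outside it does not vanish. Morphisms
  become \<open>regular_map\<close>s. Tangent vectors are read off from the linear coefficient of
  F(v + T w), so that the chain rule is a composition of substitutions in every characteristic.
  Dimension one rests on the fact that an irreducible closed set on which two coprime forms vanish
  is a point; the third variable is eliminated by pseudo-division instead of a resultant. The degree
  has to be recovered from the curve before the functor is even defined. Degree 0 never occurs, as
  nonzero constants are units.\<close>

locale ring_morph =
  fixes h :: "'a::comm_ring_1 \<Rightarrow> 'b::comm_ring_1"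
  assumes add: "h (x + y) = h x + h y"
    and mult: "h (x * y) = h x * h y"
    and one: "h 1 = 1"
begin

lemma zero: "h 0 = 0"
  using add[of 0 0] by simp

lemma uminus: "h (- x) = - h x"
  using add[of x "- x"] by (simp add: zero eq_neg_iff_add_eq_0 add.commute)

lemma diff: "h (x - y) = h x - h y"
  using add[of x "- y"] by (simp add: uminus)

lemma sum: "h (sum f A) = (\<Sum>i\<in>A. h (f i))"
  by (induction A rule: infinite_finite_induct) (simp_all add: zero add)

lemma power: "h (x ^ n) = h x ^ n"
  by (induction n) (simp_all add: one mult)

lemma prod: "h (prod f A) = (\<Prod>i\<in>A. h (f i))"
  by (induction A rule: infinite_finite_induct) (simp_all add: one mult)

end

lemma ring_morph_comp: "ring_morph g \<Longrightarrow> ring_morph h \<Longrightarrow> ring_morph (\<lambda>x. g (h x))"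
  by (simp add: ring_morph_def)

lemma ring_morph_id: "ring_morph (\<lambda>x. x)"
  by (simp add: ring_morph_def)

lemma ring_morph_pCons: "ring_morph (\<lambda>c. [:c:])"
  by (simp add: ring_morph_def one_pCons mult.commute)

lemma ring_morph_poly: "ring_morph (\<lambda>p. poly p x)"
  by (simp add: ring_morph_def)

lemma ring_morph_single: "ring_morph (Poly_Mapping.single (0 :: 'b::comm_monoid_add))"
  by (simp add: ring_morph_def single_add mult_single)

lemma ring_morph_map_poly:
  assumes "ring_morph h"
  shows "ring_morph (map_poly h)"
proof -
  interpret ring_morph h by fact
  have [simp]: "h 0 = 0" "h 1 = 1"
    by (simp_all add: zero one)
  show ?thesis
    by standard (auto intro!: poly_eqI simp: coeff_map_poly add coeff_mult sum mult coeff_1)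
qed

text \<open>The target is an arbitrary commutative ring and \<open>\<phi>\<close> acts on the
  coefficients: evaluation, change of variables, grading, passage to univariate polynomials and
  differentials are all instances of this one map.\<close>

definition psubst :: "('a \<Rightarrow> 'b) \<Rightarrow> ('i \<Rightarrow> 'b) \<Rightarrow> ('i, 'a::field) mpoly \<Rightarrow> 'b::comm_ring_1" where
  "psubst \<phi> x F = (\<Sum>m\<in>Poly_Mapping.keys F. \<phi> (Poly_Mapping.lookup F m) *
     (\<Prod>i\<in>Poly_Mapping.keys m. x i ^ Poly_Mapping.lookup m i))"

abbreviation Const :: "'a::field \<Rightarrow> ('i, 'a) mpoly" where
  "Const \<equiv> Poly_Mapping.single 0"

definition Var :: "'i \<Rightarrow> ('i, 'a::field) mpoly" where
  "Var i = Poly_Mapping.single (Poly_Mapping.single i 1) 1"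

lemma monomial_value_add:
  fixes x :: "'i \<Rightarrow> 'b::comm_ring_1"
  shows "(\<Prod>i\<in>Poly_Mapping.keys (m + n). x i ^ Poly_Mapping.lookup (m + n) i) =
    (\<Prod>i\<in>Poly_Mapping.keys m. x i ^ Poly_Mapping.lookup m i) *
    (\<Prod>i\<in>Poly_Mapping.keys n. x i ^ Poly_Mapping.lookup n i)"
proof -
  let ?A = "Poly_Mapping.keys m \<union> Poly_Mapping.keys n"
  have *: "(\<Prod>i\<in>Poly_Mapping.keys k. x i ^ Poly_Mapping.lookup k i) =
      (\<Prod>i\<in>?A. x i ^ Poly_Mapping.lookup k i)" if "Poly_Mapping.keys k \<subseteq> ?A" for k
    using that by (intro prod.mono_neutral_left) (auto simp: in_keys_iff)
  have "(\<Prod>i\<in>Poly_Mapping.keys (m + n). x i ^ Poly_Mapping.lookup (m + n) i) =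
      (\<Prod>i\<in>?A. x i ^ Poly_Mapping.lookup (m + n) i)"
    using keys_add by (rule *)
  also have "\<dots> = (\<Prod>i\<in>?A. x i ^ Poly_Mapping.lookup m i) * (\<Prod>i\<in>?A. x i ^ Poly_Mapping.lookup n i)"
    by (simp add: lookup_add power_add prod.distrib)
  finally show ?thesis
    using *[of m] *[of n] by simp
qed

lemma psubst_single:
  assumes "ring_morph \<phi>"
  shows "psubst \<phi> x (Poly_Mapping.single m c) =
    \<phi> c * (\<Prod>i\<in>Poly_Mapping.keys m. x i ^ Poly_Mapping.lookup m i)"
  by (simp add: psubst_def ring_morph.zero[OF assms])

lemma psubst_zero: "psubst \<phi> x 0 = 0"
  by (simp add: psubst_def)

lemma psubst_add:
  assumes "ring_morph \<phi>"
  shows "psubst \<phi> x (F + G) = psubst \<phi> x F + psubst \<phi> x G"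
proof -
  interpret ring_morph \<phi> by fact
  show ?thesis
    unfolding psubst_def by (rule setsum_keys_plus_distrib) (simp_all add: zero add algebra_simps)
qed

lemma mpoly_sum_single:
  fixes F :: "'b \<Rightarrow>\<^sub>0 'c::comm_monoid_add"
  shows "F = (\<Sum>m\<in>Poly_Mapping.keys F. Poly_Mapping.single m (Poly_Mapping.lookup F m))"
  by (rule poly_mapping_eqI)
    (simp add: lookup_sum lookup_single when_def in_keys_iff)

lemma mpoly_induct_single [case_names zero add single]:
  fixes F :: "'b \<Rightarrow>\<^sub>0 'c::comm_monoid_add"
  assumes "P 0" "\<And>F G. P F \<Longrightarrow> P G \<Longrightarrow> P (F + G)" "\<And>m c. P (Poly_Mapping.single m c)"
  shows "P F"
proof -
  have "P (\<Sum>m\<in>A. Poly_Mapping.single m (Poly_Mapping.lookup F m))" for A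
    using assms by (induction A rule: infinite_finite_induct) auto
  then show ?thesis
    using mpoly_sum_single[of F] by metis
qed

lemma psubst_mult:
  assumes "ring_morph \<phi>"
  shows "psubst \<phi> x (F * G) = psubst \<phi> x F * psubst \<phi> x G"
proof -
  interpret ring_morph \<phi> by fact
  show ?thesis
  proof (induction F rule: mpoly_induct_single)
    case (single m c)
    show ?case
    proof (induction G rule: mpoly_induct_single)
      case (single n d)
      show ?case
        by (simp add: mult_single psubst_single[OF assms] mult monomial_value_add mult_ac)
    qed (simp_all add: distrib_left psubst_add[OF assms] psubst_zero)
  qed (simp_all add: distrib_right psubst_add[OF assms] psubst_zero)
qed

lemma ring_morph_psubst:
  assumes "ring_morph \<phi>"
  shows "ring_morph (psubst \<phi> x)"
proof
  show "psubst \<phi> x 1 = 1"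
    using psubst_single[OF assms, of x 0 1] ring_morph.one[OF assms] by simp
qed (simp_all add: psubst_add psubst_mult assms)

lemma psubst_Const:
  "ring_morph \<phi> \<Longrightarrow> psubst \<phi> x (Const c) = \<phi> c"
  by (simp add: psubst_single)

lemma psubst_Var:
  "ring_morph \<phi> \<Longrightarrow> psubst \<phi> x (Var i) = x i"
  by (simp add: Var_def psubst_single ring_morph.one)

lemma Var_power: "Var i ^ n = Poly_Mapping.single (Poly_Mapping.single i n) 1"
  by (induction n) (simp_all add: Var_def mult_single flip: single_add)

lemma single_eq_Const_prod_Var:
  fixes c :: "'a::field"
  shows "Poly_Mapping.single m c = Const c * (\<Prod>i\<in>Poly_Mapping.keys m. Var i ^ Poly_Mapping.lookup m i)"
proof -
  have "(\<Prod>i\<in>A. Poly_Mapping.single (Poly_Mapping.single i (Poly_Mapping.lookup m i)) (1::'a)) =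
      Poly_Mapping.single (\<Sum>i\<in>A. Poly_Mapping.single i (Poly_Mapping.lookup m i)) 1" for A
    by (induction A rule: infinite_finite_induct) (simp_all add: mult_single)
  then show ?thesis
    by (simp add: Var_power mult_single flip: mpoly_sum_single)
qed

lemma mpoly_induct [case_names Const Var add mult]:
  assumes "\<And>c. P (Const c)" "\<And>i. P (Var i)" "\<And>F G. P F \<Longrightarrow> P G \<Longrightarrow> P (F + G)"
    and "\<And>F G. P F \<Longrightarrow> P G \<Longrightarrow> P (F * G)"
  shows "P F"
proof (induction F rule: mpoly_induct_single)
  case zero
  then show ?case using assms(1)[of 0] by simp
next
  case (single m c)
  have pow: "P (Var i ^ n)" for i n
    using assms(1)[of 1] by (induction n) (auto intro: assms)
  have "P (\<Prod>i\<in>A. Var i ^ Poly_Mapping.lookup m i)" for A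
    using assms(1)[of 1] by (induction A rule: infinite_finite_induct) (auto intro: assms pow)
  then show ?case
    by (subst single_eq_Const_prod_Var) (auto intro: assms)
qed (rule assms)

text \<open>Constants and variables generate the ring. Nearly every identity between composite
  substitutions below is checked on these generators only.\<close>

lemma ring_morph_mpoly_eqI:
  assumes "ring_morph g" "ring_morph h"
    and "\<And>c. g (Const c) = h (Const c)" "\<And>i. g (Var i) = h (Var i)"
  shows "g F = h F"
  by (induction F rule: mpoly_induct)
    (simp_all add: assms ring_morph.add[OF assms(1)] ring_morph.add[OF assms(2)]
      ring_morph.mult[OF assms(1)] ring_morph.mult[OF assms(2)])

lemma peval_eq_psubst: "peval F v = psubst (\<lambda>c. c) v F"
  by (simp add: peval_def psubst_def)

lemma ring_morph_peval: "ring_morph (\<lambda>F. peval F v)"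
  unfolding peval_eq_psubst by (rule ring_morph_psubst[OF ring_morph_id])

interpretation peval: ring_morph "\<lambda>F. peval F v" for v
  by (rule ring_morph_peval)

lemma peval_Const: "peval (Const c) v = c"
  by (simp add: peval_eq_psubst psubst_Const[OF ring_morph_id])

lemma peval_Var: "peval (Var i) v = v i"
  by (simp add: peval_eq_psubst psubst_Var[OF ring_morph_id])

lemma peval_single:
  "peval (Poly_Mapping.single m c) v = c * (\<Prod>i\<in>Poly_Mapping.keys m. v i ^ Poly_Mapping.lookup m i)"
  by (simp add: peval_eq_psubst psubst_single[OF ring_morph_id])

lemmas peval_simps = peval.add peval.mult peval.one peval.zero peval.uminus peval.diff peval.sum
  peval.prod peval.power peval_Const peval_Var

lemma ring_morph_poly_eqI:
  assumes "ring_morph g" "ring_morph h"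
    and "\<And>c. g [:c:] = h [:c:]" "g [:0, 1:] = h [:0, 1:]"
  shows "g p = h p"
proof (induction p)
  case 0
  show ?case
    by (simp add: ring_morph.zero[OF assms(1)] ring_morph.zero[OF assms(2)])
next
  case (pCons a p)
  have "k (pCons a p) = k [:a:] + k [:0, 1:] * k p" if "ring_morph k" for k :: "'a poly \<Rightarrow> 'b"
  proof -
    have "pCons a p = [:a:] + [:0, 1:] * p"
      by simp
    then show ?thesis
      using ring_morph.add[OF that, of "[:a:]" "[:0, 1:] * p"] ring_morph.mult[OF that] by metis
  qed
  from this[OF assms(1)] this[OF assms(2)] show ?case
    by (simp only: assms(3,4) pCons)
qed

section \<open>The Nullstellensatz\<close>

text \<open>In a finite field the product of all X - a, increased by 1, is nonconstant and has no
  root.\<close>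

lemma infinite_alg_closed: "infinite (UNIV :: 'a::alg_closed_field set)"
proof
  assume fin: "finite (UNIV :: 'a set)"
  define p where "p = (\<Prod>a\<in>(UNIV :: 'a set). [:- a, 1:])"
  have "p \<noteq> 0" "degree p = card (UNIV :: 'a set)"
    by (auto simp: p_def fin degree_prod_sum_eq prod_zero_iff)
  then have "degree (p + 1) > 0"
    using fin by (simp add: degree_add_eq_left finite_UNIV_card_ge_0)
  then obtain x where "poly (p + 1) x = 0"
    using alg_closed_imp_poly_has_root by blast
  moreover have "poly p x = 0"
    using fin by (auto simp: p_def poly_prod prod_zero_iff)
  ultimately show False
    by simp
qed

text \<open>Prime ideals of a whole ring type, so that univariate polynomials over any such ring can
  be used. The \<open>primeideal\<close>s of \<open>poly_ring S\<close> in the definitions are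
  converted by \<open>prime_id_restrict_vars\<close>.\<close>

locale prime_id =
  fixes J :: "'r::comm_ring_1 set"
  assumes zero: "0 \<in> J"
    and add: "x \<in> J \<Longrightarrow> y \<in> J \<Longrightarrow> x + y \<in> J"
    and mult_left: "x \<in> J \<Longrightarrow> r * x \<in> J"
    and one: "1 \<notin> J"
    and prime: "x * y \<in> J \<Longrightarrow> x \<in> J \<or> y \<in> J"
begin

lemma mult_right: "x \<in> J \<Longrightarrow> x * r \<in> J"
  using mult_left[of x r] by (simp add: mult.commute)

lemma uminus: "x \<in> J \<Longrightarrow> - x \<in> J"
  using mult_left[of x "-1"] by simp

lemma diff: "x \<in> J \<Longrightarrow> y \<in> J \<Longrightarrow> x - y \<in> J"
  using add[of x "- y"] uminus[of y] by simp

lemma add_iff: "x \<in> J \<Longrightarrow> x + y \<in> J \<longleftrightarrow> y \<in> J"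
  using add[of x y] diff[of "x + y" x] by auto

lemma diff_iff: "x - y \<in> J \<Longrightarrow> x \<in> J \<longleftrightarrow> y \<in> J"
  using add[of "x - y" y] diff[of x "x - y"] by auto

lemma sum: "(\<And>i. i \<in> A \<Longrightarrow> f i \<in> J) \<Longrightarrow> sum f A \<in> J"
  by (induction A rule: infinite_finite_induct) (auto simp: zero add)

lemma power: "x ^ n \<in> J \<Longrightarrow> x \<in> J"
  by (induction n) (use one prime in auto)

end

lemma prime_id_vimage:
  assumes "prime_id J" "ring_morph h"
  shows "prime_id {x. h x \<in> J}"
proof -
  interpret prime_id J by fact
  interpret h: ring_morph h by fact
  show ?thesis
    by standard (auto simp: h.zero h.add h.mult h.one zero add mult_left one prime)
qed

lemma pseudo_division:
  fixes P F :: "'r::comm_ring_1 poly"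
  assumes "P \<noteq> 0"
  obtains k Q R where "smult (lead_coeff P ^ k) F = P * Q + R" "R = 0 \<or> degree R < degree P"
proof -
  obtain Q R where QR: "pseudo_divmod F P = (Q, R)"
    by fastforce
  show ?thesis
    using pseudo_divmod[OF assms QR] that by blast
qed

text \<open>Let \<open>J0\<close> be the contraction of \<open>J\<close>. Unless \<open>J\<close> is the extension of \<open>J0\<close>, \<open>J\<close> is determined up to
  leading coefficients by an element \<open>P\<close> of minimal degree modulo \<open>J0\<close>; a root of the image of \<open>P\<close> is
  then a common zero. A constant in the ideal generated by \<open>J\<close> and \<open>g\<close> keeps \<open>g\<close> from vanishing there.\<close>

lemma prime_id_extension:
  fixes J :: "'r::comm_ring_1 poly set"
  assumes J: "prime_id J" and g: "g \<notin> J"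
  obtains b where "[:b:] \<notin> J"
    and "\<And>\<phi> :: 'r \<Rightarrow> 'a::alg_closed_field. ring_morph \<phi> \<Longrightarrow> (\<And>c. [:c:] \<in> J \<Longrightarrow> \<phi> c = 0) \<Longrightarrow>
      \<phi> b \<noteq> 0 \<Longrightarrow> \<exists>t. (\<forall>F\<in>J. poly (map_poly \<phi> F) t = 0) \<and> poly (map_poly \<phi> g) t \<noteq> 0"
proof -
  interpret prime_id J by fact
  define J0 where "J0 = {c. [:c:] \<in> J}"
  \<comment> \<open>The extension of \<open>J0\<close>, that is, the kernel of reducing the
    coefficients modulo \<open>J0\<close>.\<close>
  define N where "N = {F. \<forall>n. coeff F n \<in> J0}"
  interpret J0: prime_id J0
    unfolding J0_def by (rule prime_id_vimage[OF J ring_morph_pCons])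
  have smult: "smult c F \<in> J" if "F \<in> J" for c F
    using mult_left[OF that, of "[:c:]"] by simp
  have smult_prime: "F \<in> J" if "smult (c ^ k) F \<in> J" "c \<notin> J0" for c F k
    using prime[of "[:c ^ k:]" F] that J0.power[of c k] by (auto simp: J0_def)
  have NJ: "F \<in> J" if "F \<in> N" for F
  proof -
    have "monom (coeff F i) i \<in> J" for i
      using mult_left[of "[:coeff F i:]" "monom 1 i"] that by (simp add: N_def J0_def smult_monom)
    then have "(\<Sum>i\<le>degree F. monom (coeff F i) i) \<in> J"
      by (intro sum) auto
    then show ?thesis
      by (simp add: poly_as_sum_of_monoms)
  qed
  have N_mult: "F * G \<in> N" if "F \<in> N" for F G
    using that by (auto simp: N_def coeff_mult intro!: J0.sum J0.mult_right)
  \<comment> \<open>This simulates polynomials over the domain of residues modulo \<open>J0\<close>: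
    dropping the top coefficients that lie in \<open>J0\<close> leaves a representative whose
    leading coefficient is nonzero there.\<close>
  have trunc: "\<exists>F'. F - F' \<in> N \<and> lead_coeff F' \<notin> J0 \<and> degree F' \<le> degree F" if "F \<notin> N" for F
  proof -
    define A where "A = {n. coeff F n \<notin> J0}"
    have A: "A \<subseteq> {..degree F}"
      using J0.zero by (auto simp: A_def intro!: le_degree)
    then have fin: "finite A"
      by (rule finite_subset) simp
    have "A \<noteq> {}"
      using that by (auto simp: A_def N_def)
    then have M: "Max A \<in> A" "Max A \<le> degree F"
      using Max_in[OF fin] A by auto
    define F' where "F' = poly_cutoff (Suc (Max A)) F"
    have c: "coeff F' (Max A) = coeff F (Max A)"
      by (simp add: F'_def coeff_poly_cutoff)
    then have "coeff F' (Max A) \<noteq> 0"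
      using M J0.zero by (auto simp: A_def)
    moreover have "degree F' \<le> Max A"
      by (rule degree_le) (simp add: F'_def coeff_poly_cutoff)
    ultimately have "degree F' = Max A"
      using le_degree by (metis le_antisym)
    moreover have "F - F' \<in> N"
    proof -
      have "n \<in> A \<Longrightarrow> n \<le> Max A" for n
        using fin by simp
      then show ?thesis
        using J0.zero by (force simp: N_def F'_def coeff_poly_cutoff A_def)
    qed
    ultimately show ?thesis
      using M c by (auto simp: A_def)
  qed
  show ?thesis
  proof (cases "J = N")
    case True
    then obtain n where n: "coeff g n \<notin> J0"
      using g by (auto simp: N_def)
    \<comment> \<open>If \<open>\<phi>\<close> does not kill this coefficient, the image of
      \<open>g\<close> is a nonzero polynomial and has a non-root in the infinite field; all of
      \<open>J\<close> maps to 0, so any such non-root serves.\<close>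
    show ?thesis
    proof (rule that[of "coeff g n"])
      show "[:coeff g n:] \<notin> J"
        using n by (simp add: J0_def)
      fix \<phi> :: "'r \<Rightarrow> 'a"
      assume \<phi>: "ring_morph \<phi>" and kill: "\<And>c. [:c:] \<in> J \<Longrightarrow> \<phi> c = 0" and b: "\<phi> (coeff g n) \<noteq> 0"
      have [simp]: "\<phi> 0 = 0"
        by (rule ring_morph.zero[OF \<phi>])
      have N0: "map_poly \<phi> F = 0" if "F \<in> N" for F
      proof (rule poly_eqI)
        fix n
        have "[:coeff F n:] \<in> J"
          using that by (simp add: N_def J0_def)
        from kill[OF this] show "coeff (map_poly \<phi> F) n = coeff 0 n"
          by (simp add: coeff_map_poly)
      qed
      have "coeff (map_poly \<phi> g) n \<noteq> 0"
        using b by (simp add: coeff_map_poly)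
      then have "map_poly \<phi> g \<noteq> 0"
        by auto
      then have "finite {t. poly (map_poly \<phi> g) t = 0}"
        by (rule poly_roots_finite)
      then obtain t where "poly (map_poly \<phi> g) t \<noteq> 0"
        using ex_new_if_finite[OF infinite_alg_closed] by blast
      moreover have "map_poly \<phi> F = 0" if "F \<in> J" for F
        using N0 that True by simp
      ultimately show "\<exists>t. (\<forall>F\<in>J. poly (map_poly \<phi> F) t = 0) \<and> poly (map_poly \<phi> g) t \<noteq> 0"
        by auto
    qed
  next
    case False
    \<comment> \<open>Candidates for \<open>P\<close>: elements of \<open>J\<close> that are
      honestly nonzero modulo \<open>J0\<close>, measured by their true degree.\<close>
    define B where "B F \<longleftrightarrow> F \<in> J \<and> lead_coeff F \<notin> J0" for F
    from False NJ obtain F0 where F0: "F0 \<in> J" "F0 \<notin> N"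
      by blast
    then have "\<exists>F. B F"
      using trunc[of F0] NJ diff_iff by (auto simp: B_def)
    then obtain P where P: "B P" and Pmin: "\<And>F. B F \<Longrightarrow> degree P \<le> degree F"
      using ex_has_least_nat[of B _ degree] by blast
    have low: "F \<in> N" if "F \<in> J" "degree F < degree P" for F
    proof (rule ccontr)
      assume "F \<notin> N"
      then obtain F' where "F - F' \<in> N" "lead_coeff F' \<notin> J0" "degree F' \<le> degree F"
        using trunc by blast
      then show False
        using Pmin[of F'] that NJ diff_iff by (auto simp: B_def)
    qed
    have P0: "P \<noteq> 0" and Pd: "degree P > 0"
    proof -
      show "P \<noteq> 0"
        using P J0.zero by (auto simp: B_def)
      show "degree P > 0"
      proof (rule ccontr)
        assume "\<not> degree P > 0"
        then have "P = [:lead_coeff P:]"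
          by (metis degree_0_id gr0I)
        then show False
          using P unfolding B_def J0_def by auto
      qed
    qed
    \<comment> \<open>The ideal generated by \<open>J\<close> and \<open>g\<close>. The aim is a
      constant in it outside \<open>J0\<close>, which \<open>R\<close> of least degree will turn out
      to be.\<close>
    define I where "I = {j + u * g | j u. j \<in> J}"
    have I_add: "x + y \<in> I" if xy: "x \<in> I" "y \<in> I" for x y
    proof -
      obtain j u j' u' where "x = j + u * g" "y = j' + u' * g" "j \<in> J" "j' \<in> J"
        using xy unfolding I_def by blast
      then have "x + y = (j + j') + (u + u') * g" "j + j' \<in> J"
        by (auto simp: algebra_simps add)
      then show ?thesis
        unfolding I_def by blast
    qed
    have I_mult: "r * x \<in> I" if x: "x \<in> I" for x r
    proof -
      obtain j u where "x = j + u * g" "j \<in> J"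
        using x unfolding I_def by blast
      then have "r * x = r * j + (r * u) * g" "r * j \<in> J"
        by (auto simp: algebra_simps mult_left mult_right)
      then show ?thesis
        unfolding I_def by blast
    qed
    have JI: "j \<in> I" if "j \<in> J" for j
      using that unfolding I_def by (intro CollectI exI[of _ j] exI[of _ 0]) simp
    have gI: "g \<in> I"
      using zero unfolding I_def by (intro CollectI exI[of _ 0] exI[of _ 1]) simp
    have I_diff: "x - y * z \<in> I" if "x \<in> I" "y \<in> I" for x y z
      using I_add[OF that(1) I_mult[OF that(2), of "- z"]] by (simp add: algebra_simps)
    define C where "C F \<longleftrightarrow> F \<in> I \<and> F \<notin> J \<and> lead_coeff F \<notin> J0" for F
    have C_trunc: "\<exists>F'. C F' \<and> degree F' \<le> degree F" if F: "F \<in> I" "F \<notin> J" for F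
    proof -
      obtain F' where F': "F - F' \<in> N" "lead_coeff F' \<notin> J0" "degree F' \<le> degree F"
        using trunc[of F] NJ F by blast
      have "F' \<in> I"
        using I_diff[OF F(1) JI[OF NJ[OF F'(1)]], of 1] by simp
      moreover have "F' \<notin> J"
        using diff_iff[OF NJ[OF F'(1)]] F by simp
      ultimately show ?thesis
        using F' by (auto simp: C_def)
    qed
    obtain R where R: "C R" and Rmin: "\<And>F. C F \<Longrightarrow> degree R \<le> degree F"
      using ex_has_least_nat[of C _ degree] C_trunc[OF gI g] by blast
    have lowC: "F \<in> J" if "F \<in> I" "F = 0 \<or> degree F < degree R" for F
      using C_trunc[OF that(1)] Rmin that(2) zero by (metis leD le_trans)
    have R0: "R \<noteq> 0"
      using R zero by (auto simp: C_def)
    \<comment> \<open>Over the fraction field of the residues modulo \<open>J0\<close>,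
      \<open>P\<close> is a minimal polynomial, and \<open>R\<close> divides it up to leading
      coefficients. As \<open>J\<close> is prime and \<open>R\<close> lies outside it, the cofactor
      \<open>Q\<close> lies in \<open>J\<close>; but if \<open>R\<close> is nonconstant, the degree
      of \<open>Q\<close> is too small for that.\<close>
    have "degree R = 0"
    proof (rule ccontr)
      assume dR: "degree R \<noteq> 0"
      \<comment> \<open>Otherwise the pseudo-remainder of \<open>R\<close> by \<open>P\<close> would
        have degree below that of \<open>R\<close>, hence lie in \<open>J\<close>, and put
        \<open>R\<close> itself into \<open>J\<close>.\<close>
      have RP: "degree R \<le> degree P"
      proof (rule ccontr)
        assume gt: "\<not> degree R \<le> degree P"
        obtain k Q S where S: "smult (lead_coeff P ^ k) R = P * Q + S" "S = 0 \<or> degree S < degree P"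
          using pseudo_division[OF P0] by blast
        have PJ: "P \<in> J" and RI: "R \<in> I"
          using P R by (simp_all add: B_def C_def)
        have "S = [:lead_coeff P ^ k:] * R - P * Q"
          using S by simp
        then have "S \<in> I"
          using I_diff[OF I_mult[OF RI] JI[OF PJ]] by metis
        then have "S \<in> J"
          using lowC S(2) gt by auto
        then have "smult (lead_coeff P ^ k) R \<in> J"
          using S(1) PJ add mult_right by simp
        then show False
          using smult_prime P R by (auto simp: B_def C_def)
      qed
      obtain k Q S where S: "smult (lead_coeff R ^ k) P = R * Q + S" "S = 0 \<or> degree S < degree R"
        using pseudo_division[OF R0] by blast
      have PJ: "P \<in> J" and RI: "R \<in> I"
        using P R by (simp_all add: B_def C_def)
      have RkP: "smult (lead_coeff R ^ k) P \<in> J"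
        by (rule smult[OF PJ])
      have "S = [:lead_coeff R ^ k:] * P - R * Q"
        using S by simp
      then have "S \<in> I"
        using I_diff[OF I_mult[OF JI[OF PJ]] RI] by metis
      then have "S \<in> J"
        using lowC S(2) by auto
      then have "R * Q \<in> J"
        using RkP S(1) add_iff[of S "R * Q"] by (simp add: add.commute)
      then have QJ: "Q \<in> J"
        using prime R by (auto simp: C_def)
      have Sc: "coeff S n = 0" if "n \<ge> degree R" for n
        using S(2) that by (auto intro: coeff_eq_0)
      have ReqP: "coeff (R * Q) n = lead_coeff R ^ k * coeff P n" if "n \<ge> degree R" for n
        using arg_cong[OF S(1), of "\<lambda>p. coeff p n"] Sc[OF that] by simp
      \<comment> \<open>The product \<open>R * Q\<close> has the leading coefficient of
        \<open>P\<close>, up to a factor outside \<open>J0\<close>, in degree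
        \<open>degree P\<close>, and nothing above. If \<open>Q\<close> is zero modulo
        \<open>J0\<close>, the first fact is violated; if not, its true degree is at least
        \<open>degree P\<close> and the second one is.\<close>
      show False
      proof (cases "Q \<in> N")
        case True
        then have "coeff (R * Q) (degree P) \<in> J0"
          using N_mult[of Q R] by (simp add: N_def mult.commute)
        then have "lead_coeff R ^ k * lead_coeff P \<in> J0"
          using ReqP[OF RP] by simp
        then show False
          using J0.prime J0.power P R by (auto simp: B_def C_def)
      next
        case False
        then obtain Q' where Q': "Q - Q' \<in> N" "lead_coeff Q' \<notin> J0" "degree Q' \<le> degree Q"
          using trunc by blast
        then have "B Q'"
          using QJ NJ diff_iff by (auto simp: B_def)
        then have dQ': "degree P \<le> degree Q'"
          by (rule Pmin)
        have "R * Q - R * Q' \<in> N"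
          using N_mult[OF Q'(1), of R] by (simp add: algebra_simps)
        then have "coeff (R * Q) (degree R + degree Q') - coeff (R * Q') (degree R + degree Q') \<in> J0"
          by (simp add: N_def)
        moreover have "coeff (R * Q) (degree R + degree Q') = 0"
          using ReqP[of "degree R + degree Q'"] dQ' dR by (simp add: coeff_eq_0)
        ultimately have "lead_coeff R * lead_coeff Q' \<in> J0"
          using J0.uminus by (fastforce simp: coeff_mult_degree_sum)
        then show False
          using J0.prime R Q' by (auto simp: C_def)
      qed
    qed
    then obtain r where r: "R = [:r:]"
      by (auto elim: degree_eq_zeroE)
    obtain j u where ju: "[:r:] = j + u * g" "j \<in> J"
      using R r by (auto simp: C_def I_def)
    \<comment> \<open>The factor \<open>lead_coeff P\<close> keeps the image of \<open>P\<close>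
      nonconstant, so that it has a root, and allows cancellation after pseudo-division by
      \<open>P\<close>. The factor \<open>r\<close> keeps \<open>g\<close> from vanishing at that
      root.\<close>
    show ?thesis
    proof (rule that[of "lead_coeff P * r"])
      show "[:lead_coeff P * r:] \<notin> J"
        using J0.prime[of "lead_coeff P" r] P R r by (auto simp: B_def C_def J0_def)
      fix \<phi> :: "'r \<Rightarrow> 'a"
      assume \<phi>: "ring_morph \<phi>" and kill: "\<And>c. [:c:] \<in> J \<Longrightarrow> \<phi> c = 0"
        and b: "\<phi> (lead_coeff P * r) \<noteq> 0"
      interpret \<phi>: ring_morph \<phi> by fact
      interpret M: ring_morph "map_poly \<phi>"
        by (rule ring_morph_map_poly[OF \<phi>])
      have [simp]: "\<phi> 0 = 0"
        by (rule \<phi>.zero)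
      have aP: "\<phi> (lead_coeff P) \<noteq> 0" and r0: "\<phi> r \<noteq> 0"
        using b by (auto simp: \<phi>.mult)
      have "coeff (map_poly \<phi> P) (degree P) \<noteq> 0"
        using aP by (simp add: coeff_map_poly)
      then have "degree (map_poly \<phi> P) > 0"
        using Pd le_degree by (metis not_gr_zero le_zero_eq not_less_zero)
      then obtain t where t: "poly (map_poly \<phi> P) t = 0"
        using alg_closed_imp_poly_has_root by blast
      have N0: "map_poly \<phi> F = 0" if "F \<in> N" for F
      proof (rule poly_eqI)
        fix n
        have "[:coeff F n:] \<in> J"
          using that by (simp add: N_def J0_def)
        from kill[OF this] show "coeff (map_poly \<phi> F) n = coeff 0 n"
          by (simp add: coeff_map_poly)
      qed
      have J_t: "poly (map_poly \<phi> F) t = 0" if F: "F \<in> J" for F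
      proof -
        obtain k Q S where S: "smult (lead_coeff P ^ k) F = P * Q + S" "S = 0 \<or> degree S < degree P"
          using pseudo_division[OF P0] by blast
        have "S = [:lead_coeff P ^ k:] * F - P * Q"
          using S by simp
        then have "S \<in> J"
          using F P by (auto simp: B_def intro!: diff mult_left mult_right smult)
        then have "map_poly \<phi> S = 0"
          using N0 low S(2) by auto
        have "[:lead_coeff P ^ k:] * F = P * Q + S"
          using S by simp
        then have "map_poly \<phi> [:lead_coeff P ^ k:] * map_poly \<phi> F = map_poly \<phi> P * map_poly \<phi> Q"
          using \<open>map_poly \<phi> S = 0\<close> by (metis M.mult M.add add.right_neutral)
        then have "poly (map_poly \<phi> [:lead_coeff P ^ k:]) t * poly (map_poly \<phi> F) t = 0"
          using t by (metis poly_mult mult_zero_left)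
        then show ?thesis
          using aP by (simp add: map_poly_pCons \<phi>.power)
      qed
      have "map_poly \<phi> [:r:] = map_poly \<phi> j + map_poly \<phi> u * map_poly \<phi> g"
        by (simp only: ju M.add M.mult)
      then have "poly (map_poly \<phi> [:r:]) t = poly (map_poly \<phi> u) t * poly (map_poly \<phi> g) t"
        using J_t[OF ju(2)] by simp
      then have "poly (map_poly \<phi> g) t \<noteq> 0"
        using r0 by (auto simp: map_poly_pCons)
      then show "\<exists>t. (\<forall>F\<in>J. poly (map_poly \<phi> F) t = 0) \<and> poly (map_poly \<phi> g) t \<noteq> 0"
        using J_t by auto
    qed
  qed
qed

text \<open>\<open>Var s\<close> becomes the univariate indeterminate. The coefficients keep the
  full type although \<open>Var s\<close> no longer occurs in them;
  \<open>map_poly_del_var_as_poly\<close> records this.\<close>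

definition as_poly :: "'i \<Rightarrow> ('i, 'a::field) mpoly \<Rightarrow> ('i, 'a) mpoly poly" where
  "as_poly s = psubst (\<lambda>c. [:Const c:]) (\<lambda>i. if i = s then [:0, 1:] else [:Var i:])"

definition del_var :: "'i \<Rightarrow> ('i, 'a::field) mpoly \<Rightarrow> ('i, 'a) mpoly" where
  "del_var s = psubst Const (\<lambda>i. if i = s then 0 else Var i)"

text \<open>A left inverse of \<open>as_poly s\<close> that is also meaningful for coefficients containing \<open>Var s\<close>.\<close>

definition of_poly :: "'i \<Rightarrow> ('i, 'a::field) mpoly poly \<Rightarrow> ('i, 'a) mpoly" where
  "of_poly s F = poly (map_poly (del_var s) F) (Var s)"

lemma ring_morph_Const_pCons: "ring_morph (\<lambda>c. [:Const c :: ('i, 'a::field) mpoly:])"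
  by (rule ring_morph_comp[OF ring_morph_pCons ring_morph_single])

lemma ring_morph_as_poly: "ring_morph (as_poly s)"
  unfolding as_poly_def by (rule ring_morph_psubst[OF ring_morph_Const_pCons])

lemma ring_morph_del_var: "ring_morph (del_var s)"
  unfolding del_var_def by (rule ring_morph_psubst[OF ring_morph_single])

lemma ring_morph_of_poly: "ring_morph (of_poly s)"
  unfolding of_poly_def
  by (rule ring_morph_comp[OF ring_morph_poly ring_morph_map_poly[OF ring_morph_del_var]])

interpretation as_poly: ring_morph "as_poly s" for s
  by (rule ring_morph_as_poly)

interpretation del_var: ring_morph "del_var s" for s
  by (rule ring_morph_del_var)

interpretation of_poly: ring_morph "of_poly s" for s
  by (rule ring_morph_of_poly)

lemma del_var_simps [simp]:
  "del_var s 0 = 0" "del_var s 1 = 1" "del_var s (Const c) = Const c"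
  "del_var s (Var i) = (if i = s then 0 else Var i)"
  by (simp_all add: del_var.zero del_var.one)
    (simp_all add: del_var_def psubst_Const psubst_Var ring_morph_single)

lemma as_poly_simps [simp]:
  "as_poly s (Const c) = [:Const c:]" "as_poly s (Var i) = (if i = s then [:0, 1:] else [:Var i:])"
  by (simp_all add: as_poly_def psubst_Const psubst_Var ring_morph_Const_pCons)

lemma of_poly_const [simp]: "of_poly s [:c:] = del_var s c"
  by (simp add: of_poly_def map_poly_pCons)

lemma of_poly_as_poly [simp]: "of_poly s (as_poly s F) = F"
  by (rule ring_morph_mpoly_eqI[OF ring_morph_comp[OF ring_morph_of_poly ring_morph_as_poly] ring_morph_id])
    (simp_all add: of_poly_def map_poly_pCons)

text \<open>By induction on the number of variables that survive modulo \<open>J\<close>.\<close>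

theorem nullstellensatz:
  fixes J :: "('i, 'a::alg_closed_field) mpoly set"
  assumes "finite S" "prime_id J" "\<And>i. i \<notin> S \<Longrightarrow> Var i \<in> J" "g \<notin> J"
  shows "\<exists>v. (\<forall>F\<in>J. peval F v = 0) \<and> peval g v \<noteq> 0"
  using assms
proof (induction S arbitrary: J g rule: finite_induct)
  case empty
  interpret J: prime_id J by fact
  \<comment> \<open>All variables lie in \<open>J\<close>, so modulo \<open>J\<close> a polynomial
    is its constant term, and the zero sought is the origin.\<close>
  have *: "F - Const (peval F (\<lambda>_. 0)) \<in> J" for F
  proof (induction F rule: mpoly_induct)
    case (add F G)
    have "(F - Const (peval F (\<lambda>_. 0))) + (G - Const (peval G (\<lambda>_. 0))) \<in> J"
      by (rule J.add) (use add in auto)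
    then show ?case
      by (simp add: peval_simps single_add algebra_simps)
  next
    case (mult F G)
    have "F * (G - Const (peval G (\<lambda>_. 0))) +
        (F - Const (peval F (\<lambda>_. 0))) * Const (peval G (\<lambda>_. 0)) \<in> J"
      by (intro J.add J.mult_left J.mult_right mult)
    moreover have "F * (G - Const (peval G (\<lambda>_. 0))) +
        (F - Const (peval F (\<lambda>_. 0))) * Const (peval G (\<lambda>_. 0)) =
        F * G - Const (peval (F * G) (\<lambda>_. 0))"
      by (simp add: peval_simps mult_single algebra_simps)
    ultimately show ?case
      by simp
  qed (simp_all add: peval_simps J.zero empty)
  have "peval F (\<lambda>_. 0) = 0" if "F \<in> J" for F
  proof (rule ccontr)
    define c where "c = peval F (\<lambda>_. 0)"
    assume "peval F (\<lambda>_. 0) \<noteq> 0"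
    then have "Const (inverse c) * Const c = 1"
      by (simp add: mult_single c_def)
    moreover have "Const c \<in> J"
      using J.diff_iff[OF *, of F] that by (simp add: c_def)
    ultimately show False
      using J.mult_left J.one by metis
  qed
  moreover have "peval g (\<lambda>_. 0) \<noteq> 0"
    using J.diff_iff[OF *, of g] \<open>g \<notin> J\<close> J.zero by auto
  ultimately show ?case
    by blast
next
  case (insert s S)
  interpret prime_id J by fact
  define J1 where "J1 = {F. of_poly s F \<in> J}"
  have J1: "prime_id J1"
    unfolding J1_def by (rule prime_id_vimage[OF insert.prems(1) ring_morph_of_poly])
  have "as_poly s g \<notin> J1"
    using insert.prems by (simp add: J1_def)
  then obtain b where b: "[:b:] \<notin> J1"
    and ext: "\<And>\<phi> :: ('i, 'a) mpoly \<Rightarrow> 'a. ring_morph \<phi> \<Longrightarrow> (\<And>c. [:c:] \<in> J1 \<Longrightarrow> \<phi> c = 0) \<Longrightarrow>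
      \<phi> b \<noteq> 0 \<Longrightarrow> \<exists>t. (\<forall>F\<in>J1. poly (map_poly \<phi> F) t = 0) \<and> poly (map_poly \<phi> (as_poly s g)) t \<noteq> 0"
    by (rule prime_id_extension[OF J1]) blast
  \<comment> \<open>The contracted ideal also contains \<open>Var s\<close>, so one variable fewer
    survives and the induction hypothesis applies to it and \<open>b\<close>.\<close>
  have "\<exists>v. (\<forall>F\<in>{c. del_var s c \<in> J}. peval F v = 0) \<and> peval b v \<noteq> 0"
    using insert.prems(2) b
    by (intro insert.IH prime_id_vimage[OF insert.prems(1) ring_morph_del_var])
      (auto simp: zero J1_def)
  then obtain v where v: "\<And>c. del_var s c \<in> J \<Longrightarrow> peval c v = 0" "peval b v \<noteq> 0"
    by blast
  have "\<exists>t. (\<forall>F\<in>J1. poly (map_poly (\<lambda>c. peval c v) F) t = 0) \<and>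
      poly (map_poly (\<lambda>c. peval c v) (as_poly s g)) t \<noteq> 0"
    by (rule ext[OF ring_morph_peval]) (use v in \<open>auto simp: J1_def\<close>)
  then obtain t where t: "\<And>F. F \<in> J1 \<Longrightarrow> poly (map_poly (\<lambda>c. peval c v) F) t = 0"
    "poly (map_poly (\<lambda>c. peval c v) (as_poly s g)) t \<noteq> 0"
    by blast
  \<comment> \<open>Evaluating the coefficients at \<open>v\<close> and then the indeterminate at
    \<open>t\<close> amounts to evaluating at \<open>v\<close> with its coordinate \<open>s\<close>
    replaced by \<open>t\<close>.\<close>
  have eval: "poly (map_poly (\<lambda>c. peval c v) (as_poly s F)) t = peval F (v(s := t))" for F
    by (rule ring_morph_mpoly_eqI[OF ring_morph_comp[OF ring_morph_poly
        ring_morph_comp[OF ring_morph_map_poly[OF ring_morph_peval] ring_morph_as_poly]] ring_morph_peval])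
      (simp_all add: map_poly_pCons peval_simps)
  have "peval F (v(s := t)) = 0" if "F \<in> J" for F
    using t(1)[of "as_poly s F"] that unfolding eval J1_def by simp
  moreover have "peval g (v(s := t)) \<noteq> 0"
    using t(2) unfolding eval .
  ultimately show ?case
    by blast
qed

section \<open>Homogeneous forms and unique factorization\<close>

text \<open>Replacing each x_i by T x_i multiplies a monomial by T to its total degree.\<close>

lemma lookup_coeff_grading:
  fixes F :: "('i, 'a::field) mpoly"
  shows "Poly_Mapping.lookup (coeff (psubst (\<lambda>c. [:Const c:]) (\<lambda>i. [:0, Var i:]) F) n) m =
    (if tdeg m = n then Poly_Mapping.lookup F m else 0)"
proof (induction F rule: mpoly_induct_single)
  case (add F G)
  then show ?case
    by (simp add: psubst_add[OF ring_morph_Const_pCons] lookup_add)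
next
  case (single k c)
  have pow: "[:0, Var i :: ('i, 'a) mpoly:] ^ j = monom (Var i ^ j) j" for i :: 'i and j
  proof -
    have eq: "[:0, Var i :: ('i, 'a) mpoly:] = monom (Var i) 1"
      by (simp add: monom_Suc monom_0)
    show ?thesis
      unfolding eq monom_power by simp
  qed
  have "(\<Prod>i\<in>A. [:0, Var i :: ('i, 'a) mpoly:] ^ Poly_Mapping.lookup k i) =
      monom (\<Prod>i\<in>A. Var i ^ Poly_Mapping.lookup k i) (\<Sum>i\<in>A. Poly_Mapping.lookup k i)" for A
    by (induction A rule: infinite_finite_induct) (simp_all add: pow mult_monom)
  then have "psubst (\<lambda>c. [:Const c:]) (\<lambda>i. [:0, Var i:]) (Poly_Mapping.single k c) =
      monom (Poly_Mapping.single k c) (tdeg k)"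
    by (simp add: psubst_single[OF ring_morph_Const_pCons] tdeg_def smult_monom
        flip: single_eq_Const_prod_Var)
  then show ?case
    by (auto simp: lookup_single when_def)
qed (simp add: psubst_zero)

text \<open>The ring homomorphism F(x) to F(T x). Homogeneous components are its coefficients and
  homogeneous polynomials its monomials in T, so statements on components reduce to univariate
  ones.\<close>

definition grading :: "('i, 'a::field) mpoly \<Rightarrow> ('i, 'a) mpoly poly" where
  "grading = psubst (\<lambda>c. [:Const c:]) (\<lambda>i. [:0, Var i:])"

abbreviation hcomp :: "nat \<Rightarrow> ('i, 'a::field) mpoly \<Rightarrow> ('i, 'a) mpoly" where
  "hcomp n F \<equiv> coeff (grading F) n"

interpretation grading: ring_morph grading
  unfolding grading_def by (rule ring_morph_psubst[OF ring_morph_Const_pCons])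

lemma lookup_hcomp: "Poly_Mapping.lookup (hcomp n F) m = (if tdeg m = n then Poly_Mapping.lookup F m else 0)"
  unfolding grading_def by (rule lookup_coeff_grading)

lemma homogeneous_hcomp: "homogeneous n (hcomp n F)"
  by (auto simp: homogeneous_def in_keys_iff lookup_hcomp split: if_splits)

lemma homogeneous_iff_grading: "homogeneous d F \<longleftrightarrow> grading F = monom F d"
proof
  assume "homogeneous d F"
  then show "grading F = monom F d"
    by (intro poly_eqI poly_mapping_eqI) (auto simp: homogeneous_def lookup_hcomp in_keys_iff)
next
  assume g: "grading F = monom F d"
  have "tdeg m = d" if "Poly_Mapping.lookup F m \<noteq> 0" for m
    using lookup_hcomp[of F "tdeg m" m] that by (auto simp: g split: if_splits)
  then show "homogeneous d F"
    by (simp add: homogeneous_def in_keys_iff)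
qed

lemma hcomp_homogeneous: "homogeneous d F \<Longrightarrow> hcomp n F = (if n = d then F else 0)"
  by (auto simp: homogeneous_iff_grading)

lemma sum_hcomp: "F = (\<Sum>n\<le>degree (grading F). hcomp n F)"
proof -
  have "poly (grading F) 1 = F"
    by (rule ring_morph_mpoly_eqI[OF ring_morph_comp[OF ring_morph_poly grading.ring_morph_axioms] ring_morph_id])
      (simp_all add: grading_def psubst_Const psubst_Var ring_morph_Const_pCons)
  then show ?thesis
    by (simp add: poly_altdef)
qed

lemma hcomp_keys: "m \<in> Poly_Mapping.keys (hcomp n F) \<Longrightarrow> m \<in> Poly_Mapping.keys F"
  by (auto simp: in_keys_iff lookup_hcomp split: if_splits)

lemma homogeneous_zero [simp]: "homogeneous d 0"
  by (simp add: homogeneous_def)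

lemma homogeneous_add: "homogeneous d F \<Longrightarrow> homogeneous d G \<Longrightarrow> homogeneous d (F + G)"
  by (simp add: homogeneous_iff_grading grading.add add_monom)

lemma homogeneous_uminus: "homogeneous d F \<Longrightarrow> homogeneous d (- F)"
  by (simp add: homogeneous_def in_keys_iff)

lemma homogeneous_diff: "homogeneous d F \<Longrightarrow> homogeneous d G \<Longrightarrow> homogeneous d (F - G)"
  using homogeneous_add[of d F "- G"] by (simp add: homogeneous_uminus)

lemma homogeneous_sum: "(\<And>i. i \<in> A \<Longrightarrow> homogeneous d (f i)) \<Longrightarrow> homogeneous d (sum f A)"
  by (induction A rule: infinite_finite_induct) (auto intro: homogeneous_add)

lemma homogeneous_mult: "homogeneous d F \<Longrightarrow> homogeneous e G \<Longrightarrow> homogeneous (d + e) (F * G)"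
  by (simp add: homogeneous_iff_grading grading.mult mult_monom)

lemma homogeneous_Const [simp]: "homogeneous 0 (Const c)"
  by (auto simp: homogeneous_def tdeg_def)

lemma homogeneous_one [simp]: "homogeneous 0 1"
  using homogeneous_Const[of 1] by simp

lemma homogeneous_Const_mult: "homogeneous d F \<Longrightarrow> homogeneous d (Const c * F)"
  using homogeneous_mult[of 0 "Const c" d F] by simp

lemma homogeneous_Var [simp]: "homogeneous 1 (Var i)"
  by (auto simp: homogeneous_def tdeg_def Var_def)

lemma homogeneous_power: "homogeneous d F \<Longrightarrow> homogeneous (n * d) (F ^ n)"
  by (induction n) (auto dest: homogeneous_mult)

lemma homogeneous_prod:
  "(\<And>i. i \<in> A \<Longrightarrow> homogeneous (d i) (f i)) \<Longrightarrow> homogeneous (sum d A) (prod f A)"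
  by (induction A rule: infinite_finite_induct) (auto intro: homogeneous_mult)

lemma homogeneous_unique_degree: "homogeneous d F \<Longrightarrow> homogeneous e F \<Longrightarrow> F \<noteq> 0 \<Longrightarrow> d = e"
  by (metis homogeneous_iff_grading degree_monom_eq)

lemma homogeneous_0_D: "homogeneous 0 F \<Longrightarrow> F = Const (Poly_Mapping.lookup F 0)"
  by (rule poly_mapping_eqI)
    (force simp: homogeneous_def tdeg_def lookup_single when_def in_keys_iff sum_nonneg_eq_0_iff
      intro: poly_mapping_eqI)

lemma psubst_scale:
  assumes "homogeneous d F"
  shows "psubst \<phi> (\<lambda>i. c * x i) F = c ^ d * psubst \<phi> x F"
proof -
  have "(\<Prod>i\<in>Poly_Mapping.keys m. (c * x i) ^ Poly_Mapping.lookup m i) =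
      c ^ d * (\<Prod>i\<in>Poly_Mapping.keys m. x i ^ Poly_Mapping.lookup m i)"
    if "m \<in> Poly_Mapping.keys F" for m
    using that assms
    by (auto simp: power_mult_distrib prod.distrib tdeg_def homogeneous_def simp flip: power_sum)
  then show ?thesis
    by (simp add: psubst_def sum_distrib_left mult_ac)
qed

lemma peval_scale: "homogeneous d F \<Longrightarrow> peval F (vscale c v) = c ^ d * peval F v"
  unfolding peval_eq_psubst vscale_def by (rule psubst_scale)

text \<open>In a domain both the lowest and the highest exponents add. They coincide in the product,
  hence in each factor.\<close>

lemma monom_eq_mult_D:
  fixes p q :: "'r::idom poly"
  assumes "p * q = monom c d" "c \<noteq> 0"
  obtains a i where "p = monom a i"
proof -
  have pq: "p \<noteq> 0" "q \<noteq> 0"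
    using assms by auto
  define i where "i = (LEAST n. coeff p n \<noteq> 0)"
  define j where "j = (LEAST n. coeff q n \<noteq> 0)"
  have i: "coeff p i \<noteq> 0" and j: "coeff q j \<noteq> 0"
    using LeastI_ex[of "\<lambda>n. coeff p n \<noteq> 0"] LeastI_ex[of "\<lambda>n. coeff q n \<noteq> 0"] pq
    by (auto simp: i_def j_def poly_eq_iff)
  have lt: "coeff p n = 0" if "n < i" for n
    using not_less_Least[of n "\<lambda>n. coeff p n \<noteq> 0"] that by (auto simp: i_def)
  have lt': "coeff q n = 0" if "n < j" for n
    using not_less_Least[of n "\<lambda>n. coeff q n \<noteq> 0"] that by (auto simp: j_def)
  have "coeff (p * q) (i + j) = (\<Sum>k\<in>{i}. coeff p k * coeff q (i + j - k))"
    unfolding coeff_mult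
  proof (rule sum.mono_neutral_right)
    show "\<forall>k\<in>{..i + j} - {i}. coeff p k * coeff q (i + j - k) = 0"
    proof
      fix k assume "k \<in> {..i + j} - {i}"
      then have "k < i \<or> i + j - k < j"
        by auto
      then show "coeff p k * coeff q (i + j - k) = 0"
        using lt lt' by auto
    qed
  qed auto
  then have "coeff (monom c d) (i + j) \<noteq> 0"
    using i j assms by simp
  then have "d = i + j"
    by (auto split: if_splits)
  moreover have "degree p + degree q = d"
    using assms pq degree_mult_eq[of p q] by (simp add: degree_monom_eq)
  moreover have "i \<le> degree p" "j \<le> degree q"
    using i j by (auto intro: le_degree)
  ultimately have "degree p = i"
    by simp
  then have "coeff p n = 0" if "n \<noteq> i" for n
    using that lt[of n] coeff_eq_0[of p n] by (cases "n < i") auto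
  then have "p = monom (coeff p i) i"
    by (auto intro!: poly_eqI)
  then show ?thesis
    by (rule that)
qed

text \<open>Apply \<open>monom_eq_mult_D\<close> to the gradings. The linear order on the variables
  provides the integral domain structure of the polynomial type.\<close>

lemma homogeneous_dvd:
  fixes F :: "('i::linorder, 'a::field) mpoly"
  assumes "homogeneous d F" "F \<noteq> 0" "G dvd F"
  obtains e where "homogeneous e G"
proof -
  obtain H where "F = G * H"
    using assms(3) by (auto simp: dvd_def)
  then have "grading G * grading H = monom F d"
    using assms(1) by (simp add: homogeneous_iff_grading grading.mult)
  then obtain a i where a: "grading G = monom a i"
    using assms(2) by (rule monom_eq_mult_D)
  then have "G = a"
    using sum_hcomp[of G] by (simp add: if_distrib cong: if_cong)
      (metis atMost_iff degree_monom_eq degree_monom_le monom_eq_0 order_refl sum.delta)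
  then show ?thesis
    using a that by (simp add: homogeneous_iff_grading)
qed

text \<open>A divisor of 1 is homogeneous, and degrees of forms add up to that of 1, which is
  0.\<close>

lemma unit_mpoly_iff:
  fixes F :: "('i::linorder, 'a::field) mpoly"
  shows "F dvd 1 \<longleftrightarrow> (\<exists>c. c \<noteq> 0 \<and> F = Const c)"
proof
  assume "F dvd 1"
  then obtain G where G: "1 = F * G"
    by (auto simp: dvd_def)
  obtain d where d: "homogeneous d F"
    using homogeneous_dvd[OF homogeneous_one _ \<open>F dvd 1\<close>] by auto
  obtain e where e: "homogeneous e G"
    using homogeneous_dvd[OF homogeneous_one, of G] G by (auto simp: dvd_def mult.commute)
  have "homogeneous (d + e) (1 :: ('i, 'a) mpoly)"
    using homogeneous_mult[OF d e] G by simp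
  then have "d + e = 0"
    by (rule homogeneous_unique_degree[OF _ homogeneous_one]) simp
  then have "F = Const (Poly_Mapping.lookup F 0)"
    using homogeneous_0_D d by auto
  moreover have "F \<noteq> 0"
    using G by auto
  ultimately show "\<exists>c. c \<noteq> 0 \<and> F = Const c"
    by (metis single_zero)
next
  assume "\<exists>c. c \<noteq> 0 \<and> F = Const c"
  then obtain c where "c \<noteq> 0" "F = Const c"
    by blast
  then have "F * Const (inverse c) = 1"
    by (simp add: mult_single)
  then show "F dvd 1"
    by (metis dvd_triv_left)
qed

section \<open>Unique factorization in three variables\<close>

lemma exhaust_3:
  fixes x :: 3
  shows "x = 1 \<or> x = 2 \<or> x = 3"
proof (induct x)
  case (of_int z)
  then have "z = 0 \<or> z = 1 \<or> z = 2"
    by fastforce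
  then show ?case
    by auto
qed

text \<open>The isomorphism onto K[z][y][x], through which unique factorization of iterated
  univariate polynomials is imported.\<close>

definition mpoly3_to_poly :: "(3, 'a::field) mpoly \<Rightarrow> 'a poly poly poly" where
  "mpoly3_to_poly = psubst (\<lambda>c. [:[:[:c:]:]:])
     (\<lambda>i. if i = 1 then [:0, 1:] else if i = 2 then [:[:0, 1:]:] else [:[:[:0, 1:]:]:])"

definition poly_to_mpoly3 :: "'a::field poly poly poly \<Rightarrow> (3, 'a) mpoly" where
  "poly_to_mpoly3 p = poly (map_poly (\<lambda>q. poly (map_poly (\<lambda>r. poly (map_poly Const r) (Var 3)) q) (Var 2)) p) (Var 1)"

lemma ring_morph_Const_pCons3: "ring_morph (\<lambda>c :: 'a::comm_ring_1. [:[:[:c:]:]:])"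
  by (intro ring_morph_comp[OF ring_morph_pCons] ring_morph_pCons)

interpretation to3: ring_morph mpoly3_to_poly
  unfolding mpoly3_to_poly_def by (rule ring_morph_psubst[OF ring_morph_Const_pCons3])

interpretation of3: ring_morph poly_to_mpoly3
  unfolding poly_to_mpoly3_def
  by (intro ring_morph_comp[OF ring_morph_poly] ring_morph_map_poly ring_morph_single)

lemma mpoly3_to_poly_inverse: "poly_to_mpoly3 (mpoly3_to_poly F) = F"
proof (rule ring_morph_mpoly_eqI[OF ring_morph_comp[OF of3.ring_morph_axioms to3.ring_morph_axioms] ring_morph_id])
  show "poly_to_mpoly3 (mpoly3_to_poly (Var i)) = Var i" for i
    using exhaust_3[of i]
    by (auto simp: mpoly3_to_poly_def psubst_Var[OF ring_morph_Const_pCons3] poly_to_mpoly3_def map_poly_pCons)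
qed (simp add: mpoly3_to_poly_def psubst_Const[OF ring_morph_Const_pCons3] poly_to_mpoly3_def map_poly_pCons)

lemma poly_to_mpoly3_inverse: "mpoly3_to_poly (poly_to_mpoly3 p) = p"
proof -
  have h: "ring_morph (\<lambda>p. mpoly3_to_poly (poly_to_mpoly3 p))"
    by (rule ring_morph_comp[OF to3.ring_morph_axioms of3.ring_morph_axioms])
  have 1: "mpoly3_to_poly (poly_to_mpoly3 [:[:[:c:]:]:]) = [:[:[:c:]:]:]" for c
    by (simp add: mpoly3_to_poly_def psubst_Const[OF ring_morph_Const_pCons3] poly_to_mpoly3_def map_poly_pCons)
  have 2: "mpoly3_to_poly (poly_to_mpoly3 [:[:r:]:]) = [:[:r:]:]" for r
    by (rule ring_morph_poly_eqI[OF ring_morph_comp[OF h ring_morph_comp[OF ring_morph_pCons ring_morph_pCons]]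
          ring_morph_comp[OF ring_morph_pCons ring_morph_pCons]])
      (simp_all add: 1, simp add: mpoly3_to_poly_def psubst_Var[OF ring_morph_Const_pCons3]
        poly_to_mpoly3_def map_poly_pCons)
  have 3: "mpoly3_to_poly (poly_to_mpoly3 [:q:]) = [:q:]" for q
    by (rule ring_morph_poly_eqI[OF ring_morph_comp[OF h ring_morph_pCons] ring_morph_pCons])
      (simp_all add: 2, simp add: mpoly3_to_poly_def psubst_Var[OF ring_morph_Const_pCons3]
        poly_to_mpoly3_def map_poly_pCons)
  show ?thesis
    by (rule ring_morph_poly_eqI[OF h ring_morph_id])
      (simp_all add: 3, simp add: mpoly3_to_poly_def psubst_Var[OF ring_morph_Const_pCons3]
        poly_to_mpoly3_def map_poly_pCons)
qed

lemma mpoly3_to_poly_dvd_iff: "mpoly3_to_poly F dvd mpoly3_to_poly G \<longleftrightarrow> F dvd G"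
proof
  assume "mpoly3_to_poly F dvd mpoly3_to_poly G"
  then obtain H where "mpoly3_to_poly G = mpoly3_to_poly F * H"
    by (auto simp: dvd_def)
  then have "poly_to_mpoly3 (mpoly3_to_poly G) = poly_to_mpoly3 (mpoly3_to_poly F) * poly_to_mpoly3 H"
    by (simp add: of3.mult)
  then show "F dvd G"
    by (simp add: mpoly3_to_poly_inverse)
qed (auto simp: dvd_def to3.mult)

lemma mpoly3_to_poly_eq_0_iff: "mpoly3_to_poly F = 0 \<longleftrightarrow> F = 0"
  by (metis mpoly3_to_poly_inverse to3.zero)

text \<open>Transport along \<open>mpoly3_to_poly\<close>, which preserves and reflects
  divisibility. The additional sorts of \<open>'a\<close> give \<open>'a poly poly poly\<close> the
  gcd structure that makes irreducible elements prime.\<close>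

lemma mpoly3_irreducible_imp_prime_elem:
  fixes F :: "(3, 'a::{field, factorial_ring_gcd, semiring_gcd_mult_normalize}) mpoly"
  assumes "Factorial_Ring.irreducible F"
  shows "prime_elem F"
proof -
  have unit: "mpoly3_to_poly G dvd 1 \<longleftrightarrow> G dvd 1" for G :: "(3, 'a) mpoly"
    using mpoly3_to_poly_dvd_iff[of G 1] by (simp add: to3.one)
  have "Factorial_Ring.irreducible (mpoly3_to_poly F)"
  proof (rule irreducibleI)
    show "mpoly3_to_poly F \<noteq> 0" "\<not> mpoly3_to_poly F dvd 1"
      using assms by (auto simp: mpoly3_to_poly_eq_0_iff unit irreducible_def)
    fix a b
    assume "mpoly3_to_poly F = a * b"
    then have "F = poly_to_mpoly3 a * poly_to_mpoly3 b"
      by (metis mpoly3_to_poly_inverse of3.mult)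
    then have "poly_to_mpoly3 a dvd 1 \<or> poly_to_mpoly3 b dvd 1"
      using assms by (auto dest: irreducibleD)
    then show "a dvd 1 \<or> b dvd 1"
      by (metis unit poly_to_mpoly3_inverse)
  qed
  then have p: "prime_elem (mpoly3_to_poly F)"
    by (rule irreducible_imp_prime_elem_gcd)
  show ?thesis
  proof (rule prime_elemI)
    show "F \<noteq> 0" "\<not> F dvd 1"
      using assms by (auto simp: irreducible_def)
    fix a b
    assume "F dvd a * b"
    then show "F dvd a \<or> F dvd b"
      using prime_elem_dvd_multD[OF p, of "mpoly3_to_poly a" "mpoly3_to_poly b"]
      by (simp add: mpoly3_to_poly_dvd_iff flip: to3.mult)
  qed
qed

lemma (in prime_id) prod_mset_in_D: "prod_mset A \<in> J \<Longrightarrow> \<exists>x\<in>#A. x \<in> J"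
  by (induction A) (use one prime in auto)

text \<open>Factor \<open>G\<close> into primes in K[z][y][x]; a prime ideal that contains their
  product contains one of them.\<close>

lemma mpoly3_irreducible_factor_in_prime_id:
  fixes G :: "(3, 'a::{field, factorial_ring_gcd, semiring_gcd_mult_normalize}) mpoly"
  assumes J: "prime_id J" and G: "G \<in> J" "G \<noteq> 0"
  obtains F where "Factorial_Ring.irreducible F" "F \<in> J" "F dvd G"
proof -
  interpret J': prime_id "{p. poly_to_mpoly3 p \<in> J}"
    by (rule prime_id_vimage[OF J of3.ring_morph_axioms])
  have "mpoly3_to_poly G \<noteq> 0"
    using G by (simp add: mpoly3_to_poly_eq_0_iff)
  then obtain A where A: "\<And>x. x \<in># A \<Longrightarrow> prime x" "normalize (prod_mset A) = normalize (mpoly3_to_poly G)"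
    by (rule prime_factorization_exists') blast
  then have assoc: "mpoly3_to_poly G dvd prod_mset A" "prod_mset A dvd mpoly3_to_poly G"
    by (metis associatedD1 associatedD2)+
  then obtain c where "prod_mset A = mpoly3_to_poly G * c"
    by (auto simp: dvd_def)
  then have "prod_mset A \<in> {p. poly_to_mpoly3 p \<in> J}"
    using J'.mult_right[of "mpoly3_to_poly G" c] G by (simp add: mpoly3_to_poly_inverse)
  then obtain x where x: "x \<in># A" "poly_to_mpoly3 x \<in> J"
    using J'.prod_mset_in_D by auto
  have irr: "Factorial_Ring.irreducible x"
    using A(1)[OF x(1)] by (intro prime_elem_imp_irreducible) (auto simp: prime_def)
  have unit: "poly_to_mpoly3 p dvd 1 \<longleftrightarrow> p dvd 1" for p :: "'a poly poly poly"
    using mpoly3_to_poly_dvd_iff[of "poly_to_mpoly3 p" 1] by (simp add: to3.one poly_to_mpoly3_inverse)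
  show ?thesis
  proof (rule that[of "poly_to_mpoly3 x"])
    show "Factorial_Ring.irreducible (poly_to_mpoly3 x)"
    proof (rule irreducibleI)
      show "poly_to_mpoly3 x \<noteq> 0"
        using irr by (metis irreducible_def poly_to_mpoly3_inverse to3.zero)
      show "\<not> poly_to_mpoly3 x dvd 1"
        using irr by (simp add: unit irreducible_def)
      fix a b
      assume "poly_to_mpoly3 x = a * b"
      then have "x = mpoly3_to_poly a * mpoly3_to_poly b"
        by (metis poly_to_mpoly3_inverse to3.mult)
      then have "mpoly3_to_poly a dvd 1 \<or> mpoly3_to_poly b dvd 1"
        using irr by (auto dest: irreducibleD)
      then show "a dvd 1 \<or> b dvd 1"
        by (metis unit mpoly3_to_poly_inverse)
    qed
    have "x dvd mpoly3_to_poly G"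
      using x(1) assoc(2) dvd_prod_mset dvd_trans by blast
    then show "poly_to_mpoly3 x dvd G"
      using mpoly3_to_poly_dvd_iff[of "poly_to_mpoly3 x" G] by (simp add: poly_to_mpoly3_inverse)
  qed (rule x(2))
qed

section \<open>Elimination of one variable\<close>

lemma map_poly_del_var_as_poly: "map_poly (del_var k) (as_poly k G) = as_poly k G"
  by (rule ring_morph_mpoly_eqI[OF ring_morph_comp[OF ring_morph_map_poly[OF ring_morph_del_var]
      ring_morph_as_poly] ring_morph_as_poly]) (simp_all add: map_poly_pCons)

lemma as_poly_del_var: "as_poly k (del_var k c) = [:del_var k c:]"
  by (rule ring_morph_mpoly_eqI[OF ring_morph_comp[OF ring_morph_as_poly ring_morph_del_var]
        ring_morph_comp[OF ring_morph_pCons ring_morph_del_var]]) (simp_all add: as_poly.zero)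

lemma as_poly_of_poly: "as_poly k (of_poly k S) = map_poly (del_var k) S"
  by (rule ring_morph_poly_eqI[OF ring_morph_comp[OF ring_morph_as_poly ring_morph_of_poly]
        ring_morph_map_poly[OF ring_morph_del_var]])
    (simp_all add: map_poly_pCons as_poly_del_var, simp add: of_poly_def map_poly_pCons)

lemma as_poly_eq_0_iff: "as_poly k G = 0 \<longleftrightarrow> G = 0"
  by (metis of_poly_as_poly as_poly.zero)

lemma degree_as_poly_dvd:
  fixes A B :: "('i::linorder, 'a::field) mpoly"
  assumes "A dvd B" "B \<noteq> 0"
  shows "degree (as_poly k A) \<le> degree (as_poly k B)"
proof -
  obtain C where C: "B = A * C"
    using assms by (auto simp: dvd_def)
  then have "as_poly k A \<noteq> 0" "as_poly k C \<noteq> 0"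
    using assms by (auto simp: as_poly_eq_0_iff)
  then show ?thesis
    by (simp add: C as_poly.mult degree_mult_eq)
qed

lemma del_var_fixed_iff: "del_var k F = F \<longleftrightarrow> degree (as_poly k F) = 0"
proof
  assume "del_var k F = F"
  then show "degree (as_poly k F) = 0"
    by (metis as_poly_del_var degree_pCons_0)
next
  assume "degree (as_poly k F) = 0"
  then obtain c where c: "as_poly k F = [:c:]"
    by (rule degree_eq_zeroE)
  then have "F = del_var k c"
    by (metis of_poly_as_poly of_poly_const)
  moreover have "del_var k c = c"
    using map_poly_del_var_as_poly[of k F] by (simp add: c map_poly_pCons)
  ultimately show "del_var k F = F"
    by simp
qed

text \<open>Here \<open>del_var k c = c\<close> says that \<open>Var k\<close> does not occur in
  \<open>c\<close>. If \<open>J\<close> had no such nonzero element, let \<open>P\<close> in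
  \<open>J\<close> be irreducible of least degree in \<open>Var k\<close>. Pseudo-remainders by
  \<open>P\<close> stay in \<open>J\<close> with smaller degree and vanish, so \<open>P\<close>
  divides all of \<open>J\<close>. Then \<open>P\<close> is associated to \<open>F\<close>, and
  \<open>F\<close> divides \<open>H\<close>.\<close>

lemma elimination:
  fixes F H :: "(3, 'a::{field, factorial_ring_gcd, semiring_gcd_mult_normalize}) mpoly"
  assumes J: "prime_id J" and F: "Factorial_Ring.irreducible F" "F \<in> J"
    and H: "H \<in> J" "\<not> F dvd H"
  obtains c where "c \<in> J" "c \<noteq> 0" "del_var k c = c"
proof (rule ccontr)
  assume "\<not> thesis"
  then have free: "c = 0" if "c \<in> J" "del_var k c = c" for c
    using that \<open>\<And>c. c \<in> J \<Longrightarrow> c \<noteq> 0 \<Longrightarrow> del_var k c = c \<Longrightarrow> thesis\<close> by blast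
  interpret prime_id J by fact
  have "F \<in> J \<and> F \<noteq> 0"
    using F by auto
  then obtain P0 where P0: "P0 \<in> J" "P0 \<noteq> 0"
    and P0_min: "\<And>G. G \<in> J \<Longrightarrow> G \<noteq> 0 \<Longrightarrow> degree (as_poly k P0) \<le> degree (as_poly k G)"
    using ex_has_least_nat[of "\<lambda>G. G \<in> J \<and> G \<noteq> 0" F "\<lambda>G. degree (as_poly k G)"] by blast
  obtain P where P: "Factorial_Ring.irreducible P" "P \<in> J" "P dvd P0"
    by (rule mpoly3_irreducible_factor_in_prime_id[OF J P0])
  have P_prime: "prime_elem P"
    by (rule mpoly3_irreducible_imp_prime_elem[OF P(1)])
  have Pne: "P \<noteq> 0"
    using P by auto
  have P_min: "degree (as_poly k P) \<le> degree (as_poly k G)" if "G \<in> J" "G \<noteq> 0" for G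
    using degree_as_poly_dvd[OF P(3) P0(2), of k] P0_min[OF that] by simp
  define a where "a = lead_coeff (as_poly k P)"
  have del_a: "del_var k a = a"
    using arg_cong[OF map_poly_del_var_as_poly[of k P], of "\<lambda>p. coeff p (degree (as_poly k P))"]
    by (simp add: coeff_map_poly a_def)
  have "a \<noteq> 0"
    using Pne by (simp add: a_def as_poly_eq_0_iff)
  have deg_P: "degree (as_poly k P) > 0"
  proof (rule ccontr)
    assume "\<not> degree (as_poly k P) > 0"
    then show False
      using free[of P] P(2) Pne by (simp add: del_var_fixed_iff)
  qed
  \<comment> \<open>The leading coefficient is nonzero and free of \<open>Var k\<close>, whereas
    \<open>P\<close> has positive degree in it.\<close>
  have "\<not> P dvd a"
    using degree_as_poly_dvd[of P a k] deg_P as_poly_del_var[of k a] \<open>a \<noteq> 0\<close> by (auto simp: del_a)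
  have all: "P dvd G" if G: "G \<in> J" for G
  proof -
    obtain m Q S where S: "smult (a ^ m) (as_poly k G) = as_poly k P * Q + S"
      "S = 0 \<or> degree S < degree (as_poly k P)"
      using pseudo_division[of "as_poly k P" "as_poly k G"] Pne as_poly_eq_0_iff[of k P] unfolding a_def by blast
    have "of_poly k ([:a ^ m:] * as_poly k G) = of_poly k (as_poly k P * Q + S)"
      using S(1) by simp
    then have eq: "a ^ m * G = P * of_poly k Q + of_poly k S"
      by (simp only: of_poly.mult of_poly.add of_poly_const of_poly_as_poly del_var.power del_a)
    have "of_poly k S = a ^ m * G - P * of_poly k Q"
      using eq by simp
    then have SJ: "of_poly k S \<in> J"
      using G P(2) by (simp add: diff mult_left mult_right)
    \<comment> \<open>Passing from \<open>S\<close> to \<open>of_poly k S\<close> only sets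
      \<open>Var k\<close> to 0 in the coefficients, which cannot raise the degree; minimality of
      \<open>P\<close> then applies.\<close>
    have "of_poly k S = 0"
    proof (rule ccontr)
      assume ne: "of_poly k S \<noteq> 0"
      then have "S \<noteq> 0"
        by (auto simp: of_poly.zero)
      then have "degree (as_poly k (of_poly k S)) < degree (as_poly k P)"
        using S(2) map_poly_degree_leq[of "del_var k" S] by (simp add: as_poly_of_poly)
      then show False
        using P_min[OF SJ ne] by simp
    qed
    then have "P dvd a ^ m * G"
      using eq by simp
    then show ?thesis
      using \<open>\<not> P dvd a\<close> P_prime by (metis prime_elem_dvd_multD prime_elem_dvd_power)
  qed
  obtain u where u: "F = P * u"
    using all[OF F(2)] by (auto simp: dvd_def)
  have "\<not> P dvd 1"
    using P(1) by (simp add: irreducible_def)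
  then have "u dvd 1"
    using irreducibleD[OF F(1) u] by blast
  then have "F dvd P"
    by (simp add: u)
  then show False
    using H all dvd_trans by blast
qed

section \<open>Projective varieties\<close>

abbreviation polys :: "'i set \<Rightarrow> ('i, 'a::field) mpoly set" where
  "polys S \<equiv> carrier (poly_ring S)"

lemma polys_iff: "F \<in> polys S \<longleftrightarrow> (\<forall>m\<in>Poly_Mapping.keys F. Poly_Mapping.keys m \<subseteq> S)"
  by (simp add: poly_ring_def)

lemma poly_ring_simps [simp]:
  "F \<otimes>\<^bsub>poly_ring S\<^esub> G = F * G" "F \<oplus>\<^bsub>poly_ring S\<^esub> G = F + G"
  "\<one>\<^bsub>poly_ring S\<^esub> = 1" "\<zero>\<^bsub>poly_ring S\<^esub> = 0"
  by (simp_all add: poly_ring_def)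

lemma polys_UNIV [simp]: "polys UNIV = UNIV"
  by (auto simp: polys_iff)

lemma polys_zero [simp]: "0 \<in> polys S"
  by (simp add: polys_iff)

lemma polys_Const [simp]: "Const c \<in> polys S"
  by (simp add: polys_iff)

lemma polys_one [simp]: "1 \<in> polys S"
  by (simp add: polys_iff)

lemma polys_Var [simp]: "Var i \<in> polys S \<longleftrightarrow> i \<in> S"
  by (simp add: polys_iff Var_def)

lemma polys_add: "F \<in> polys S \<Longrightarrow> G \<in> polys S \<Longrightarrow> F + G \<in> polys S"
  using keys_add[of F G] by (force simp: polys_iff)

lemma polys_uminus: "F \<in> polys S \<Longrightarrow> - F \<in> polys S"
  by (simp add: polys_iff in_keys_iff)

lemma polys_diff: "F \<in> polys S \<Longrightarrow> G \<in> polys S \<Longrightarrow> F - G \<in> polys S"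
  using polys_add[of F S "- G"] polys_uminus[of G S] by simp

lemma polys_mult:
  assumes "F \<in> polys S" "G \<in> polys S"
  shows "F * G \<in> polys S"
  unfolding polys_iff
proof
  fix m assume "m \<in> Poly_Mapping.keys (F * G)"
  then obtain a b where "m = a + b" "a \<in> Poly_Mapping.keys F" "b \<in> Poly_Mapping.keys G"
    using keys_mult[of F G] by blast
  then show "Poly_Mapping.keys m \<subseteq> S"
    using assms keys_add[of a b] unfolding polys_iff by blast
qed

lemma polys_sum: "(\<And>i. i \<in> A \<Longrightarrow> f i \<in> polys S) \<Longrightarrow> sum f A \<in> polys S"
  by (induction A rule: infinite_finite_induct) (auto intro: polys_add)

lemma polys_prod: "(\<And>i. i \<in> A \<Longrightarrow> f i \<in> polys S) \<Longrightarrow> prod f A \<in> polys S"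
  by (induction A rule: infinite_finite_induct) (auto intro: polys_mult)

lemma polys_power: "F \<in> polys S \<Longrightarrow> F ^ n \<in> polys S"
  by (induction n) (auto intro: polys_mult)

lemma polys_hcomp: "F \<in> polys S \<Longrightarrow> hcomp n F \<in> polys S"
  unfolding polys_iff using hcomp_keys by blast

lemma psubst_cong:
  assumes "F \<in> polys S" "\<And>i. i \<in> S \<Longrightarrow> x i = y i"
  shows "psubst \<phi> x F = psubst \<phi> y F"
proof -
  have "x i = y i" if "m \<in> Poly_Mapping.keys F" "i \<in> Poly_Mapping.keys m" for m i
    using that assms by (auto simp: polys_iff)
  then show ?thesis
    by (simp add: psubst_def)
qed

lemma polys_psubst:
  assumes "\<And>i. x i \<in> polys S"
  shows "psubst Const x F \<in> polys S"
  unfolding psubst_def by (intro polys_sum polys_mult polys_prod polys_power polys_Const assms)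

lemma cring_poly_ring: "cring (poly_ring S :: ('i, 'a::field) mpoly ring)"
proof (rule cringI)
  show "abelian_group (poly_ring S :: ('i, 'a) mpoly ring)"
  proof (rule abelian_groupI)
    fix F :: "('i, 'a) mpoly"
    assume "F \<in> polys S"
    then show "\<exists>G\<in>polys S. G \<oplus>\<^bsub>poly_ring S\<^esub> F = \<zero>\<^bsub>poly_ring S\<^esub>"
      by (intro bexI[of _ "- F"]) (simp_all add: polys_uminus)
  qed (simp_all add: polys_add algebra_simps)
  show "Group.comm_monoid (poly_ring S :: ('i, 'a) mpoly ring)"
    by (rule comm_monoidI) (simp_all add: polys_mult algebra_simps)
qed (simp add: algebra_simps)

definition restrict_vars :: "'i set \<Rightarrow> ('i, 'a::field) mpoly \<Rightarrow> ('i, 'a) mpoly" where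
  "restrict_vars S = psubst Const (\<lambda>i. if i \<in> S then Var i else 0)"

interpretation restrict_vars: ring_morph "restrict_vars S" for S
  unfolding restrict_vars_def by (rule ring_morph_psubst[OF ring_morph_single])

lemma restrict_vars_polys: "restrict_vars S F \<in> polys S"
  unfolding restrict_vars_def by (rule polys_psubst) simp

lemma psubst_Var_id: "psubst Const Var F = F"
  by (rule ring_morph_mpoly_eqI[OF ring_morph_psubst[OF ring_morph_single] ring_morph_id])
    (simp_all add: psubst_Const psubst_Var ring_morph_single)

lemma restrict_vars_id: "F \<in> polys S \<Longrightarrow> restrict_vars S F = F"
  using psubst_cong[of F S "\<lambda>i. if i \<in> S then Var i else 0" Var Const]
  by (simp add: restrict_vars_def psubst_Var_id)

text \<open>Inverse image under the retraction of all polynomials onto \<open>polys S\<close>. It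
  contains the variables outside \<open>S\<close>, as \<open>nullstellensatz\<close>
  demands.\<close>

lemma prime_id_restrict_vars:
  fixes J :: "('i, 'a::field) mpoly set"
  assumes "primeideal J (poly_ring S)"
  shows "prime_id {F. restrict_vars S F \<in> J}"
proof -
  interpret primeideal J "poly_ring S" by fact
  show ?thesis
  proof
    show "0 \<in> {F. restrict_vars S F \<in> J}"
      using additive_subgroup.zero_closed[OF additive_subgroup_axioms] by (simp add: restrict_vars.zero)
    show "1 \<notin> {F. restrict_vars S F \<in> J}"
      using I_notcarr one_imp_carrier by (auto simp: restrict_vars.one)
    show "F + G \<in> {F. restrict_vars S F \<in> J}"
      if "F \<in> {F. restrict_vars S F \<in> J}" "G \<in> {F. restrict_vars S F \<in> J}" for F G
      using that additive_subgroup.a_closed[OF additive_subgroup_axioms] by (simp add: restrict_vars.add)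
    show "H * F \<in> {F. restrict_vars S F \<in> J}" if "F \<in> {F. restrict_vars S F \<in> J}" for F H
      using that I_l_closed[OF _ restrict_vars_polys[of S H]] by (simp add: restrict_vars.mult)
    show "F \<in> {F. restrict_vars S F \<in> J} \<or> G \<in> {F. restrict_vars S F \<in> J}"
      if "F * G \<in> {F. restrict_vars S F \<in> J}" for F G
      using that I_prime[OF restrict_vars_polys restrict_vars_polys, of F G]
      by (simp add: restrict_vars.mult)
  qed
qed

lemma proj_space_iff:
  "L \<in> proj_space S \<longleftrightarrow> (\<exists>v\<in>coord_space S. v \<noteq> 0 \<and> L = vec.span {v})"
  for L :: "('i, 'a::field) point"
proof
  assume L: "L \<in> proj_space S"
  then have sub: "vec.subspace L" "L \<subseteq> coord_space S" "vec.dim L = 1"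
    by (auto simp: proj_space_def)
  obtain B where B: "B \<subseteq> L" "vec.independent B" "L \<subseteq> vec.span B" "card B = vec.dim L"
    using vec.basis_exists by blast
  then obtain v where v: "B = {v}"
    using sub by (auto simp: card_1_singleton_iff)
  have "v \<noteq> 0"
    using B v vec.dependent_zero by blast
  moreover have "L = vec.span {v}"
    using B v sub vec.span_minimal[of "{v}" L] by auto
  ultimately show "\<exists>v\<in>coord_space S. v \<noteq> 0 \<and> L = vec.span {v}"
    using B v sub by blast
next
  assume "\<exists>v\<in>coord_space S. v \<noteq> 0 \<and> L = vec.span {v}"
  then obtain v where v: "v \<in> coord_space S" "v \<noteq> 0" "L = vec.span {v}"
    by blast
  have "vec.independent {v}"
    using v by (simp add: vec.independent_insert)
  then have "vec.dim L = card {v}"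
    using v vec.dim_span_eq_card_independent by blast
  then show "L \<in> proj_space S"
    using v vec.span_minimal[of "{v}" "coord_space S"] coord_space_subspace
    by (auto simp: proj_space_def vec.subspace_span)
qed

lemma in_span_singleton: "w \<in> vec.span {v} \<longleftrightarrow> (\<exists>c. w = vscale c v)"
  by (auto simp: vec.span_singleton)

lemma span_singleton_eq:
  assumes "w \<in> vec.span {v}" "w \<noteq> 0"
  shows "vec.span {w} = vec.span {v}"
proof -
  obtain c where c: "w = vscale c v" "c \<noteq> 0"
    using assms by (auto simp: in_span_singleton)
  then have "v = vscale (inverse c) w"
    by (simp add: vscale_def fun_eq_iff)
  then have "v \<in> vec.span {w}"
    unfolding in_span_singleton by blast
  then show ?thesis
    using assms by (meson empty_subsetI insert_subset subset_antisym vec.span_minimal vec.subspace_span)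
qed

lemma span_eq_iff:
  "v \<noteq> 0 \<Longrightarrow> w \<noteq> 0 \<Longrightarrow> vec.span {w} = vec.span {v} \<longleftrightarrow> (\<exists>c. w = vscale c v)"
  using span_singleton_eq in_span_singleton vec.span_base by (metis singletonI)

lemma vanishes_at_span:
  assumes "homogeneous d F"
  shows "vanishes_at F (vec.span {v}) \<longleftrightarrow> peval F v = 0"
proof
  assume "vanishes_at F (vec.span {v})"
  then show "peval F v = 0"
    using vec.span_base[of v "{v}"] by (auto simp: vanishes_at_def)
qed (auto simp: vanishes_at_def in_span_singleton peval_scale[OF assms])

section \<open>Vanishing ideals and irreducible closed sets\<close>

definition vanishes_on :: "('i, 'a::field) mpoly \<Rightarrow> ('i, 'a) point set \<Rightarrow> bool" where
  "vanishes_on F Z \<longleftrightarrow> (\<forall>L\<in>Z. vanishes_at F L)"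

lemma vanishes_on_zero: "vanishes_on 0 Z"
  by (simp add: vanishes_on_def vanishes_at_def peval_simps)

lemma vanishes_on_add: "vanishes_on F Z \<Longrightarrow> vanishes_on G Z \<Longrightarrow> vanishes_on (F + G) Z"
  by (simp add: vanishes_on_def vanishes_at_def peval_simps)

lemma vanishes_on_mult_left: "vanishes_on F Z \<Longrightarrow> vanishes_on (G * F) Z"
  by (simp add: vanishes_on_def vanishes_at_def peval_simps)

lemma vanishes_on_mult_right: "vanishes_on F Z \<Longrightarrow> vanishes_on (F * G) Z"
  by (simp add: vanishes_on_def vanishes_at_def peval_simps)

lemma vanishes_on_sum: "(\<And>i. i \<in> A \<Longrightarrow> vanishes_on (f i) Z) \<Longrightarrow> vanishes_on (sum f A) Z"
  by (induction A rule: infinite_finite_induct) (auto intro: vanishes_on_zero vanishes_on_add)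

text \<open>Zariski closed and irreducible, both tested on forms and without the choice of an ideal.
  In this shape the property can be moved along the Veronese map;
  \<open>projective_variety_iff\<close> gives the equivalence for nonempty sets.\<close>

definition irreducible_closed :: "'i set \<Rightarrow> ('i, 'a::field) point set \<Rightarrow> bool" where
  "irreducible_closed S Z \<longleftrightarrow> finite S \<and> Z \<noteq> {} \<and> Z \<subseteq> proj_space S \<and>
     (\<forall>L\<in>proj_space S. (\<forall>d. \<forall>F\<in>polys S. homogeneous d F \<longrightarrow> vanishes_on F Z \<longrightarrow> vanishes_at F L) \<longrightarrow> L \<in> Z) \<and>
     (\<forall>d e. \<forall>F\<in>polys S. \<forall>G\<in>polys S. homogeneous d F \<longrightarrow> homogeneous e G \<longrightarrow>
        vanishes_on (F * G) Z \<longrightarrow> vanishes_on F Z \<or> vanishes_on G Z)"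

text \<open>Vanishing is imposed on each homogeneous component, so the ideal is homogeneous by
  construction.\<close>

definition vanishing_ideal :: "'i set \<Rightarrow> ('i, 'a::field) point set \<Rightarrow> ('i, 'a) mpoly set" where
  "vanishing_ideal S Z = {F \<in> polys S. \<forall>n. vanishes_on (hcomp n F) Z}"

lemma vanishing_ideal_homogeneous:
  "homogeneous d F \<Longrightarrow> F \<in> vanishing_ideal S Z \<longleftrightarrow> F \<in> polys S \<and> vanishes_on F Z"
  by (auto simp: vanishing_ideal_def hcomp_homogeneous vanishes_on_zero)

lemma vanishing_ideal_zero: "0 \<in> vanishing_ideal S Z"
  by (simp add: vanishing_ideal_def grading.zero vanishes_on_zero)

lemma vanishing_ideal_add:
  "F \<in> vanishing_ideal S Z \<Longrightarrow> G \<in> vanishing_ideal S Z \<Longrightarrow> F + G \<in> vanishing_ideal S Z"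
  by (simp add: vanishing_ideal_def grading.add vanishes_on_add polys_add)

lemma vanishing_ideal_mult:
  "F \<in> vanishing_ideal S Z \<Longrightarrow> G \<in> polys S \<Longrightarrow> G * F \<in> vanishing_ideal S Z"
  by (auto simp: vanishing_ideal_def grading.mult coeff_mult polys_mult
      intro!: vanishes_on_sum vanishes_on_mult_left)

text \<open>Irreducibility is known for forms only. For general polynomials compare the components
  of largest degree that do not vanish on \<open>Z\<close>.\<close>

lemma vanishing_ideal_prime:
  assumes Z: "irreducible_closed S Z" and F: "F \<in> polys S" and G: "G \<in> polys S"
    and FG: "F * G \<in> vanishing_ideal S Z"
  shows "F \<in> vanishing_ideal S Z \<or> G \<in> vanishing_ideal S Z"
proof (rule ccontr)
  assume neg: "\<not> ?thesis"
  define top where "top H = Max {n. \<not> vanishes_on (hcomp n H) Z}" for H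
  have top: "\<not> vanishes_on (hcomp (top H) H) Z \<and> (\<forall>n>top H. vanishes_on (hcomp n H) Z)"
    if H: "H \<in> polys S" "H \<notin> vanishing_ideal S Z" for H
  proof -
    let ?A = "{n. \<not> vanishes_on (hcomp n H) Z}"
    have "?A \<subseteq> {..degree (grading H)}"
      by (auto simp: vanishes_on_zero intro!: le_degree)
    then have fin: "finite ?A"
      by (rule finite_subset) simp
    have "?A \<noteq> {}"
      using H by (auto simp: vanishing_ideal_def)
    then have "top H \<in> ?A"
      unfolding top_def using Max_in[OF fin] by blast
    moreover have "n \<notin> ?A" if "n > top H" for n
      using Max_ge[OF fin, of n] that unfolding top_def by auto
    ultimately show ?thesis
      by simp
  qed
  have tF: "\<not> vanishes_on (hcomp (top F) F) Z" "\<And>n. n > top F \<Longrightarrow> vanishes_on (hcomp n F) Z"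
    and tG: "\<not> vanishes_on (hcomp (top G) G) Z" "\<And>n. n > top G \<Longrightarrow> vanishes_on (hcomp n G) Z"
    using top[OF F] top[OF G] neg by blast+
  let ?n = "top F + top G"
  \<comment> \<open>In every other summand one factor has degree above its \<open>top\<close> and so
    vanishes on \<open>Z\<close>.\<close>
  have eq: "hcomp ?n (F * G) = hcomp (top F) F * hcomp (top G) G +
      (\<Sum>i\<in>{..?n} - {top F}. hcomp i F * hcomp (?n - i) G)"
    by (simp add: grading.mult coeff_mult sum.remove[of "{..?n}" "top F"])
  have rest: "vanishes_on (\<Sum>i\<in>{..?n} - {top F}. hcomp i F * hcomp (?n - i) G) Z"
  proof (rule vanishes_on_sum)
    fix i assume "i \<in> {..?n} - {top F}"
    then have "i > top F \<or> ?n - i > top G"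
      by auto
    then show "vanishes_on (hcomp i F * hcomp (?n - i) G) Z"
      using tF tG vanishes_on_mult_left vanishes_on_mult_right by blast
  qed
  have "vanishes_on (hcomp ?n (F * G)) Z"
    using FG by (simp add: vanishing_ideal_def)
  then have "vanishes_on (hcomp (top F) F * hcomp (top G) G) Z"
    using vanishes_on_add[OF _ vanishes_on_mult_left[OF rest, of "- 1"]]
    by (fastforce simp: eq)
  then show False
    using Z tF(1) tG(1) homogeneous_hcomp polys_hcomp[OF F] polys_hcomp[OF G]
    unfolding irreducible_closed_def by blast
qed

lemma not_vanishes_on_one:
  assumes "irreducible_closed S Z" "c \<noteq> 0"
  shows "\<not> vanishes_on (Const c) Z"
proof -
  obtain L where L: "L \<in> Z" "L \<in> proj_space S"
    using assms(1) unfolding irreducible_closed_def by blast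
  then obtain v where "L = vec.span {v}"
    unfolding proj_space_iff by blast
  then have "\<not> vanishes_at (Const c) L"
    using assms(2) vanishes_at_span[OF homogeneous_Const, of c v] by (simp add: peval_Const)
  then show ?thesis
    using L(1) unfolding vanishes_on_def by blast
qed

text \<open>The vanishing ideal is the required prime ideal, and closedness says that
  \<open>Z\<close> is its zero set. This direction holds over any field.\<close>

lemma projective_variety_if_irreducible_closed:
  assumes Z: "irreducible_closed S Z"
  shows "projective_variety S Z"
proof -
  let ?J = "vanishing_ideal S Z"
  interpret R: cring "poly_ring S"
    by (rule cring_poly_ring)
  have uminus: "- F \<in> ?J" if "F \<in> ?J" for F
    using vanishing_ideal_mult[OF that, of "- 1"] by (simp add: polys_uminus)
  have ideal: "ideal ?J (poly_ring S)"
  proof (rule idealI)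
    show "ring (poly_ring S :: ('a, 'b) mpoly ring)"
      by (rule R.ring_axioms)
    show "subgroup ?J (add_monoid (poly_ring S))"
    proof (rule R.add.subgroupI)
      show "?J \<subseteq> polys S" "?J \<noteq> {}"
        using vanishing_ideal_zero[of S Z] by (auto simp: vanishing_ideal_def)
      fix F G assume FG: "F \<in> ?J" "G \<in> ?J"
      show "F \<oplus>\<^bsub>poly_ring S\<^esub> G \<in> ?J"
        using FG by (simp add: vanishing_ideal_add)
      have "F \<in> polys S"
        using FG by (simp add: vanishing_ideal_def)
      then have "\<ominus>\<^bsub>poly_ring S\<^esub> F = - F"
        by (intro R.minus_equality) (simp_all add: polys_uminus)
      then show "\<ominus>\<^bsub>poly_ring S\<^esub> F \<in> ?J"
        using uminus FG by simp
    qed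
    show "F \<otimes>\<^bsub>poly_ring S\<^esub> G \<in> ?J" "G \<otimes>\<^bsub>poly_ring S\<^esub> F \<in> ?J"
      if "F \<in> ?J" "G \<in> polys S" for F G
      using vanishing_ideal_mult[OF that] by (simp_all add: mult.commute[of F G])
  qed
  have "1 \<notin> ?J"
    using not_vanishes_on_one[OF Z, of 1] vanishing_ideal_homogeneous[OF homogeneous_one, of S Z] by simp
  then have "polys S \<noteq> ?J"
    using polys_one by blast
  then have prime: "primeideal ?J (poly_ring S)"
    using vanishing_ideal_prime[OF Z] by (intro primeidealI ideal cring_poly_ring) simp_all
  have gen: "?J = genideal (poly_ring S) {F \<in> ?J. \<exists>d. homogeneous d F}" (is "_ = ?G")
  proof
    show "?G \<subseteq> ?J"
      by (rule R.genideal_minimal[OF ideal]) auto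
    have G: "ideal ?G (poly_ring S)"
      by (rule R.genideal_ideal) (auto simp: vanishing_ideal_def)
    have sub: "additive_subgroup ?G (poly_ring S)"
      by (rule ideal.axioms(1)[OF G])
    show "?J \<subseteq> ?G"
    proof
      fix F assume F: "F \<in> ?J"
      have "hcomp n F \<in> ?J" for n
        unfolding vanishing_ideal_homogeneous[OF homogeneous_hcomp]
        using F by (simp add: vanishing_ideal_def polys_hcomp)
      then have "hcomp n F \<in> {F \<in> ?J. \<exists>d. homogeneous d F}" for n
        using homogeneous_hcomp[of n F] by blast
      then have "hcomp n F \<in> ?G" for n
        by (intro subsetD[OF R.genideal_self]) (auto simp: vanishing_ideal_def)
      moreover have "F1 + F2 \<in> ?G" if "F1 \<in> ?G" "F2 \<in> ?G" for F1 F2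
        using additive_subgroup.a_closed[OF sub that] by simp
      moreover have "0 \<in> ?G"
        using additive_subgroup.zero_closed[OF sub] by simp
      ultimately have "(\<Sum>n\<in>A. hcomp n F) \<in> ?G" for A
        by (induction A rule: infinite_finite_induct) (simp_all only: sum.infinite sum.empty sum.insert not_False_eq_True)
      then have "(\<Sum>n\<le>degree (grading F). hcomp n F) \<in> ?G"
        by blast
      then show "F \<in> ?G"
        by (simp only: sum_hcomp[symmetric])
    qed
  qed
  have "Z = vanishing_set S ?J"
  proof
    show "Z \<subseteq> vanishing_set S ?J"
      using Z vanishing_ideal_homogeneous
      by (fastforce simp: vanishing_set_def irreducible_closed_def vanishes_on_def)
    show "vanishing_set S ?J \<subseteq> Z"
      using Z vanishing_ideal_homogeneous
      unfolding vanishing_set_def irreducible_closed_def by blast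
  qed
  then show ?thesis
    using Z prime ideal gen
    unfolding projective_variety_def homogeneous_ideal_def irreducible_closed_def by blast
qed

text \<open>Forms not vanishing on \<open>Z\<close> lie outside the prime ideal, hence so does their
  product; the Nullstellensatz gives a zero of the ideal where the product is nonzero, which is a
  point of \<open>Z\<close>.\<close>

lemma irreducible_closed_if_projective_variety:
  fixes Z :: "('i, 'a::alg_closed_field) point set"
  assumes Z: "projective_variety S Z" "Z \<noteq> {}"
  shows "irreducible_closed S Z"
proof -
  obtain J where fin: "finite S" and J: "primeideal J (poly_ring S)" and ZJ: "Z = vanishing_set S J"
    using Z by (auto simp: projective_variety_def)
  interpret J: primeideal J "poly_ring S" by fact
  define J' where "J' = {F :: ('i, 'a) mpoly. restrict_vars S F \<in> J}"
  interpret J': prime_id J'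
    unfolding J'_def by (rule prime_id_restrict_vars[OF J])
  have J'_iff: "F \<in> J' \<longleftrightarrow> F \<in> J" if "F \<in> polys S" for F
    using that by (simp add: J'_def restrict_vars_id)
  have Var_J': "Var i \<in> J'" if "i \<notin> S" for i
    using that additive_subgroup.zero_closed[OF J.additive_subgroup_axioms]
    by (simp add: J'_def restrict_vars_def psubst_Var[OF ring_morph_single])
  have sub: "Z \<subseteq> proj_space S"
    by (auto simp: ZJ vanishing_set_def)
  have irr: "vanishes_on F Z \<or> vanishes_on G Z"
    if F: "F \<in> polys S" "homogeneous d F" and G: "G \<in> polys S" "homogeneous e G"
      and FG: "vanishes_on (F * G) Z" for d e F G
  proof (rule ccontr)
    assume neg: "\<not> (vanishes_on F Z \<or> vanishes_on G Z)"
    have "F \<notin> J" "G \<notin> J"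
      using neg F G unfolding ZJ vanishing_set_def vanishes_on_def by blast+
    then have "F * G \<notin> J'"
      using J'.prime J'_iff F G by blast
    then obtain v where v: "\<And>H. H \<in> J' \<Longrightarrow> peval H v = 0" and FGv: "peval (F * G) v \<noteq> 0"
      using nullstellensatz[OF fin J'.prime_id_axioms Var_J'] by blast
    have hom: "homogeneous (d + e) (F * G)"
      by (rule homogeneous_mult[OF F(2) G(2)])
    have "v \<in> coord_space S"
      using v[OF Var_J'] by (auto simp: coord_space_def peval_Var)
    \<comment> \<open>A line contains the zero vector, so the product, which vanishes on a line of
      the nonempty \<open>Z\<close>, is 0 there. This excludes the irrelevant ideal.\<close>
    moreover have "v \<noteq> 0"
    proof
      assume v0: "v = 0"
      obtain L where "L \<in> Z"
        using Z by blast
      then obtain w where w: "L = vec.span {w}"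
        using sub proj_space_iff by blast
      then have "peval (F * G) (vscale 0 w) = 0"
        using FG \<open>L \<in> Z\<close> unfolding vanishes_on_def vanishes_at_def
        by (metis in_span_singleton)
      moreover have "vscale 0 w = v"
        by (simp add: v0)
      ultimately show False
        using FGv by simp
    qed
    ultimately have "vec.span {v} \<in> proj_space S"
      by (auto simp: proj_space_iff)
    moreover have "vanishes_at H (vec.span {v})" if "H \<in> J" "homogeneous n H" for H n
      using that v J'_iff J.Icarr by (auto simp: vanishes_at_span)
    ultimately have "vec.span {v} \<in> Z"
      by (auto simp: ZJ vanishing_set_def)
    then show False
      using FG FGv vanishes_at_span[OF hom] by (auto simp: vanishes_on_def)
  qed
  have closed: "L \<in> Z" if "L \<in> proj_space S"
    "\<And>d F. F \<in> polys S \<Longrightarrow> homogeneous d F \<Longrightarrow> vanishes_on F Z \<Longrightarrow> vanishes_at F L" for L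
    using that J.Icarr unfolding ZJ vanishing_set_def vanishes_on_def by blast
  show ?thesis
    unfolding irreducible_closed_def using fin Z(2) sub irr closed by blast
qed

lemma projective_variety_iff:
  fixes Z :: "('i, 'a::alg_closed_field) point set"
  shows "Z \<noteq> {} \<Longrightarrow> projective_variety S Z \<longleftrightarrow> irreducible_closed S Z"
  using projective_variety_if_irreducible_closed irreducible_closed_if_projective_variety by blast

text \<open>A point [v] with \<open>v i\<close> nonzero is cut out by the linear forms v_i x_j - v_j
  x_i, and vanishing of a form on it is vanishing at \<open>v\<close>.\<close>

lemma irreducible_closed_point:
  assumes "finite S" "L \<in> proj_space S"
  shows "irreducible_closed S {L}"
proof -
  obtain v where v: "v \<in> coord_space S" "v \<noteq> 0" "L = vec.span {v}"
    using assms by (auto simp: proj_space_iff)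
  have "L' = L" if L': "L' \<in> proj_space S"
    and van: "\<And>d F. F \<in> polys S \<Longrightarrow> homogeneous d F \<Longrightarrow> vanishes_on F {L} \<Longrightarrow> vanishes_at F L'" for L'
  proof -
    obtain w where w: "w \<in> coord_space S" "w \<noteq> 0" "L' = vec.span {w}"
      using L' by (auto simp: proj_space_iff)
    obtain i where i: "v i \<noteq> 0" "i \<in> S"
      using v by (auto simp: coord_space_def fun_eq_iff)
    have "v i * w j = v j * w i" if j: "j \<in> S" for j
    proof -
      let ?F = "Const (v i) * Var j - Const (v j) * Var i"
      have hom: "homogeneous 1 ?F"
        by (intro homogeneous_diff homogeneous_Const_mult homogeneous_Var)
      have "vanishes_on ?F {L}"
        unfolding vanishes_on_def v by (simp add: vanishes_at_span[OF hom] peval_simps)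
      then have "vanishes_at ?F L'"
        using i j by (intro van[OF _ hom]) (auto intro!: polys_diff polys_mult)
      then show ?thesis
        unfolding w by (simp add: vanishes_at_span[OF hom] peval_simps)
    qed
    then have "v i * w j = v j * w i" for j
      using v(1) w(1) by (cases "j \<in> S") (auto simp: coord_space_def)
    then have "w = vscale (w i / v i) v"
      using i by (auto simp: vscale_def fun_eq_iff field_simps)
    then show ?thesis
      using v w span_eq_iff by blast
  qed
  moreover have "vanishes_on F {L} \<or> vanishes_on G {L}"
    if "homogeneous d F" "homogeneous e G" "vanishes_on (F * G) {L}" for d e F G
    using that vanishes_at_span[OF homogeneous_mult[OF that(1,2)]]
    by (auto simp: vanishes_on_def v(3) vanishes_at_span peval_simps)
  ultimately show ?thesis
    using assms unfolding irreducible_closed_def by blast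
qed

section \<open>Plane curves\<close>

definition plane_curve :: "(3, 'a::field) mpoly \<Rightarrow> (3, 'a) point set" where
  "plane_curve F = {L \<in> proj_space UNIV. vanishes_at F L}"

lemma coord_space_UNIV [simp]: "coord_space UNIV = UNIV"
  by (simp add: coord_space_def)

lemma span_in_proj_space_UNIV: "v \<noteq> 0 \<Longrightarrow> vec.span {v} \<in> proj_space UNIV"
  by (auto simp: proj_space_iff)

lemma irreducible_not_unit': "Factorial_Ring.irreducible F \<Longrightarrow> \<not> F dvd 1"
  by (simp add: irreducible_def)

lemma irreducible_homogeneous_degree_pos:
  fixes F :: "('i::linorder, 'a::field) mpoly"
  assumes "Factorial_Ring.irreducible F" "homogeneous d F"
  shows "d > 0"
proof (rule ccontr)
  assume "\<not> d > 0"
  then have "F = Const (Poly_Mapping.lookup F 0)"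
    using homogeneous_0_D assms by simp
  moreover have "F \<noteq> 0"
    using assms by auto
  ultimately have "F dvd 1"
    unfolding unit_mpoly_iff by (metis single_zero)
  then show False
    using assms irreducible_not_unit' by blast
qed

text \<open>Restrict \<open>F\<close> to the line in its two affine charts u + t w and w + t u. A
  nonconstant restriction has a root; if both are constant, homogeneity of positive degree makes
  \<open>F\<close> vanish at \<open>u\<close>.\<close>

lemma line_meets_zero_set:
  fixes F :: "('i, 'a::alg_closed_field) mpoly"
  assumes F: "homogeneous d F" "d > 0"
  shows "\<exists>a b. (a \<noteq> 0 \<or> b \<noteq> 0) \<and> peval F (\<lambda>i. a * u i + b * w i) = 0"
proof -
  define p where "p u w = psubst (\<lambda>c. [:c:]) (\<lambda>i. [:u i, w i:]) F" for u w :: "'i \<Rightarrow> 'a"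
  have p: "poly (p u w) t = peval F (\<lambda>i. u i + t * w i)" for u w t
    unfolding p_def
    by (rule ring_morph_mpoly_eqI[OF ring_morph_comp[OF ring_morph_poly ring_morph_psubst[OF ring_morph_pCons]]
          ring_morph_peval])
      (simp_all add: psubst_Const psubst_Var ring_morph_pCons peval_simps)
  show ?thesis
  proof (cases "degree (p u w) > 0")
    case True
    then obtain t where "poly (p u w) t = 0"
      using alg_closed_imp_poly_has_root by blast
    then have "peval F (\<lambda>i. 1 * u i + t * w i) = 0"
      by (simp add: p)
    then show ?thesis
      by (metis one_neq_zero)
  next
    case False
    show ?thesis
    proof (cases "degree (p w u) > 0")
      case True
      then obtain t where "poly (p w u) t = 0"
        using alg_closed_imp_poly_has_root by blast
      then have "peval F (\<lambda>i. t * u i + 1 * w i) = 0"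
        by (simp add: p add.commute)
      then show ?thesis
        by (metis one_neq_zero)
    next
      case False': False
      obtain c c' where c: "p u w = [:c:]" "p w u = [:c':]"
        using False False' by (metis degree_eq_zeroE not_gr_zero)
      \<comment> \<open>The two charts differ by the scalar \<open>t\<close>. Comparing two
        constants for infinitely many \<open>t\<close> forces \<open>c\<close> to be 0.\<close>
      have "c = t ^ d * c'" if "t \<noteq> 0" for t
      proof -
        have "vscale t (\<lambda>i. w i + inverse t * u i) = (\<lambda>i. u i + t * w i)"
          using that by (simp add: vscale_def fun_eq_iff field_simps)
        then have "peval F (\<lambda>i. u i + t * w i) = t ^ d * peval F (\<lambda>i. w i + inverse t * u i)"
          using peval_scale[OF F(1)] by metis
        then show ?thesis
          using p[of u w t] p[of w u "inverse t"] by (simp add: c)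
      qed
      then have "poly (monom c' d - [:c:]) t = 0" if "t \<noteq> 0" for t
        using that by (simp add: poly_monom)
      then have "UNIV - {0} \<subseteq> {t. poly (monom c' d - [:c:]) t = 0}"
        by auto
      moreover have "infinite (UNIV - {0 :: 'a})"
        using infinite_alg_closed[where 'a = 'a] by simp
      ultimately have "infinite {t. poly (monom c' d - [:c:]) t = 0}"
        using finite_subset by blast
      then have "monom c' d - [:c:] = 0"
        using poly_roots_finite by blast
      then have "coeff (monom c' d - [:c:]) 0 = 0"
        by simp
      then have "c = 0"
        using F(2) by simp
      then have "peval F (\<lambda>i. 1 * u i + 0 * w i) = 0"
        using p[of u w 0] by (simp add: c)
      then show ?thesis
        by (metis one_neq_zero)
    qed
  qed
qed

lemma third_index: "\<exists>k::3. k \<noteq> i \<and> k \<noteq> j"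
proof -
  have "(1::3) \<noteq> 2" "(1::3) \<noteq> 3" "(2::3) \<noteq> 3"
    by simp_all
  then show ?thesis
    by metis
qed

lemma exhaust_3_distinct: "i \<noteq> j \<Longrightarrow> k \<noteq> i \<Longrightarrow> k \<noteq> j \<Longrightarrow> n = i \<or> n = j \<or> n = (k::3)"
  using exhaust_3[of i] exhaust_3[of j] exhaust_3[of k] exhaust_3[of n] by metis

text \<open>Choose a coordinate that is nonzero on \<open>L\<close>. The line where this coordinate
  vanishes misses \<open>L\<close> but meets the curve.\<close>

lemma plane_curve_other_point:
  fixes F :: "(3, 'a::alg_closed_field) mpoly"
  assumes F: "homogeneous d F" "d > 0" and L: "L \<in> proj_space UNIV"
  shows "\<exists>L'\<in>plane_curve F. L' \<noteq> L"
proof -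
  obtain v where v: "v \<noteq> 0" "L = vec.span {v}"
    using L by (auto simp: proj_space_iff)
  then obtain i where i: "v i \<noteq> 0"
    by (auto simp: fun_eq_iff)
  obtain j where j: "j \<noteq> i"
    using third_index by blast
  obtain k where k: "k \<noteq> i" "k \<noteq> j"
    using third_index by blast
  define u where "u = (\<lambda>n. if n = j then 1 else 0 :: 'a)"
  define w where "w = (\<lambda>n. if n = k then 1 else 0 :: 'a)"
  obtain a b where ab: "a \<noteq> 0 \<or> b \<noteq> 0" "peval F (\<lambda>n. a * u n + b * w n) = 0"
    using line_meets_zero_set[OF F] by blast
  define x where "x = (\<lambda>n. a * u n + b * w n)"
  have "x j = a" "x k = b" "x i = 0"
    using j k by (auto simp: x_def u_def w_def)
  then have "x \<noteq> 0"
    using ab(1) by auto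
  then have "vec.span {x} \<in> plane_curve F"
    using ab(2) by (simp add: plane_curve_def span_in_proj_space_UNIV vanishes_at_span[OF F(1)] x_def)
  moreover have "vec.span {x} \<noteq> L"
  proof
    assume "vec.span {x} = L"
    then obtain c where "v = vscale c x"
      using v \<open>x \<noteq> 0\<close> span_eq_iff[of x v] by auto
    then show False
      using i \<open>x i = 0\<close> by (simp add: vscale_def)
  qed
  ultimately show ?thesis
    by blast
qed

lemma prime_id_multiples:
  assumes "prime_elem F"
  shows "prime_id {G. F dvd G}"
  using assms by unfold_locales (auto simp: prime_elem_def)

lemma vanishes_on_plane_curve: "vanishes_on F (plane_curve F)"
  by (simp add: vanishes_on_def plane_curve_def)

context
  fixes F :: "(3, 'a::{alg_closed_field, factorial_ring_gcd, semiring_gcd_mult_normalize}) mpoly" and d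
  assumes irr: "Factorial_Ring.irreducible F" and hom: "homogeneous d F"
begin

lemma plane_curve_nonempty: "plane_curve F \<noteq> {}"
proof -
  have "vec.span {\<lambda>_. 1} \<in> (proj_space UNIV :: (3, 'a) point set)"
    by (rule span_in_proj_space_UNIV) (simp add: fun_eq_iff)
  then show ?thesis
    using plane_curve_other_point[OF hom irreducible_homogeneous_degree_pos[OF irr hom]] by blast
qed

text \<open>Apply the Nullstellensatz to the prime ideal of multiples of \<open>F\<close>. The
  resulting vector is nonzero since \<open>G\<close>, vanishing on some line, vanishes at 0.\<close>

lemma dvd_if_vanishes_on_plane_curve:
  assumes G: "homogeneous e G" "vanishes_on G (plane_curve F)"
  shows "F dvd G"
proof (rule ccontr)
  assume "\<not> F dvd G"
  then obtain v where "\<forall>A\<in>{A. F dvd A}. peval A v = 0" and Gv: "peval G v \<noteq> 0"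
    using nullstellensatz[OF finite_class.finite_UNIV prime_id_multiples[OF mpoly3_irreducible_imp_prime_elem[OF irr]], of G]
    by auto
  then have v: "peval F v = 0" "peval G v \<noteq> 0"
    by simp_all
  have "v \<noteq> 0"
  proof
    assume "v = 0"
    obtain L where "L \<in> plane_curve F"
      using plane_curve_nonempty by blast
    then have "0 \<in> L" "vanishes_at G L"
      using G(2) vec.subspace_0 by (auto simp: vanishes_on_def plane_curve_def proj_space_def)
    then show False
      using v \<open>v = 0\<close> by (auto simp: vanishes_at_def)
  qed
  then have "vec.span {v} \<in> plane_curve F"
    using v by (simp add: plane_curve_def span_in_proj_space_UNIV vanishes_at_span[OF hom])
  then show False
    using G v vanishes_at_span[OF G(1)] by (auto simp: vanishes_on_def)
qed

lemma vanishes_on_plane_curve_iff: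
  "homogeneous e G \<Longrightarrow> vanishes_on G (plane_curve F) \<longleftrightarrow> F dvd G"
  using dvd_if_vanishes_on_plane_curve vanishes_on_mult_right[OF vanishes_on_plane_curve]
  by (auto simp: dvd_def)

lemma irreducible_closed_plane_curve: "irreducible_closed UNIV (plane_curve F)"
proof -
  have "vanishes_on G (plane_curve F) \<or> vanishes_on H (plane_curve F)"
    if "homogeneous d G" "homogeneous e H" "vanishes_on (G * H) (plane_curve F)" for d e G H
    using that homogeneous_mult[OF that(1,2)]
      prime_elem_dvd_multD[OF mpoly3_irreducible_imp_prime_elem[OF irr], of G H]
    by (simp add: vanishes_on_plane_curve_iff)
  moreover have "L \<in> plane_curve F" if "L \<in> proj_space UNIV"
    "\<And>d G. homogeneous d G \<Longrightarrow> vanishes_on G (plane_curve F) \<Longrightarrow> vanishes_at G L" for L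
    using that(2)[OF hom vanishes_on_plane_curve] that(1) by (simp add: plane_curve_def)
  ultimately show ?thesis
    using plane_curve_nonempty unfolding irreducible_closed_def polys_UNIV
    by (auto simp: plane_curve_def)
qed

end

text \<open>Factors of a form are forms whose degrees add up to 1, so one of them is a
  constant.\<close>

lemma irreducible_if_homogeneous_1:
  fixes F :: "('i::linorder, 'a::field) mpoly"
  assumes F: "homogeneous 1 F" "F \<noteq> 0"
  shows "Factorial_Ring.irreducible F"
proof (rule irreducibleI)
  show "\<not> F dvd 1"
  proof
    assume "F dvd 1"
    then obtain c where "F = Const c"
      using unit_mpoly_iff by blast
    then show False
      using homogeneous_unique_degree[OF F(1) _ F(2), of 0] by simp
  qed
  fix A B
  assume AB: "F = A * B"
  obtain e where e: "homogeneous e A"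
    using homogeneous_dvd[OF F] AB by (metis dvd_triv_left)
  obtain e' where e': "homogeneous e' B"
    using homogeneous_dvd[OF F] AB by (metis dvd_triv_right)
  have "e + e' = 1"
    using homogeneous_unique_degree[OF homogeneous_mult[OF e e'], of 1] F AB by simp
  then have "e = 0 \<or> e' = 0"
    by auto
  moreover have "A \<noteq> 0" "B \<noteq> 0"
    using F AB by auto
  ultimately show "A dvd 1 \<or> B dvd 1"
    unfolding unit_mpoly_iff using homogeneous_0_D e e' by (metis single_zero)
qed (rule F)

lemma prime_id_vanishing_ideal: 
  assumes "irreducible_closed (UNIV :: 'i set) Z"
  shows "prime_id (vanishing_ideal UNIV Z :: ('i, 'a::field) mpoly set)"
proof
  show "1 \<notin> vanishing_ideal UNIV Z"
    using not_vanishes_on_one[OF assms, of 1] vanishing_ideal_homogeneous[OF homogeneous_one] by auto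
qed (use vanishing_ideal_prime[OF assms] in
    \<open>auto simp: vanishing_ideal_zero vanishing_ideal_add vanishing_ideal_mult\<close>)

lemma peval_del_var: "peval (del_var k c) q = peval c (q(k := 0))"
  by (rule ring_morph_mpoly_eqI[OF ring_morph_comp[OF ring_morph_peval ring_morph_del_var] ring_morph_peval])
    (simp_all add: peval_simps)

lemma hcomp_del_var: "hcomp n (del_var k c) = del_var k (hcomp n c)"
proof -
  have "grading (del_var k c) = map_poly (del_var k) (grading c)"
    by (rule ring_morph_mpoly_eqI[OF ring_morph_comp[OF grading.ring_morph_axioms ring_morph_del_var]
          ring_morph_comp[OF ring_morph_map_poly[OF ring_morph_del_var] grading.ring_morph_axioms]])
      (simp_all add: grading_def psubst_Const psubst_Var ring_morph_Const_pCons map_poly_pCons psubst_zero)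
  then show ?thesis
    by (simp add: coeff_map_poly)
qed

text \<open>Eliminating the third variable from two coprime forms vanishing on \<open>Z\<close> yields a binary form;
  its factor through a given point of \<open>Z\<close> is linear and lies in the prime ideal of \<open>Z\<close>.\<close>

lemma irreducible_closed_subset_plane_curve:
  fixes F :: "(3, 'a::{alg_closed_field, factorial_ring_gcd, semiring_gcd_mult_normalize}) mpoly"
  assumes Z: "irreducible_closed UNIV Z"
    and F: "Factorial_Ring.irreducible F" "homogeneous d F" "vanishes_on F Z"
    and H: "homogeneous e H" "vanishes_on H Z" "\<not> F dvd H"
    and P: "P \<in> Z" "Q \<in> Z"
  shows "P = Q"
proof -
  let ?I = "vanishing_ideal UNIV Z"
  have I: "prime_id ?I"
    by (rule prime_id_vanishing_ideal[OF Z])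
  interpret I: prime_id ?I by (rule I)
  have sub: "Z \<subseteq> proj_space UNIV"
    using Z by (simp add: irreducible_closed_def)
  obtain p q where p: "p \<noteq> 0" "P = vec.span {p}" and q: "q \<noteq> 0" "Q = vec.span {q}"
    using sub P by (meson proj_space_iff subsetD)
  \<comment> \<open>Proportionality of \<open>p\<close> and \<open>q\<close> is proved for two
    coordinates at a time, projecting from the coordinate point of the remaining index
    \<open>k\<close>.\<close>
  have minor: "p j * q i = p i * q j" if ij: "i \<noteq> j" for i j
  proof (cases "p i = 0 \<and> p j = 0")
    case False
    obtain k where k: "k \<noteq> i" "k \<noteq> j"
      using third_index by blast
    obtain c where c: "c \<in> ?I" "c \<noteq> 0" "del_var k c = c"
      using elimination[OF I F(1)] F H by (metis UNIV_I polys_UNIV vanishing_ideal_homogeneous)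
    \<comment> \<open>Passing to a nonzero component keeps membership in the ideal and the absence
      of \<open>Var k\<close>, and makes the factor \<open>c1\<close> below a form.\<close>
    obtain n where n: "hcomp n c \<noteq> 0"
      using sum_hcomp[of c] c(2) by (metis sum.neutral)
    have "hcomp n c \<in> ?I"
      unfolding vanishing_ideal_homogeneous[OF homogeneous_hcomp] using c(1)
      by (simp add: vanishing_ideal_def)
    then obtain c1 where c1: "Factorial_Ring.irreducible c1" "c1 \<in> ?I" "c1 dvd hcomp n c"
      using mpoly3_irreducible_factor_in_prime_id[OF I _ n] by blast
    obtain m where m: "homogeneous m c1"
      using homogeneous_dvd[OF homogeneous_hcomp n c1(3)] by blast
    have "degree (as_poly k (hcomp n c)) = 0"
      using c(3) hcomp_del_var[of k c n] by (simp flip: del_var_fixed_iff)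
    then have del: "del_var k c1 = c1"
      using degree_as_poly_dvd[OF c1(3) n, of k] by (simp add: del_var_fixed_iff)
    have "vanishes_on c1 Z"
      using c1(2) vanishing_ideal_homogeneous[OF m] by blast
    then have c1p: "peval c1 p = 0"
      using P(1) p vanishes_at_span[OF m] by (auto simp: vanishes_on_def)
    \<comment> \<open>The line joining [p] to the \<open>k\<close>-th coordinate point.\<close>
    define l where "l = Const (p j) * Var i - Const (p i) * Var j"
    have l: "homogeneous 1 l"
      unfolding l_def by (intro homogeneous_diff homogeneous_Const_mult homogeneous_Var)
    have pl: "peval l x = p j * x i - p i * x j" for x
      by (simp add: l_def peval_simps)
    have "peval l (\<lambda>n. if n = i then 1 else 0) = p j" "peval l (\<lambda>n. if n = j then 1 else 0) = - p i"
      using ij by (simp_all add: pl)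
    then have "l \<noteq> 0"
      using False by (metis neg_equal_0_iff_equal peval.zero)
    then have l_irr: "Factorial_Ring.irreducible l"
      using irreducible_if_homogeneous_1[OF l] by simp
    \<comment> \<open>\<open>c1\<close> does not involve \<open>Var k\<close>, so its vanishing at
      \<open>p\<close> spreads along \<open>l\<close>. Divisibility then makes the irreducible
      \<open>c1\<close> associated to \<open>l\<close>.\<close>
    have "vanishes_on c1 (plane_curve l)"
      unfolding vanishes_on_def
    proof
      fix L assume "L \<in> plane_curve l"
      then obtain x where x: "L = vec.span {x}" "peval l x = 0"
        unfolding plane_curve_def proj_space_iff using vanishes_at_span[OF l] by auto
      have "\<exists>t. x i = t * p i \<and> x j = t * p j"
      proof (cases "p i = 0")
        case True
        then show ?thesis
          using False x(2) by (intro exI[of _ "x j / p j"]) (simp add: pl)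
      next
        case False
        then show ?thesis
          using x(2) by (intro exI[of _ "x i / p i"]) (simp add: pl field_simps)
      qed
      then obtain t where "x i = t * p i" "x j = t * p j"
        by blast
      then have "x(k := 0) = vscale t (p(k := 0))"
        using exhaust_3_distinct[OF ij k] by (fastforce simp: vscale_def)
      then have "peval c1 x = t ^ m * peval c1 p"
        using peval_del_var[of k c1 x] peval_del_var[of k c1 p] peval_scale[OF m, of t "p(k := 0)"]
        by (simp only: del)
      then show "vanishes_at c1 L"
        by (simp add: x(1) vanishes_at_span[OF m] c1p)
    qed
    then have "l dvd c1"
      by (rule dvd_if_vanishes_on_plane_curve[OF l_irr l m])
    then obtain u where u: "c1 = l * u"
      by (auto simp: dvd_def)
    then have "u dvd 1"
      using irreducibleD[OF c1(1) u] irreducible_not_unit'[OF l_irr] by blast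
    then have "c1 dvd l"
      by (simp add: u)
    then have "l \<in> ?I"
      using c1(2) I.mult_right by (auto simp: dvd_def)
    then have "vanishes_on l Z"
      using vanishing_ideal_homogeneous[OF l] by blast
    then have "peval l q = 0"
      using P(2) q vanishes_at_span[OF l] by (auto simp: vanishes_on_def)
    then show ?thesis
      by (simp add: pl)
  qed auto
  obtain i where i: "p i \<noteq> 0"
    using p by (auto simp: fun_eq_iff)
  have "q j = q i / p i * p j" for j
    using minor[of i j] i by (cases "i = j") (auto simp: field_simps)
  then have "q = vscale (q i / p i) p"
    unfolding vscale_def by blast
  then show ?thesis
    using p q span_eq_iff by blast
qed

section \<open>Chains and the dimension of plane curves\<close>

definition variety_chain :: "'i set \<Rightarrow> ('i, 'a::field) point set \<Rightarrow> nat \<Rightarrow> (nat \<Rightarrow> ('i, 'a) point set) \<Rightarrow> bool" where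
  "variety_chain S X n Z \<longleftrightarrow>
     (\<forall>k\<le>n. projective_variety S (Z k) \<and> Z k \<noteq> {} \<and> Z k \<subseteq> X) \<and> (\<forall>k<n. Z k \<subset> Z (Suc k))"

lemma variety_dim_chain: "variety_dim S X = Sup {enat n | n. \<exists>Z. variety_chain S X n Z}"
  by (simp add: variety_dim_def variety_chain_def)

lemma le_variety_dim: "variety_chain S X n Z \<Longrightarrow> enat n \<le> variety_dim S X"
  unfolding variety_dim_chain by (rule Sup_upper) blast

lemma variety_dim_le: "(\<And>n Z. variety_chain S X n Z \<Longrightarrow> n \<le> m) \<Longrightarrow> variety_dim S X \<le> enat m"
  unfolding variety_dim_chain by (rule Sup_least) auto

lemma variety_chain_1:
  assumes "projective_variety S A" "projective_variety S B" "A \<noteq> {}" "A \<subset> B"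
  shows "variety_chain S B 1 (\<lambda>k. if k = 0 then A else B)"
proof -
  have "(k = 0 \<or> k = 1) \<longleftrightarrow> k \<le> 1" for k :: nat
    by auto
  then show ?thesis
    using assms unfolding variety_chain_def by (auto 0 3)
qed

lemma variety_chain_2:
  assumes "projective_variety S A" "projective_variety S B" "projective_variety S C"
    and "A \<noteq> {}" "A \<subset> B" "B \<subset> C"
  shows "variety_chain S C 2 (\<lambda>k. if k = 0 then A else if k = 1 then B else C)"
  unfolding variety_chain_def
proof (intro conjI allI impI)
  fix k :: nat
  assume "k < 2"
  then consider "k = 0" | "k = 1"
    by linarith
  then show "(if k = 0 then A else if k = 1 then B else C) \<subset>
      (if Suc k = 0 then A else if Suc k = 1 then B else C)"
    using assms by cases simp_all
qed (use assms in auto)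

lemma variety_dim_point_le:
  assumes "\<And>P Q. P \<in> X \<Longrightarrow> Q \<in> X \<Longrightarrow> P = Q"
  shows "variety_dim S X \<le> 0"
proof -
  have "n \<le> 0" if "variety_chain S X n Z" for n Z
  proof (rule ccontr)
    assume "\<not> n \<le> 0"
    then have "Z 0 \<noteq> {}" "Z 0 \<subset> Z 1" "Z 1 \<subseteq> X"
      using that by (auto simp: variety_chain_def)
    then show False
      using assms by blast
  qed
  then have "variety_dim S X \<le> enat 0"
    by (rule variety_dim_le)
  then show ?thesis
    by (simp add: zero_enat_def)
qed

lemma irreducible_closed_psubset:
  assumes "irreducible_closed S Z" "L \<in> proj_space S" "L \<notin> Z"
  obtains e H where "H \<in> polys S" "homogeneous e H" "vanishes_on H Z" "\<not> vanishes_at H L"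
  using assms unfolding irreducible_closed_def by blast

context
  fixes F :: "(3, 'a::{alg_closed_field, factorial_ring_gcd, semiring_gcd_mult_normalize}) mpoly" and d
  assumes irr: "Factorial_Ring.irreducible F" and hom: "homogeneous d F"
begin

lemma irreducible_closed_psubset_plane_curve:
  assumes Z: "irreducible_closed UNIV Z" "Z \<subset> plane_curve F" and P: "P \<in> Z" "Q \<in> Z"
  shows "P = Q"
proof -
  obtain L where L: "L \<in> plane_curve F" "L \<notin> Z"
    using Z by blast
  then have "L \<in> proj_space UNIV"
    by (simp add: plane_curve_def)
  then obtain e H where H: "homogeneous e H" "vanishes_on H Z" "\<not> vanishes_at H L"
    using irreducible_closed_psubset[OF Z(1) _ L(2)] by blast
  have "\<not> F dvd H"
    using vanishes_on_plane_curve_iff[OF irr hom H(1)] H(3) L(1) by (auto simp: vanishes_on_def)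
  moreover have "vanishes_on F Z"
    using Z by (auto simp: vanishes_on_def plane_curve_def)
  ultimately show ?thesis
    using irreducible_closed_subset_plane_curve[OF Z(1) irr hom _ H(1,2) _ P] by blast
qed

lemma projective_variety_plane_curve: "projective_variety UNIV (plane_curve F)"
  by (rule projective_variety_if_irreducible_closed[OF irreducible_closed_plane_curve[OF irr hom]])

text \<open>In a chain of length two the middle member would be a proper irreducible closed subset
  with more than one point. A point of the curve gives a chain of length one.\<close>

lemma variety_dim_plane_curve: "variety_dim UNIV (plane_curve F) = 1"
proof (rule antisym)
  have "n \<le> 1" if chain: "variety_chain UNIV (plane_curve F) n Z" for n Z
  proof (rule ccontr)
    assume "\<not> n \<le> 1"
    then have Z: "projective_variety UNIV (Z 1)" "Z 0 \<noteq> {}" "Z 0 \<subset> Z 1" "Z 1 \<subset> Z 2" "Z 2 \<subseteq> plane_curve F"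
      using chain by (auto simp: variety_chain_def numeral_2_eq_2)
    then have "irreducible_closed UNIV (Z 1)"
      using projective_variety_iff by blast
    then show False
      using irreducible_closed_psubset_plane_curve[of "Z 1"] Z by blast
  qed
  then have "variety_dim UNIV (plane_curve F) \<le> enat 1"
    by (rule variety_dim_le)
  then show "variety_dim UNIV (plane_curve F) \<le> 1"
    by (simp add: one_enat_def)
  obtain L where L: "L \<in> plane_curve F"
    using plane_curve_nonempty[OF irr hom] by blast
  then have Lp: "L \<in> proj_space UNIV"
    by (simp add: plane_curve_def)
  then obtain L' where "L' \<in> plane_curve F" "L' \<noteq> L"
    using plane_curve_other_point[OF hom irreducible_homogeneous_degree_pos[OF irr hom]] by blast
  then have "{L} \<subset> plane_curve F"
    using L by blast
  moreover have "projective_variety UNIV {L}"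
    using projective_variety_if_irreducible_closed[OF irreducible_closed_point[OF _ Lp]] by simp
  ultimately have "variety_chain UNIV (plane_curve F) 1 (\<lambda>k. if k = 0 then {L} else plane_curve F)"
    using variety_chain_1 projective_variety_plane_curve by blast
  then have "enat 1 \<le> variety_dim UNIV (plane_curve F)"
    by (rule le_variety_dim)
  then show "1 \<le> variety_dim UNIV (plane_curve F)"
    by (simp add: one_enat_def)
qed

end

text \<open>Each form vanishes on the curve of the other, so they divide each other. This makes the
  degree used by the functor well defined.\<close>

lemma plane_curve_eq_imp_degree_eq:
  fixes F G :: "(3, 'a::{alg_closed_field, factorial_ring_gcd, semiring_gcd_mult_normalize}) mpoly"
  assumes F: "Factorial_Ring.irreducible F" "homogeneous d F"
    and G: "Factorial_Ring.irreducible G" "homogeneous e G"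
    and eq: "plane_curve F = plane_curve G"
  shows "d = e"
proof -
  have le: "d \<le> e" if dvd: "F dvd G" and hom: "homogeneous d F" "homogeneous e G" "G \<noteq> 0" for d e and F G :: "(3, 'a) mpoly"
  proof -
    obtain A where A: "G = F * A"
      using dvd by (auto simp: dvd_def)
    obtain n where n: "homogeneous n A"
      using homogeneous_dvd[of e G A] hom A by (metis dvd_triv_right)
    show ?thesis
      using homogeneous_unique_degree[OF homogeneous_mult[OF hom(1) n], of e] hom A by simp
  qed
  have "F dvd G" "G dvd F"
    using vanishes_on_plane_curve_iff[OF F G(2)] vanishes_on_plane_curve_iff[OF G F(2)] eq
      vanishes_on_plane_curve[of F] vanishes_on_plane_curve[of G] by simp_all
  moreover have "F \<noteq> 0" "G \<noteq> 0"
    using F G by auto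
  ultimately show ?thesis
    using le F G by (meson le_antisym)
qed

text \<open>Dimension one leaves a nonzero form vanishing on \<open>X\<close>, and its irreducible
  factor \<open>F\<close> in the prime ideal of \<open>X\<close> defines a curve containing
  \<open>X\<close>. Proper irreducible closed subsets of that curve are points, which have dimension
  0.\<close>

lemma projective_plane_curve_is_plane_curve:
  fixes X :: "(3, 'a::{alg_closed_field, factorial_ring_gcd, semiring_gcd_mult_normalize}) point set"
  assumes X: "projective_plane_curve X"
  obtains F d where "Factorial_Ring.irreducible F" "homogeneous d F" "X = plane_curve F"
proof -
  have pv: "projective_variety UNIV X" and dim: "variety_dim UNIV X = 1"
    using X by (auto simp: projective_plane_curve_def)
  have not_point: "\<not> (\<forall>P\<in>X. \<forall>Q\<in>X. P = Q)"
    using variety_dim_point_le[of X UNIV] dim by auto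
  then have ic: "irreducible_closed UNIV X"
    using projective_variety_iff pv by blast
  have sub: "X \<subseteq> proj_space UNIV"
    using ic by (simp add: irreducible_closed_def)
  have "\<exists>d G. homogeneous d G \<and> G \<noteq> 0 \<and> vanishes_on G X"
  proof (rule ccontr)
    assume none: "\<not> ?thesis"
    have "L \<in> X" if L: "L \<in> proj_space UNIV" for L
    proof (rule ccontr)
      assume "L \<notin> X"
      then obtain e H where H: "homogeneous e H" "vanishes_on H X" "\<not> vanishes_at H L"
        using irreducible_closed_psubset[OF ic L] by blast
      moreover have "H \<noteq> 0"
        using H(3) by (auto simp: vanishes_at_def peval.zero)
      ultimately show False
        using none by blast
    qed
    then have X_eq: "X = proj_space UNIV"
      using sub by blast
    \<comment> \<open>If \<open>X\<close> were the whole plane, a point on this coordinate line, the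
      line and \<open>X\<close> would form a chain of length 2.\<close>
    let ?F = "Var 1 :: (3, 'a) mpoly"
    have "?F \<noteq> 0"
      using peval_Var[of "1 :: 3" "\<lambda>_. 1 :: 'a"] by (auto simp: peval.zero)
    then have F: "Factorial_Ring.irreducible ?F" "homogeneous 1 ?F"
      by (simp_all only: irreducible_if_homogeneous_1 homogeneous_Var not_False_eq_True)
    obtain L where L: "L \<in> plane_curve ?F"
      using plane_curve_nonempty[OF F] by blast
    then have Lp: "L \<in> proj_space UNIV"
      by (simp add: plane_curve_def)
    obtain L' where L': "L' \<in> plane_curve ?F" "L' \<noteq> L"
      using plane_curve_other_point[OF F(2) _ Lp] by auto
    have "vec.span {\<lambda>_. 1} \<in> X - plane_curve ?F"
      unfolding X_eq using span_in_proj_space_UNIV[of "\<lambda>_. 1"]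
      by (simp add: fun_eq_iff plane_curve_def vanishes_at_span[OF F(2)] peval_Var)
    then have "plane_curve ?F \<subset> X"
      unfolding X_eq by (auto simp: plane_curve_def)
    then have less: "{L} \<subset> plane_curve ?F" "plane_curve ?F \<subset> X"
      using L L' by blast+
    have "projective_variety UNIV {L}"
      using projective_variety_if_irreducible_closed[OF irreducible_closed_point[OF _ Lp]] by simp
    from variety_chain_2[OF this projective_variety_plane_curve[OF F] pv _ less]
    have "variety_chain UNIV X 2 (\<lambda>k. if k = 0 then {L} else if k = 1 then plane_curve ?F else X)"
      by simp
    from le_variety_dim[OF this] have "enat 2 \<le> 1"
      unfolding dim .
    then show False
      by (simp add: one_enat_def)
  qed
  then obtain n G where G: "homogeneous n G" "G \<noteq> 0" "vanishes_on G X"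
    by blast
  have "G \<in> vanishing_ideal UNIV X"
    using G vanishing_ideal_homogeneous[OF G(1)] by simp
  then obtain F where F: "Factorial_Ring.irreducible F" "F \<in> vanishing_ideal UNIV X" "F dvd G"
    using mpoly3_irreducible_factor_in_prime_id[OF prime_id_vanishing_ideal[OF ic] _ G(2)] by blast
  obtain d where d: "homogeneous d F"
    using homogeneous_dvd[OF G(1,2) F(3)] by blast
  have "vanishes_on F X"
    using vanishing_ideal_homogeneous[OF d] F(2) by blast
  then have "X \<subseteq> plane_curve F"
    using sub by (auto simp: plane_curve_def vanishes_on_def)
  moreover have "\<not> X \<subset> plane_curve F"
    using irreducible_closed_psubset_plane_curve[OF F(1) d ic] not_point by blast
  ultimately show ?thesis
    using that F(1) d by blast
qed

section \<open>The Veronese embedding\<close>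

lemma homogeneous_Var_Suc [simp]: "homogeneous (Suc 0) (Var i)"
  using homogeneous_Var[of i] by simp

lemma irreducible_closedI:
  assumes "finite S" "Z \<noteq> {}" "Z \<subseteq> proj_space S"
    and "\<And>L. L \<in> proj_space S \<Longrightarrow> (\<And>d F. F \<in> polys S \<Longrightarrow> homogeneous d F \<Longrightarrow> vanishes_on F Z \<Longrightarrow> vanishes_at F L) \<Longrightarrow> L \<in> Z"
    and "\<And>d e F G. F \<in> polys S \<Longrightarrow> G \<in> polys S \<Longrightarrow> homogeneous d F \<Longrightarrow> homogeneous e G \<Longrightarrow>
      vanishes_on (F * G) Z \<Longrightarrow> vanishes_on F Z \<or> vanishes_on G Z"
  shows "irreducible_closed S Z"
  unfolding irreducible_closed_def
proof (intro conjI ballI allI impI)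
  show "L \<in> Z" if "L \<in> proj_space S"
    "\<forall>d. \<forall>F\<in>polys S. homogeneous d F \<longrightarrow> vanishes_on F Z \<longrightarrow> vanishes_at F L" for L
    using that by (intro assms(4)) blast+
qed (rule assms; assumption)+

lemma irreducible_closed_multD:
  assumes "irreducible_closed S Z" "F \<in> polys S" "G \<in> polys S" "homogeneous d F" "homogeneous e G"
    "vanishes_on (F * G) Z"
  shows "vanishes_on F Z \<or> vanishes_on G Z"
  using assms unfolding irreducible_closed_def by blast

lemma psubst_psubst:
  assumes "ring_morph \<phi>"
  shows "psubst \<phi> x (psubst Const y F) = psubst \<phi> (\<lambda>i. psubst \<phi> x (y i)) F"
  by (rule ring_morph_mpoly_eqI[OF ring_morph_comp[OF ring_morph_psubst[OF assms]
        ring_morph_psubst[OF ring_morph_single]] ring_morph_psubst[OF assms]])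
    (simp_all add: psubst_Const psubst_Var assms ring_morph_single)

lemma peval_psubst: "peval (psubst Const y F) v = peval F (\<lambda>i. peval (y i) v)"
  unfolding peval_eq_psubst by (rule psubst_psubst[OF ring_morph_id])

lemma homogeneous_psubst:
  assumes "F \<in> polys S" "homogeneous g F" "\<And>i. i \<in> S \<Longrightarrow> homogeneous e (x i)"
  shows "homogeneous (g * e) (psubst Const x F)"
  unfolding psubst_def
proof (intro homogeneous_sum homogeneous_Const_mult)
  fix m assume m: "m \<in> Poly_Mapping.keys F"
  then have "homogeneous (\<Sum>i\<in>Poly_Mapping.keys m. Poly_Mapping.lookup m i * e)
      (\<Prod>i\<in>Poly_Mapping.keys m. x i ^ Poly_Mapping.lookup m i)"
    using assms(1,3) by (intro homogeneous_prod homogeneous_power) (auto simp: polys_iff)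
  also have "(\<Sum>i\<in>Poly_Mapping.keys m. Poly_Mapping.lookup m i * e) = g * e"
    using m assms(2) by (simp add: homogeneous_def tdeg_def flip: sum_distrib_right)
  finally show "homogeneous (g * e) (\<Prod>i\<in>Poly_Mapping.keys m. x i ^ Poly_Mapping.lookup m i)" .
qed

lemma value_at_span:
  assumes "\<And>j. homogeneous d (\<phi> j)"
  shows "value_at \<phi> (vec.span {v}) = vec.span {\<lambda>j. peval (\<phi> j) v}"
proof
  have eq: "(\<lambda>j. peval (\<phi> j) (vscale c v)) = vscale (c ^ d) (\<lambda>j. peval (\<phi> j) v)" for c
    by (rule ext) (simp add: peval_scale[OF assms], simp add: vscale_def)
  show "value_at \<phi> (vec.span {v}) \<subseteq> vec.span {\<lambda>j. peval (\<phi> j) v}"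
    unfolding value_at_def
    by (rule vec.span_minimal) (auto simp: in_span_singleton eq vec.subspace_span intro: exI)
  have "(\<lambda>j. peval (\<phi> j) v) \<in> (\<lambda>w j. peval (\<phi> j) w) ` vec.span {v}"
    using vec.span_base[of v "{v}"] by blast
  then show "vec.span {\<lambda>j. peval (\<phi> j) v} \<subseteq> value_at \<phi> (vec.span {v})"
    unfolding value_at_def by (intro vec.span_mono) simp
qed

definition monomial_value :: "'i expo \<Rightarrow> ('i \<Rightarrow> 'a::comm_monoid_mult) \<Rightarrow> 'a" where
  "monomial_value m v = (\<Prod>i\<in>Poly_Mapping.keys m. v i ^ Poly_Mapping.lookup m i)"

lemma psubst_monomial:
  "ring_morph \<phi> \<Longrightarrow> psubst \<phi> x (Poly_Mapping.single m 1) = monomial_value m x"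
  by (simp add: psubst_single ring_morph.one monomial_value_def)

lemma monomial_value_plus:
  "monomial_value (m + n) x = monomial_value m x * monomial_value n x"
  for x :: "'i \<Rightarrow> 'a::comm_ring_1"
  unfolding monomial_value_def by (rule monomial_value_add)

lemma monomial_value_single: "monomial_value (Poly_Mapping.single i k) x = x i ^ k"
  by (simp add: monomial_value_def)

lemma tdeg_add: "tdeg (m + n) = tdeg m + tdeg n"
proof -
  have "homogeneous (tdeg m + tdeg n) (Poly_Mapping.single m (1::rat) * Poly_Mapping.single n 1)"
    by (rule homogeneous_mult) (simp_all add: homogeneous_def)
  then show ?thesis
    by (simp add: mult_single homogeneous_def)
qed

lemma tdeg_single: "tdeg (Poly_Mapping.single i k) = k"
  by (simp add: tdeg_def)

text \<open>The value 0 outside \<open>monomials d\<close> is forced because representatives of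
  rational maps vanish off the target index set.\<close>

definition veronese_poly :: "nat \<Rightarrow> 3 expo \<Rightarrow> (3, 'a::field) mpoly" where
  "veronese_poly d m = (if m \<in> monomials d then Poly_Mapping.single m 1 else 0)"

definition veronese :: "nat \<Rightarrow> (3, 'a::field) point \<Rightarrow> (3 expo, 'a) point" where
  "veronese d = value_at (veronese_poly d)"

definition veronese_vec :: "nat \<Rightarrow> (3 \<Rightarrow> 'a::field) \<Rightarrow> 3 expo \<Rightarrow> 'a" where
  "veronese_vec d v m = peval (veronese_poly d m) v"

lemma homogeneous_veronese_poly: "homogeneous d (veronese_poly d m)"
  by (simp add: veronese_poly_def homogeneous_def monomials_def)

lemma veronese_vec_eq: "veronese_vec d v m = (if m \<in> monomials d then monomial_value m v else 0)"
  by (simp add: veronese_vec_def veronese_poly_def peval_eq_psubst psubst_monomial[OF ring_morph_id] psubst_zero)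

lemma veronese_span: "veronese d (vec.span {v}) = vec.span {veronese_vec d v}"
  unfolding veronese_def veronese_vec_def by (rule value_at_span[OF homogeneous_veronese_poly])

lemma veronese_vec_coord_space: "veronese_vec d v \<in> coord_space (monomials d)"
  by (simp add: coord_space_def veronese_vec_eq)

text \<open>The exponents of \<open>x\<^sub>i\<^sup>d\<^sup>-\<^sup>1 x\<^sub>j\<close>: the corresponding coordinates invert the
  Veronese map where \<open>x\<^sub>i\<close> does not vanish.\<close>

definition base_expo :: "nat \<Rightarrow> 3 \<Rightarrow> 3 \<Rightarrow> 3 expo" where
  "base_expo d i j = Poly_Mapping.single i (d - 1) + Poly_Mapping.single j 1"

lemma base_expo_monomials: "d > 0 \<Longrightarrow> base_expo d i j \<in> monomials d"
  by (simp add: monomials_def base_expo_def tdeg_add tdeg_single)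

lemma base_expo_same: "d > 0 \<Longrightarrow> base_expo d i i = Poly_Mapping.single i d"
  by (simp add: base_expo_def flip: single_add)

lemma veronese_vec_base: "d > 0 \<Longrightarrow> veronese_vec d v (base_expo d i j) = v i ^ (d - 1) * v j"
  by (simp add: veronese_vec_eq base_expo_monomials)
    (simp add: base_expo_def monomial_value_plus monomial_value_single)

lemma veronese_vec_power: "veronese_vec d v (Poly_Mapping.single i d) = v i ^ d"
  by (simp add: veronese_vec_eq monomials_def tdeg_single monomial_value_single)

lemma veronese_vec_nonzero: "v \<noteq> 0 \<Longrightarrow> veronese_vec d v \<noteq> 0"
  using veronese_vec_power[of d v] by (force simp: fun_eq_iff)

lemma veronese_in_proj_space: "L \<in> proj_space UNIV \<Longrightarrow> veronese d L \<in> proj_space (monomials d)"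
  unfolding proj_space_iff using veronese_vec_nonzero veronese_vec_coord_space veronese_span by metis

text \<open>The coordinates v_i^(d-1) v_j, for an \<open>i\<close> with \<open>v i\<close> nonzero,
  determine \<open>v\<close> up to a scalar.\<close>

lemma veronese_inj:
  assumes "d > 0" "L \<in> proj_space UNIV" "M \<in> proj_space UNIV" "veronese d L = veronese d M"
  shows "L = M"
proof -
  obtain v w where v: "v \<noteq> 0" "L = vec.span {v}" and w: "w \<noteq> 0" "M = vec.span {w}"
    using assms by (auto simp: proj_space_iff)
  have "vec.span {veronese_vec d v} = vec.span {veronese_vec d w}"
    using assms by (simp add: v w veronese_span)
  then obtain c where c: "veronese_vec d v = vscale c (veronese_vec d w)"
    using span_eq_iff[OF veronese_vec_nonzero[OF w(1)] veronese_vec_nonzero[OF v(1)]] by blast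
  obtain i where i: "v i \<noteq> 0"
    using v by (auto simp: fun_eq_iff)
  have "v i ^ (d - 1) * v j = c * (w i ^ (d - 1) * w j)" for j
    using veronese_vec_base[OF assms(1)] c by (metis vscale_def)
  then have "v = vscale (c * w i ^ (d - 1) / v i ^ (d - 1)) w"
    using i by (simp add: vscale_def fun_eq_iff field_simps)
  then show ?thesis
    using v w span_eq_iff by blast
qed

section \<open>Moving forms along the Veronese map\<close>

definition veronese_pullback :: "nat \<Rightarrow> (3 expo, 'a::field) mpoly \<Rightarrow> (3, 'a) mpoly" where
  "veronese_pullback d = psubst Const (veronese_poly d)"

text \<open>Coordinates of index \<open>base_expo d i j\<close> take the value v_i^(d-1) v_j, so
  pulling the result back returns the form times a power of x_i (\<open>peval_push\<close>).
  Vanishing is thus preserved everywhere but can be read back only where x_i is nonzero.\<close>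

definition veronese_push :: "nat \<Rightarrow> 3 \<Rightarrow> (3, 'a::field) mpoly \<Rightarrow> (3 expo, 'a) mpoly" where
  "veronese_push d i = psubst Const (\<lambda>j. Var (base_expo d i j))"

lemma peval_pullback: "peval (veronese_pullback d G) v = peval G (veronese_vec d v)"
  by (simp add: veronese_pullback_def peval_psubst veronese_vec_def[abs_def])

lemma homogeneous_pullback:
  "homogeneous g G \<Longrightarrow> homogeneous (g * d) (veronese_pullback d G)"
  unfolding veronese_pullback_def
  by (rule homogeneous_psubst[of _ UNIV]) (simp_all add: homogeneous_veronese_poly)

lemma homogeneous_push: "homogeneous a A \<Longrightarrow> homogeneous a (veronese_push d i A)"
  unfolding veronese_push_def using homogeneous_psubst[of A UNIV a 1 "\<lambda>j. Var (base_expo d i j)"] by simp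

lemma polys_push: "d > 0 \<Longrightarrow> veronese_push d i A \<in> polys (monomials d)"
  unfolding veronese_push_def by (rule polys_psubst) (simp add: base_expo_monomials)

lemma peval_push:
  assumes "d > 0" "homogeneous a A"
  shows "peval (veronese_push d i A) (veronese_vec d v) = v i ^ ((d - 1) * a) * peval A v"
proof -
  have "(\<lambda>j. veronese_vec d v (base_expo d i j)) = vscale (v i ^ (d - 1)) v"
    by (simp add: veronese_vec_base assms vscale_def)
  then show ?thesis
    by (simp add: veronese_push_def peval_psubst peval_simps peval_scale[OF assms(2)] power_mult)
qed

lemma vanishes_at_pullback:
  "homogeneous g G \<Longrightarrow> L \<in> proj_space UNIV \<Longrightarrow>
    vanishes_at G (veronese d L) \<longleftrightarrow> vanishes_at (veronese_pullback d G) L"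
  by (auto simp: proj_space_iff veronese_span vanishes_at_span homogeneous_pullback peval_pullback
      vanishes_at_span[OF homogeneous_pullback])

lemma vanishes_on_pullback:
  "homogeneous g G \<Longrightarrow> Z \<subseteq> proj_space UNIV \<Longrightarrow>
    vanishes_on G (veronese d ` Z) \<longleftrightarrow> vanishes_on (veronese_pullback d G) Z"
  by (auto simp: vanishes_on_def vanishes_at_pullback subset_iff)

lemma vanishes_at_push:
  assumes "d > 0" "homogeneous a A" "vanishes_at A L" "L \<in> proj_space UNIV"
  shows "vanishes_at (veronese_push d i A) (veronese d L)"
  using assms
  by (auto simp: proj_space_iff veronese_span vanishes_at_span homogeneous_push peval_push
      vanishes_at_span[OF homogeneous_push])

lemma vanishes_at_push_D:
  assumes "d > 0" "homogeneous a A" "v i \<noteq> 0"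
    and "vanishes_at (veronese_push d i A) (veronese d (vec.span {v}))"
  shows "vanishes_at A (vec.span {v})"
  using assms
  by (simp add: veronese_span vanishes_at_span[OF homogeneous_push[OF assms(2)]] vanishes_at_span[OF assms(2)] peval_push)

text \<open>From x^m (x_i^d)^(d-1) being the product of the (x_i^(d-1) x_j)^(m_j). It determines the
  coordinate \<open>m\<close> from the chart coordinates where that of x_i^d is nonzero;
  differentiated, it does the same for tangent vectors.\<close>

definition veronese_eq1 :: "nat \<Rightarrow> 3 \<Rightarrow> 3 expo \<Rightarrow> (3 expo, 'a::field) mpoly" where
  "veronese_eq1 d i m = Var m * Var (base_expo d i i) ^ (d - 1) - monomial_value m (\<lambda>j. Var (base_expo d i j))"

text \<open>The \<open>d\<close>-th power of x^m is the monomial \<open>m\<close> in the pure powers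
  x_j^d. This forbids that all pure power coordinates vanish at a point.\<close>

definition veronese_eq2 :: "nat \<Rightarrow> 3 expo \<Rightarrow> (3 expo, 'a::field) mpoly" where
  "veronese_eq2 d m = Var m ^ d - monomial_value m (\<lambda>j. Var (base_expo d j j))"

lemma homogeneous_monomial_value:
  "(\<And>j. homogeneous 1 (x j)) \<Longrightarrow> homogeneous (tdeg m) (monomial_value m x)"
  unfolding monomial_value_def tdeg_def
proof (intro homogeneous_prod)
  fix i
  assume "\<And>j. homogeneous 1 (x j)"
  then show "homogeneous (Poly_Mapping.lookup m i) (x i ^ Poly_Mapping.lookup m i)"
    using homogeneous_power[of 1 "x i" "Poly_Mapping.lookup m i"] by simp
qed

lemma polys_monomial_value: "(\<And>j. x j \<in> polys S) \<Longrightarrow> monomial_value m x \<in> polys S"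
  unfolding monomial_value_def by (intro polys_prod polys_power)

lemma ring_morph_monomial_value:
  "ring_morph h \<Longrightarrow> h (monomial_value m x) = monomial_value m (\<lambda>j. h (x j))"
  by (simp add: monomial_value_def ring_morph.prod ring_morph.power)

lemma monomial_value_scale: "monomial_value m (\<lambda>j. c * x j) = c ^ tdeg m * monomial_value m x"
  by (simp add: monomial_value_def tdeg_def power_mult_distrib prod.distrib power_sum)

lemma monomial_value_power: "monomial_value m (\<lambda>j. x j ^ n) = monomial_value m x ^ n"
  for x :: "'i \<Rightarrow> 'a::comm_ring_1"
  by (simp add: monomial_value_def prod_power_distrib mult.commute flip: power_mult)

lemma veronese_eq_homogeneous:
  assumes "d > 0" "m \<in> monomials d"
  shows "homogeneous d (veronese_eq1 d i m)" "homogeneous d (veronese_eq2 d m)"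
proof -
  have "homogeneous (1 + (d - 1) * 1) (Var m * Var (base_expo d i i) ^ (d - 1))"
    by (intro homogeneous_mult homogeneous_power homogeneous_Var)
  then show "homogeneous d (veronese_eq1 d i m)"
    unfolding veronese_eq1_def
    using assms homogeneous_monomial_value[of "\<lambda>j. Var (base_expo d i j)" m]
    by (intro homogeneous_diff) (simp_all add: monomials_def)
  have "homogeneous (d * 1) (Var m ^ d)"
    by (intro homogeneous_power homogeneous_Var)
  then show "homogeneous d (veronese_eq2 d m)"
    unfolding veronese_eq2_def
    using assms homogeneous_monomial_value[of "\<lambda>j. Var (base_expo d j j)" m]
    by (intro homogeneous_diff) (simp_all add: monomials_def)
qed

lemma veronese_eq_polys:
  assumes "d > 0" "m \<in> monomials d"
  shows "veronese_eq1 d i m \<in> polys (monomials d)" "veronese_eq2 d m \<in> polys (monomials d)"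
  unfolding veronese_eq1_def veronese_eq2_def
  by (intro polys_diff polys_mult polys_power polys_monomial_value; simp add: assms base_expo_monomials)+

lemma peval_veronese_eq:
  "peval (veronese_eq1 d i m) w = w m * w (base_expo d i i) ^ (d - 1) - monomial_value m (\<lambda>j. w (base_expo d i j))"
  "peval (veronese_eq2 d m) w = w m ^ d - monomial_value m (\<lambda>j. w (base_expo d j j))"
  by (simp_all add: veronese_eq1_def veronese_eq2_def peval_simps ring_morph_monomial_value[OF ring_morph_peval])

lemma veronese_eq_vanish:
  assumes "d > 0" "m \<in> monomials d" "Z \<subseteq> proj_space UNIV"
  shows "vanishes_on (veronese_eq1 d i m) (veronese d ` Z)" "vanishes_on (veronese_eq2 d m) (veronese d ` Z)"
proof -
  have td: "tdeg m = d"
    using assms by (simp add: monomials_def)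
  have "peval (veronese_eq1 d i m) (veronese_vec d v) = 0" for v
  proof -
    have "monomial_value m v * (v i ^ d) ^ (d - 1) = (v i ^ (d - 1)) ^ d * monomial_value m v"
      by (simp add: mult.commute flip: power_mult)
    then show ?thesis
      using assms by (simp add: peval_veronese_eq veronese_vec_base base_expo_same veronese_vec_power
          monomial_value_scale td veronese_vec_eq[of d v m])
  qed
  moreover have "peval (veronese_eq2 d m) (veronese_vec d v) = 0" for v
    using assms by (simp add: peval_veronese_eq base_expo_same veronese_vec_power
        monomial_value_power veronese_vec_eq[of d v m])
  ultimately show "vanishes_on (veronese_eq1 d i m) (veronese d ` Z)" "vanishes_on (veronese_eq2 d m) (veronese d ` Z)"
    using assms(3)
    by (auto simp: vanishes_on_def proj_space_iff veronese_span dest!: subsetD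
        simp: vanishes_at_span[OF veronese_eq_homogeneous(1)[OF assms(1,2)]]
          vanishes_at_span[OF veronese_eq_homogeneous(2)[OF assms(1,2)]])
qed

text \<open>\<open>veronese_eq2\<close> gives an \<open>i\<close> whose pure power coordinate is
  nonzero; by \<open>veronese_eq1\<close> the chart coordinates at \<open>i\<close> are then
  homogeneous coordinates of the preimage.\<close>

lemma veronese_image_char:
  assumes d: "d > 0" and L: "L \<in> proj_space (monomials d)"
    and eqs: "\<And>i m. m \<in> monomials d \<Longrightarrow> vanishes_at (veronese_eq1 d i m) L"
      "\<And>m. m \<in> monomials d \<Longrightarrow> vanishes_at (veronese_eq2 d m) L"
  obtains v where "v \<noteq> 0" "L = veronese d (vec.span {v})"
proof -
  obtain w where w: "w \<in> coord_space (monomials d)" "w \<noteq> 0" "L = vec.span {w}"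
    using L by (auto simp: proj_space_iff)
  have e1: "w m * w (base_expo d i i) ^ (d - 1) = monomial_value m (\<lambda>j. w (base_expo d i j))"
    and e2: "w m ^ d = monomial_value m (\<lambda>j. w (base_expo d j j))" if "m \<in> monomials d" for m i
    using eqs[OF that] that d
    by (simp_all add: w(3) vanishes_at_span[OF veronese_eq_homogeneous(1)]
        vanishes_at_span[OF veronese_eq_homogeneous(2)] peval_veronese_eq)
  have "\<exists>i. w (base_expo d i i) \<noteq> 0"
  proof (rule ccontr)
    assume neg: "\<not> ?thesis"
    have "w m = 0" for m
    proof (cases "m \<in> monomials d")
      case True
      then have "tdeg m \<noteq> 0"
        using d by (simp add: monomials_def)
      then obtain j where j: "j \<in> Poly_Mapping.keys m"
        by (auto simp: tdeg_def)
      then have "monomial_value m (\<lambda>j. w (base_expo d j j)) = 0"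
        using neg by (auto simp: monomial_value_def prod_zero_iff in_keys_iff intro!: bexI[of _ j])
      then show ?thesis
        using e2[OF True] by simp
    qed (use w in \<open>simp add: coord_space_def\<close>)
    then show False
      using w by (simp add: fun_eq_iff)
  qed
  then obtain i where i: "w (base_expo d i i) \<noteq> 0"
    by blast
  define a where "a = (\<lambda>j. w (base_expo d i j))"
  have "veronese_vec d a = vscale (w (base_expo d i i) ^ (d - 1)) w"
  proof
    fix m
    show "veronese_vec d a m = vscale (w (base_expo d i i) ^ (d - 1)) w m"
      using e1[of m i] w(1) by (auto simp: veronese_vec_eq vscale_def a_def coord_space_def mult.commute)
  qed
  moreover have "a \<noteq> 0"
    using i by (auto simp: a_def fun_eq_iff)
  ultimately have "L = veronese d (vec.span {a})"
    unfolding veronese_span w(3)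
    using span_eq_iff[OF w(2) veronese_vec_nonzero] by blast
  then show ?thesis
    using \<open>a \<noteq> 0\<close> that by blast
qed

text \<open>A point where all forms vanishing on the image vanish is some
  \<open>veronese d (vec.span {v})\<close> by the equations of the surface. Pushing the forms of
  \<open>Z\<close> with an index \<open>i\<close> where \<open>v i\<close> is nonzero puts [v] into
  \<open>Z\<close>. Irreducibility is pulled back.\<close>

lemma irreducible_closed_veronese:
  assumes d: "d > 0" and Z: "irreducible_closed UNIV Z"
  shows "irreducible_closed (monomials d) (veronese d ` Z)"
proof -
  have sub: "Z \<subseteq> proj_space UNIV"
    using Z by (simp add: irreducible_closed_def)
  have closed: "L \<in> veronese d ` Z" if L: "L \<in> proj_space (monomials d)"
    and van: "\<And>e G. G \<in> polys (monomials d) \<Longrightarrow> homogeneous e G \<Longrightarrow> vanishes_on G (veronese d ` Z) \<Longrightarrow> vanishes_at G L" for L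
  proof -
    obtain v where v: "v \<noteq> 0" "L = veronese d (vec.span {v})"
      by (rule veronese_image_char[OF d L])
        (use van veronese_eq_polys[OF d] veronese_eq_homogeneous[OF d] veronese_eq_vanish[OF d _ sub] in blast)+
    obtain i where i: "v i \<noteq> 0"
      using v by (auto simp: fun_eq_iff)
    have "vanishes_at A (vec.span {v})" if A: "homogeneous a A" "vanishes_on A Z" for a A
    proof -
      have "vanishes_on (veronese_push d i A) (veronese d ` Z)"
        using A sub vanishes_at_push[OF d A(1)] by (auto simp: vanishes_on_def)
      then have "vanishes_at (veronese_push d i A) L"
        using van polys_push[OF d] homogeneous_push[OF A(1)] by blast
      then show ?thesis
        using vanishes_at_push_D[of d a A v i] d A(1) i v(2) by blast
    qed
    then have "vec.span {v} \<in> Z"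
      using Z span_in_proj_space_UNIV[OF v(1)] unfolding irreducible_closed_def by blast
    then show ?thesis
      using v(2) by blast
  qed
  have irr: "vanishes_on G (veronese d ` Z) \<or> vanishes_on H (veronese d ` Z)"
    if GH: "homogeneous g G" "homogeneous h H" "vanishes_on (G * H) (veronese d ` Z)" for g h G H
  proof -
    have "vanishes_on (veronese_pullback d (G * H)) Z"
      using vanishes_on_pullback[OF homogeneous_mult[OF GH(1,2)] sub] GH(3) by blast
    moreover have "veronese_pullback d (G * H) = veronese_pullback d G * veronese_pullback d H"
      by (simp add: veronese_pullback_def psubst_mult[OF ring_morph_single])
    ultimately have "vanishes_on (veronese_pullback d G) Z \<or> vanishes_on (veronese_pullback d H) Z"
      using irreducible_closed_multD[OF Z _ _ homogeneous_pullback[OF GH(1)] homogeneous_pullback[OF GH(2)]]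
      by simp
    then show ?thesis
      using vanishes_on_pullback[OF GH(1) sub] vanishes_on_pullback[OF GH(2) sub] by blast
  qed
  show ?thesis
  proof (rule irreducible_closedI)
    show "finite (monomials d)"
      by (rule finite_monomials)
    show "veronese d ` Z \<subseteq> proj_space (monomials d)"
      using sub veronese_in_proj_space by blast
    show "veronese d ` Z \<noteq> {}"
      using Z by (simp add: irreducible_closed_def)
    show "L \<in> veronese d ` Z" if "L \<in> proj_space (monomials d)"
      "\<And>e G. G \<in> polys (monomials d) \<Longrightarrow> homogeneous e G \<Longrightarrow> vanishes_on G (veronese d ` Z) \<Longrightarrow> vanishes_at G L" for L
      using that by (rule closed)
    show "vanishes_on F (veronese d ` Z) \<or> vanishes_on G (veronese d ` Z)"
      if "homogeneous n F" "homogeneous e G" "vanishes_on (F * G) (veronese d ` Z)" for n e F G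
      using that by (rule irr)
  qed
qed

text \<open>The roles are exchanged: closedness uses pullbacks and irreducibility uses pushed
  forms.\<close>

lemma irreducible_closed_veronese_D:
  assumes d: "d > 0" and sub: "Z \<subseteq> proj_space UNIV"
    and Z: "irreducible_closed (monomials d) (veronese d ` Z)"
  shows "irreducible_closed UNIV Z"
proof -
  have closed: "L \<in> Z" if L: "L \<in> proj_space UNIV"
    and van: "\<And>e G. G \<in> polys UNIV \<Longrightarrow> homogeneous e G \<Longrightarrow> vanishes_on G Z \<Longrightarrow> vanishes_at G L" for L
  proof (rule ccontr)
    assume "L \<notin> Z"
    then have "veronese d L \<notin> veronese d ` Z"
      using veronese_inj[OF d L] sub by blast
    then obtain e H where H: "homogeneous e H" "vanishes_on H (veronese d ` Z)" "\<not> vanishes_at H (veronese d L)"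
      using irreducible_closed_psubset[OF Z veronese_in_proj_space[OF L]] by blast
    have "veronese_pullback d H \<in> polys UNIV"
      by simp
    then show False
      using van[OF _ homogeneous_pullback[OF H(1)]] vanishes_on_pullback[OF H(1) sub]
        vanishes_at_pullback[OF H(1) L] H(2,3) by blast
  qed
  have irr: "vanishes_on A Z \<or> vanishes_on B Z"
    if AB: "homogeneous a A" "homogeneous b B" "vanishes_on (A * B) Z" for a b A B
  proof (rule ccontr)
    assume neg: "\<not> ?thesis"
    \<comment> \<open>The index depends on the form, because a point where \<open>C\<close> is
      nonzero may lie on some coordinate lines. The two factors may thus be pushed with different
      indices.\<close>
    have *: "\<exists>i. \<not> vanishes_on (veronese_push d i C) (veronese d ` Z)"
      if C: "homogeneous c C" "\<not> vanishes_on C Z" for c C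
    proof -
      obtain L where L: "L \<in> Z" "\<not> vanishes_at C L"
        using C by (auto simp: vanishes_on_def)
      then obtain v where v: "v \<noteq> 0" "L = vec.span {v}"
        using sub by (meson proj_space_iff subsetD)
      then obtain i where i: "v i \<noteq> 0"
        by (auto simp: fun_eq_iff)
      then have "\<not> vanishes_at (veronese_push d i C) (veronese d L)"
        using vanishes_at_push_D[of d c C v i] d C(1) L(2) v(2) by blast
      then show ?thesis
        using L(1) by (auto simp: vanishes_on_def)
    qed
    obtain i where i: "\<not> vanishes_on (veronese_push d i A) (veronese d ` Z)"
      using * AB neg by blast
    obtain j where j: "\<not> vanishes_on (veronese_push d j B) (veronese d ` Z)"
      using * AB neg by blast
    have "vanishes_on (veronese_push d i A * veronese_push d j B) (veronese d ` Z)"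
      unfolding vanishes_on_def
    proof safe
      fix L assume L: "L \<in> Z"
      then obtain v where v: "v \<noteq> 0" "L = vec.span {v}"
        using sub by (meson proj_space_iff subsetD)
      have "peval (A * B) v = 0"
        using AB(3) L vanishes_at_span[OF homogeneous_mult[OF AB(1,2)]] by (auto simp: v vanishes_on_def)
      then have "peval (veronese_push d i A * veronese_push d j B) (veronese_vec d v) = 0"
        by (auto simp: peval_simps peval_push[OF d AB(1)] peval_push[OF d AB(2)])
      then show "vanishes_at (veronese_push d i A * veronese_push d j B) (veronese d L)"
        by (simp add: v veronese_span vanishes_at_span[OF homogeneous_mult[OF homogeneous_push[OF AB(1)] homogeneous_push[OF AB(2)]]])
    qed
    then show False
      using irreducible_closed_multD[OF Z polys_push[OF d] polys_push[OF d]
          homogeneous_push[OF AB(1)] homogeneous_push[OF AB(2)]] i j by blast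
  qed
  show ?thesis
  proof (rule irreducible_closedI)
    show "Z \<noteq> {}"
      using Z by (auto simp: irreducible_closed_def)
    show "L \<in> Z" if "L \<in> proj_space UNIV"
      "\<And>e G. G \<in> polys UNIV \<Longrightarrow> homogeneous e G \<Longrightarrow> vanishes_on G Z \<Longrightarrow> vanishes_at G L" for L
      using that by (rule closed)
    show "vanishes_on F Z \<or> vanishes_on G Z"
      if "homogeneous n F" "homogeneous e G" "vanishes_on (F * G) Z" for n e F G
      using that by (rule irr)
  qed (simp, fact sub)
qed

section \<open>Dimension under the Veronese map\<close>

lemma inj_on_veronese: "d > 0 \<Longrightarrow> inj_on (veronese d) (proj_space UNIV)"
  unfolding inj_on_def using veronese_inj by blast

lemma variety_dim_veronese:
  fixes X :: "(3, 'a::alg_closed_field) point set"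
  assumes d: "d > 0" and X: "X \<subseteq> proj_space UNIV"
  shows "variety_dim (monomials d) (veronese d ` X) = variety_dim UNIV X"
proof -
  have "(\<exists>Z. variety_chain (monomials d) (veronese d ` X) n Z) \<longleftrightarrow> (\<exists>Z. variety_chain UNIV X n Z)" for n
  proof safe
    fix Z' assume Z': "variety_chain (monomials d) (veronese d ` X) n Z'"
    \<comment> \<open>Members of a chain below the image of \<open>X\<close> are images of their
      preimages in \<open>X\<close>.\<close>
    define Z where "Z k = {L \<in> X. veronese d L \<in> Z' k}" for k
    have im: "veronese d ` Z k = Z' k" if "k \<le> n" for k
      using Z' that by (fastforce simp: variety_chain_def Z_def)
    have "variety_chain UNIV X n Z"
      unfolding variety_chain_def
    proof (intro conjI allI impI)
      fix k assume k: "k \<le> n"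
      have Z'k: "projective_variety (monomials d) (Z' k)" "Z' k \<noteq> {}"
        using Z' k by (auto simp: variety_chain_def)
      show "Z k \<noteq> {}"
        using im[OF k] Z'k by auto
      show "Z k \<subseteq> X"
        by (auto simp: Z_def)
      then show "projective_variety UNIV (Z k)"
        using irreducible_closed_veronese_D[OF d, of "Z k"] X Z'k im[OF k]
        by (simp add: projective_variety_iff \<open>Z k \<noteq> {}\<close>)
    next
      fix k assume k: "k < n"
      then have "Z' k \<subset> Z' (Suc k)"
        using Z' by (auto simp: variety_chain_def)
      then have "Z k \<subseteq> Z (Suc k)" "Z' k \<noteq> Z' (Suc k)"
        unfolding Z_def by auto
      moreover have "veronese d ` Z k = Z' k" "veronese d ` Z (Suc k) = Z' (Suc k)"
        using im k by simp_all
      ultimately show "Z k \<subset> Z (Suc k)"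
        by auto
    qed
    then show "\<exists>Z. variety_chain UNIV X n Z"
      by blast
  next
    fix Z assume Z: "variety_chain UNIV X n Z"
    have "variety_chain (monomials d) (veronese d ` X) n (\<lambda>k. veronese d ` Z k)"
      unfolding variety_chain_def
    proof (intro conjI allI impI)
      fix k assume k: "k \<le> n"
      have Zk: "projective_variety UNIV (Z k)" "Z k \<noteq> {}" "Z k \<subseteq> X"
        using Z k by (auto simp: variety_chain_def)
      then show "veronese d ` Z k \<noteq> {}" "veronese d ` Z k \<subseteq> veronese d ` X"
        by auto
      show "projective_variety (monomials d) (veronese d ` Z k)"
        using irreducible_closed_veronese[OF d] Zk by (simp add: projective_variety_iff)
    next
      fix k assume k: "k < n"
      then have "Z k \<subset> Z (Suc k)" "Z k \<subseteq> X" "Z (Suc k) \<subseteq> X"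
        using Z by (auto simp: variety_chain_def)
      then show "veronese d ` Z k \<subset> veronese d ` Z (Suc k)"
        using inj_on_subset[OF inj_on_veronese[OF d] X] by (metis inj_on_image_eq_iff image_mono psubset_eq)
    qed
    then show "\<exists>Z. variety_chain (monomials d) (veronese d ` X) n Z"
      by blast
  qed
  then show ?thesis
    by (simp add: variety_dim_chain)
qed

section \<open>Tangent spaces\<close>

text \<open>The chain rule at T = 0: a linear coefficient is the value of the derivative at 0, so
  the product rule can be applied to each monomial.\<close>

lemma coeff_1_psubst:
  fixes x :: "'i \<Rightarrow> 'a::field poly"
  assumes F: "F \<in> polys S" and S: "finite S"
  shows "coeff (psubst (\<lambda>c. [:c:]) x F) 1 =
    (\<Sum>i\<in>S. peval (pdiff i F) (\<lambda>i. coeff (x i) 0) * coeff (x i) 1)"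
proof -
  define a where "a = (\<lambda>i. coeff (x i) 0)"
  define b where "b = (\<lambda>i. coeff (x i) 1)"
  have ab: "poly (x i) 0 = a i" "poly (pderiv (x i)) 0 = b i" for i
    by (simp_all add: a_def b_def poly_0_coeff_0 coeff_pderiv)
  have 1: "coeff (\<Prod>i\<in>Poly_Mapping.keys m. x i ^ Poly_Mapping.lookup m i) 1 =
      (\<Sum>i\<in>S. of_nat (Poly_Mapping.lookup m i) * monomial_value (m - Poly_Mapping.single i 1) a * b i)"
    if m: "m \<in> Poly_Mapping.keys F" for m
  proof -
    let ?K = "Poly_Mapping.keys m"
    have K: "?K \<subseteq> S"
      using F m by (simp add: polys_iff)
    have mono: "monomial_value (m - Poly_Mapping.single i 1) a =
        a i ^ (Poly_Mapping.lookup m i - 1) * (\<Prod>j\<in>?K - {i}. a j ^ Poly_Mapping.lookup m j)"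
      if i: "i \<in> ?K" for i
    proof -
      have l: "Poly_Mapping.lookup (m - Poly_Mapping.single i 1) j =
          (if j = i then Poly_Mapping.lookup m i - 1 else Poly_Mapping.lookup m j)" for j
        by (auto simp: lookup_minus lookup_single when_def)
      have "monomial_value (m - Poly_Mapping.single i 1) a =
          (\<Prod>j\<in>?K. a j ^ Poly_Mapping.lookup (m - Poly_Mapping.single i 1) j)"
        unfolding monomial_value_def
        by (rule prod.mono_neutral_left) (auto simp: in_keys_iff l split: if_splits simp del: One_nat_def)
      also have "\<dots> = a i ^ (Poly_Mapping.lookup m i - 1) *
          (\<Prod>j\<in>?K - {i}. a j ^ Poly_Mapping.lookup (m - Poly_Mapping.single i 1) j)"
        using i by (simp add: prod.remove l del: One_nat_def)
      finally show ?thesis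
        by (simp add: l del: One_nat_def)
    qed
    have "coeff (\<Prod>i\<in>?K. x i ^ Poly_Mapping.lookup m i) 1 =
        poly (pderiv (\<Prod>i\<in>?K. x i ^ Poly_Mapping.lookup m i)) 0"
      by (simp add: poly_0_coeff_0 coeff_pderiv)
    also have "\<dots> = (\<Sum>i\<in>?K. (\<Prod>j\<in>?K - {i}. a j ^ Poly_Mapping.lookup m j) *
        (of_nat (Poly_Mapping.lookup m i) * a i ^ (Poly_Mapping.lookup m i - 1) * b i))"
      by (simp add: pderiv_prod poly_sum poly_prod pderiv_power ab mult_ac)
    also have "\<dots> = (\<Sum>i\<in>?K. of_nat (Poly_Mapping.lookup m i) *
        monomial_value (m - Poly_Mapping.single i 1) a * b i)"
      by (rule sum.cong) (simp_all only: mono mult_ac)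
    also have "\<dots> = (\<Sum>i\<in>S. of_nat (Poly_Mapping.lookup m i) *
        monomial_value (m - Poly_Mapping.single i 1) a * b i)"
      by (rule sum.mono_neutral_left) (use K S in \<open>auto simp: in_keys_iff\<close>)
    finally show ?thesis .
  qed
  have "peval (pdiff i F) a = (\<Sum>m\<in>Poly_Mapping.keys F. Poly_Mapping.lookup F m *
      (of_nat (Poly_Mapping.lookup m i) * monomial_value (m - Poly_Mapping.single i 1) a))" for i
    by (simp add: pdiff_def peval_simps peval_single monomial_value_def mult_ac)
  then have "(\<Sum>i\<in>S. peval (pdiff i F) a * b i) = (\<Sum>m\<in>Poly_Mapping.keys F. Poly_Mapping.lookup F m *
      (\<Sum>i\<in>S. of_nat (Poly_Mapping.lookup m i) * monomial_value (m - Poly_Mapping.single i 1) a * b i))"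
    by (simp add: sum_distrib_right sum_distrib_left mult_ac) (rule sum.swap)
  also have "\<dots> = coeff (psubst (\<lambda>c. [:c:]) x F) 1"
    using 1 by (simp add: psubst_def coeff_sum)
  finally show ?thesis
    by (simp add: a_def b_def)
qed

text \<open>The directional derivative at \<open>v\<close> along \<open>w\<close>, by dual numbers:
  only the linear term of F(v + T w) is kept. Differentials of substituted polynomials then follow
  from \<open>psubst_psubst\<close>.\<close>

definition differential :: "('i, 'a::field) mpoly \<Rightarrow> ('i \<Rightarrow> 'a) \<Rightarrow> ('i \<Rightarrow> 'a) \<Rightarrow> 'a" where
  "differential F v w = coeff (psubst (\<lambda>c. [:c:]) (\<lambda>i. [:v i, w i:]) F) 1"

lemma differential_eq:
  "F \<in> polys S \<Longrightarrow> finite S \<Longrightarrow> differential F v w = (\<Sum>i\<in>S. peval (pdiff i F) v * w i)"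
  using coeff_1_psubst[of F S "\<lambda>i. [:v i, w i:]"] by (simp add: differential_def)

lemma coeff_1_psubst_differential:
  "F \<in> polys S \<Longrightarrow> finite S \<Longrightarrow>
    coeff (psubst (\<lambda>c. [:c:]) x F) 1 = differential F (\<lambda>i. coeff (x i) 0) (\<lambda>i. coeff (x i) 1)"
  using coeff_1_psubst[of F S x] by (simp add: differential_eq)

lemma differential_add:
  "F \<in> polys S \<Longrightarrow> finite S \<Longrightarrow> differential F v (w + u) = differential F v w + differential F v u"
  by (simp add: differential_eq algebra_simps sum.distrib)

lemma differential_scale:
  "F \<in> polys S \<Longrightarrow> finite S \<Longrightarrow> differential F v (vscale c w) = c * differential F v w"
  by (simp add: differential_eq vscale_def sum_distrib_left mult_ac)

text \<open>From c v + T w = c (v + T (w / c)). Writing the factor c^(d-1) as a quotient avoids a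
  separate case for degree 0.\<close>

lemma differential_scale_point:
  assumes "F \<in> polys S" "finite S" "homogeneous d F" "c \<noteq> 0"
  shows "differential F (vscale c v) w = c ^ d / c * differential F v w"
proof -
  have "[:c * v i, w i:] = [:c:] * [:v i, vscale (1 / c) w i:]" for i
    using assms(4) by (simp add: vscale_def)
  then have "psubst (\<lambda>c. [:c:]) (\<lambda>i. [:c * v i, w i:]) F =
      psubst (\<lambda>c. [:c:]) (\<lambda>i. [:c:] * [:v i, vscale (1 / c) w i:]) F"
    by (simp only:)
  also have "\<dots> = [:c:] ^ d * psubst (\<lambda>c. [:c:]) (\<lambda>i. [:v i, vscale (1 / c) w i:]) F"
    by (rule psubst_scale[OF assms(3)])
  finally have "differential F (vscale c v) w = c ^ d * differential F v (vscale (1 / c) w)"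
    by (simp add: differential_def vscale_def poly_const_pow)
  then show ?thesis
    by (simp add: differential_scale[OF assms(1,2)])
qed

text \<open>Euler's relation, from F((1 + T) v) = (1 + T)^d F(v). It puts the line itself into its
  tangent cone.\<close>

lemma differential_self:
  assumes "homogeneous d F"
  shows "differential F v v = of_nat d * peval F v"
proof -
  have "psubst (\<lambda>c. [:c:]) (\<lambda>i. [:v i, v i:]) F = psubst (\<lambda>c. [:c:]) (\<lambda>i. [:1, 1:] * [:v i:]) F"
    by simp
  also have "\<dots> = [:1, 1:] ^ d * psubst (\<lambda>c. [:c:]) (\<lambda>i. [:v i:]) F"
    by (rule psubst_scale[OF assms])
  also have "psubst (\<lambda>c. [:c:]) (\<lambda>i. [:v i:]) F = [:peval F v:]"
    by (rule ring_morph_mpoly_eqI[OF ring_morph_psubst[OF ring_morph_pCons]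
          ring_morph_comp[OF ring_morph_pCons ring_morph_peval]])
      (simp_all add: psubst_Const psubst_Var ring_morph_pCons peval_simps)
  also have "coeff ([:1, 1:] ^ d * [:peval F v:]) 1 = poly (pderiv ([:1, 1:] ^ d)) 0 * peval F v"
    by (simp add: poly_0_coeff_0 coeff_pderiv mult.commute)
  finally show ?thesis
    by (simp add: differential_def pderiv_power pderiv_pCons)
qed

definition tangent_at :: "'i set \<Rightarrow> ('i, 'a::field) point set \<Rightarrow> ('i \<Rightarrow> 'a) \<Rightarrow> ('i \<Rightarrow> 'a) set" where
  "tangent_at S X v = {w \<in> coord_space S. \<forall>d. \<forall>F\<in>polys S. homogeneous d F \<longrightarrow> vanishes_on F X \<longrightarrow>
     differential F v w = 0}"

lemma tangent_cone_span:
  assumes S: "finite S" and v: "v \<noteq> 0"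
  shows "tangent_cone S X (vec.span {v}) = tangent_at S X v"
proof (intro equalityI subsetI)
  fix w assume w: "w \<in> tangent_cone S X (vec.span {v})"
  have "v \<in> vec.span {v} - {0}"
    using v vec.span_base by blast
  then show "w \<in> tangent_at S X v"
    using w unfolding tangent_cone_def tangent_at_def vanishes_on_def
    by (auto simp: differential_eq[OF _ S])
next
  fix w assume w: "w \<in> tangent_at S X v"
  have "(\<Sum>i\<in>S. peval (pdiff i F) u * w i) = 0"
    if F: "F \<in> polys S" "homogeneous d F" "\<forall>P\<in>X. vanishes_at F P" and u: "u \<in> vec.span {v} - {0}" for F d u
  proof -
    obtain c where c: "u = vscale c v" "c \<noteq> 0"
      using u by (auto simp: in_span_singleton)
    have "differential F v w = 0"
      using w F unfolding tangent_at_def vanishes_on_def by blast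
    then have "differential F u w = 0"
      by (simp add: c differential_scale_point[OF F(1) S F(2)])
    then show ?thesis
      by (simp add: differential_eq[OF F(1) S])
  qed
  then show "w \<in> tangent_cone S X (vec.span {v})"
    using w unfolding tangent_cone_def tangent_at_def by blast
qed

lemma subspace_tangent_at:
  assumes S: "finite S"
  shows "vec.subspace (tangent_at S X v)"
proof -
  have "differential F v 0 = 0" if "F \<in> polys S" for F
    using differential_eq[OF that S] by simp
  then show ?thesis
    using coord_space_subspace[of S]
    by (auto simp: vec.subspace_def tangent_at_def differential_add[OF _ S] differential_scale[OF _ S])
qed

lemma vec_dim_linear_image:
  fixes f :: "('i \<Rightarrow> 'a::field) \<Rightarrow> 'j \<Rightarrow> 'a"
  assumes f: "\<And>x y. f (x + y) = f x + f y" "\<And>c x. f (vscale c x) = vscale c (f x)"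
    and inj: "inj_on f V" and V: "vec.subspace V"
  shows "vec.dim (f ` V) = vec.dim V"
proof -
  interpret vector_space_pair "vscale :: 'a \<Rightarrow> ('i \<Rightarrow> 'a) \<Rightarrow> _" "vscale :: 'a \<Rightarrow> ('j \<Rightarrow> 'a) \<Rightarrow> _"
    by unfold_locales
  have lf: "Vector_Spaces.linear vscale vscale f"
    by unfold_locales (simp_all add: f)
  obtain B where B: "B \<subseteq> V" "vec.independent B" "V \<subseteq> vec.span B" "card B = vec.dim V"
    using vec.basis_exists by blast
  have span: "vec.span B = V"
    using B V by (meson subset_antisym vec.span_minimal)
  have "vec.independent (f ` B)"
    using linear_independent_injective_image[OF lf B(2)] inj by (simp add: span)
  moreover have "vec.span (f ` B) = f ` V"
    using linear_span_image[OF lf, of B] by (simp add: span)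
  ultimately have "vec.dim (f ` V) = card (f ` B)"
    using vec.dim_span_eq_card_independent by metis
  also have "\<dots> = card B"
    using inj_on_subset[OF inj B(1)] by (rule card_image)
  finally show ?thesis
    using B by simp
qed

lemma differential_push:
  "differential (veronese_push d i F) y u =
    differential F (\<lambda>j. y (base_expo d i j)) (\<lambda>j. u (base_expo d i j))"
  by (simp add: differential_def veronese_push_def psubst_psubst psubst_Var ring_morph_pCons)

text \<open>The differential of the chart \<open>y \<mapsto> (y\<^bsub>base_expo d i j\<^esub>)\<^sub>j\<close>, which is linear, is bijective.\<close>

lemma dim_tangent_veronese:
  assumes d: "d > 0" and X: "X \<subseteq> proj_space UNIV" and v: "v \<noteq> 0" "vec.span {v} \<in> X"
  shows "vec.dim (tangent_cone (monomials d) (veronese d ` X) (veronese d (vec.span {v}))) =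
    vec.dim (tangent_cone UNIV X (vec.span {v}))"
proof -
  obtain i where i: "v i \<noteq> 0"
    using v by (auto simp: fun_eq_iff)
  define r where "r = v i ^ (d - 1)"
  have r: "r \<noteq> 0"
    using i by (simp add: r_def)
  define p where "p u = (\<lambda>j. u (base_expo d i j))" for u :: "3 expo \<Rightarrow> 'a"
  let ?y = "veronese_vec d v"
  let ?TY = "tangent_at (monomials d) (veronese d ` X) ?y"
  let ?TX = "tangent_at UNIV X v"
  note fin = finite_monomials[of d]
  have p_lin: "p (x + y) = p x + p y" "p (vscale c x) = vscale c (p x)" for x y c
    by (auto simp: p_def vscale_def)
  have py: "p ?y = vscale r v"
    using d by (simp add: p_def veronese_vec_base r_def vscale_def)
  have y_van: "peval G ?y = 0" if G: "homogeneous g G" "vanishes_on G (veronese d ` X)" for g G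
    using G v(2) by (auto simp: vanishes_on_def veronese_span vanishes_at_span[OF G(1)] dest!: bspec)
  \<comment> \<open>Pushed forms vanish on the image. Their differential at \<open>?y\<close> is
    that of the form at \<open>vscale r v\<close>, a rescaled base point, which costs a nonzero
    factor only.\<close>
  have into: "p u \<in> ?TX" if u: "u \<in> ?TY" for u
  proof -
    have "differential F v (p u) = 0" if F: "homogeneous e F" "vanishes_on F X" for e F
    proof -
      have "vanishes_on (veronese_push d i F) (veronese d ` X)"
        using F X vanishes_at_push[OF d F(1)] by (auto simp: vanishes_on_def)
      then have "differential (veronese_push d i F) ?y u = 0"
        using u polys_push[OF d] homogeneous_push[OF F(1)] unfolding tangent_at_def by blast
      then have "differential F (vscale r v) (p u) = 0"
        by (simp add: differential_push py[symmetric]) (simp add: p_def)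
      then show ?thesis
        using differential_scale_point[of F UNIV e r] F(1) r by simp
    qed
    then show ?thesis
      by (simp add: tangent_at_def)
  qed
  \<comment> \<open>When the chart coordinates of \<open>u\<close> vanish, the differential of
    \<open>veronese_eq1\<close> leaves \<open>u m\<close> times a nonzero power.\<close>
  have inj: "u = 0" if u: "u \<in> ?TY" "p u = 0" for u
  proof
    fix m
    show "u m = 0 m"
    proof (cases "m \<in> monomials d")
      case True
      let ?E = "veronese_eq1 d i m :: (3 expo, 'a) mpoly"
      let ?s = "psubst (\<lambda>c. [:c:]) (\<lambda>k. [:?y k, u k:])"
      have s: "ring_morph ?s"
        by (rule ring_morph_psubst[OF ring_morph_pCons])
      have u0: "u (base_expo d i j) = 0" for j
        using u(2) by (simp add: p_def fun_eq_iff)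
      have "?s ?E = [:?y m, u m:] * [:?y (base_expo d i i):] ^ (d - 1) -
          monomial_value m (\<lambda>j. [:?y (base_expo d i j):])"
        by (simp add: veronese_eq1_def ring_morph.diff[OF s] ring_morph.mult[OF s] ring_morph.power[OF s]
            ring_morph_monomial_value[OF s] psubst_Var[OF ring_morph_pCons] u0)
      also have "monomial_value m (\<lambda>j. [:?y (base_expo d i j):]) = [:monomial_value m (\<lambda>j. ?y (base_expo d i j)):]"
        by (rule ring_morph_monomial_value[OF ring_morph_pCons, symmetric])
      finally have "differential ?E ?y u = u m * ?y (base_expo d i i) ^ (d - 1)"
        by (simp add: differential_def mult.commute poly_const_pow)
      moreover have "differential ?E ?y u = 0"
        using u(1) veronese_eq_polys(1)[OF d True] veronese_eq_homogeneous(1)[OF d True]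
          veronese_eq_vanish(1)[OF d True X] unfolding tangent_at_def by blast
      ultimately show ?thesis
        using i d by (simp add: veronese_vec_base)
    qed (use u in \<open>simp add: tangent_at_def coord_space_def\<close>)
  qed
  have sub: "vec.subspace ?TY"
    by (rule subspace_tangent_at[OF fin])
  have inj_p: "inj_on p ?TY"
  proof (rule inj_onI)
    fix x z assume xz: "x \<in> ?TY" "z \<in> ?TY" "p x = p z"
    have "p (x - z) = 0"
      using xz(3) by (simp add: p_def fun_eq_iff)
    then have "x - z = 0"
      using inj[OF vec.subspace_diff[OF sub xz(1,2)]] by blast
    then show "x = z"
      by simp
  qed
  have y_TY: "?y \<in> ?TY"
    using y_van by (simp add: tangent_at_def differential_self veronese_vec_coord_space)
  have onto: "w \<in> p ` ?TY" if w: "w \<in> ?TX" for w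
  proof -
    \<comment> \<open>Subtracting a multiple of \<open>v\<close> makes the \<open>i\<close>-th
      coordinate 0. Along v + T w' the factor x_i^(d-1) is then constant, so the chart coordinates
      move by exactly r w'; the radial part is restored at the end by \<open>?y\<close>.\<close>
    define w' where "w' = w + vscale (- (w i / v i)) v"
    have v_TX: "v \<in> ?TX"
      using v(2) by (auto simp: tangent_at_def differential_self vanishes_on_def vanishes_at_span dest!: bspec)
    have w'_TX: "w' \<in> ?TX"
      unfolding w'_def using subspace_tangent_at[of UNIV X v] w v_TX
      by (intro vec.subspace_add vec.subspace_scale) simp_all
    have w'i: "w' i = 0"
      using i by (simp add: w'_def vscale_def)
    \<comment> \<open>The Veronese image of the arc v + T w'. Its velocity \<open>u\<close> is the
      candidate preimage.\<close>
    define x where "x m = psubst (\<lambda>c. [:c:]) (\<lambda>j. [:v j, w' j:]) (veronese_poly d m)" for m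
    define u where "u = (\<lambda>m. coeff (x m) 1)"
    have x0: "coeff (x m) 0 = ?y m" for m
    proof -
      have "poly (x m) 0 = peval (veronese_poly d m) v"
        unfolding x_def
        by (rule ring_morph_mpoly_eqI[OF ring_morph_comp[OF ring_morph_poly ring_morph_psubst[OF ring_morph_pCons]]
              ring_morph_peval])
          (simp_all add: psubst_Const psubst_Var ring_morph_pCons peval_simps)
      then show ?thesis
        by (simp add: poly_0_coeff_0 veronese_vec_def)
    qed
    have "u \<in> coord_space (monomials d)"
      by (simp add: coord_space_def u_def x_def veronese_poly_def psubst_zero)
    moreover have "differential G ?y u = 0"
      if G: "G \<in> polys (monomials d)" "homogeneous g G" "vanishes_on G (veronese d ` X)" for g G
    proof -
      have "differential (veronese_pullback d G) v w' = 0"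
        using w'_TX homogeneous_pullback[OF G(2)] vanishes_on_pullback[OF G(2) X] G(3)
        by (auto simp: tangent_at_def)
      moreover have "differential (veronese_pullback d G) v w' = coeff (psubst (\<lambda>c. [:c:]) x G) 1"
        by (simp add: differential_def veronese_pullback_def psubst_psubst[OF ring_morph_pCons] x_def[abs_def])
      ultimately show ?thesis
        using coeff_1_psubst_differential[OF G(1) fin, of x] by (simp add: x0 u_def)
    qed
    ultimately have u_TY: "u \<in> ?TY"
      by (simp add: tangent_at_def)
    have "p u = vscale r w'"
    proof
      fix j
      have "x (base_expo d i j) = [:v i:] ^ (d - 1) * [:v j, w' j:]"
        by (simp add: x_def veronese_poly_def base_expo_monomials[OF d] psubst_monomial[OF ring_morph_pCons])
          (simp add: base_expo_def monomial_value_plus monomial_value_single w'i)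
      then show "p u j = vscale r w' j"
        by (simp add: p_def u_def r_def vscale_def poly_const_pow)
    qed
    then have "p (vscale (1 / r) (u + vscale (w i / v i) ?y)) = w' + vscale (w i / v i) v"
      using r by (simp add: p_lin py) (simp add: vscale_def fun_eq_iff field_simps)
    also have "\<dots> = w"
      by (simp add: w'_def vscale_def fun_eq_iff)
    finally show ?thesis
      using u_TY y_TY sub by (metis imageI vec.subspace_add vec.subspace_scale)
  qed
  have "p ` ?TY = ?TX"
    using into onto by blast
  then have "vec.dim ?TX = vec.dim ?TY"
    using vec_dim_linear_image[of p ?TY] p_lin inj_p sub by simp
  then show ?thesis
    using v by (simp add: veronese_span tangent_cone_span[OF fin veronese_vec_nonzero] tangent_cone_span)
qed

lemma smooth_veronese_iff:
  fixes X :: "(3, 'a::alg_closed_field) point set"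
  assumes d: "d > 0" and X: "X \<subseteq> proj_space UNIV"
  shows "smooth (monomials d) (veronese d ` X) \<longleftrightarrow> smooth UNIV X"
proof -
  have "vec.dim (tangent_cone (monomials d) (veronese d ` X) (veronese d L)) = vec.dim (tangent_cone UNIV X L)"
    if L: "L \<in> X" for L
  proof -
    obtain v where v: "v \<noteq> 0" "L = vec.span {v}"
      using X L by (meson proj_space_iff subsetD)
    then show ?thesis
      using dim_tangent_veronese[OF d X v(1)] L by simp
  qed
  then show ?thesis
    by (simp add: smooth_def variety_dim_veronese[OF d X])
qed

section \<open>Regular maps\<close>

definition form_tuple :: "'i set \<Rightarrow> 'j set \<Rightarrow> nat \<Rightarrow> ('j \<Rightarrow> ('i, 'a::field) mpoly) \<Rightarrow> bool" where
  "form_tuple S T e \<phi> \<longleftrightarrow> (\<forall>j. \<phi> j \<in> polys S \<and> homogeneous e (\<phi> j) \<and> (j \<notin> T \<longrightarrow> \<phi> j = 0))"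

text \<open>A tuple chosen for one point must represent \<open>g\<close> wherever it is defined. No
  equivalence class is mentioned, which allows composites to be checked pointwise.\<close>

definition regular_map :: "'i set \<Rightarrow> ('i, 'a::field) point set \<Rightarrow> 'j set \<Rightarrow> ('j, 'a) point set \<Rightarrow>
    (('i, 'a) point \<Rightarrow> ('j, 'a) point) \<Rightarrow> bool" where
  "regular_map S X T Y g \<longleftrightarrow> g \<in> X \<rightarrow>\<^sub>E Y \<and>
     (\<forall>L\<in>X. \<exists>\<phi> e. form_tuple S T e \<phi> \<and> defined_at \<phi> L \<and>
        (\<forall>M\<in>X. defined_at \<phi> M \<longrightarrow> g M = value_at \<phi> M))"

lemma form_tuple_value_at:
  "form_tuple S T e \<phi> \<Longrightarrow> value_at \<phi> (vec.span {v}) = vec.span {\<lambda>j. peval (\<phi> j) v}"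
  by (rule value_at_span[where d = e]) (simp add: form_tuple_def)

lemma form_tuple_defined_at:
  "form_tuple S T e \<phi> \<Longrightarrow> defined_at \<phi> (vec.span {v}) \<longleftrightarrow> (\<lambda>j. peval (\<phi> j) v) \<noteq> 0"
  using vanishes_at_span[of e "\<phi> _" v] by (simp add: form_tuple_def defined_at_def fun_eq_iff)

lemma rational_rep_form_tuple:
  assumes "rational_rep S X T Y \<phi>"
  obtains e where "form_tuple S T e \<phi>"
proof -
  obtain e where e: "\<forall>j\<in>T. \<phi> j \<in> polys S \<and> homogeneous e (\<phi> j)" "\<forall>j. j \<notin> T \<longrightarrow> \<phi> j = 0"
    using assms by (auto simp: rational_rep_def)
  have "\<phi> j \<in> polys S \<and> homogeneous e (\<phi> j) \<and> (j \<notin> T \<longrightarrow> \<phi> j = 0)" for j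
    using e by (cases "j \<in> T") simp_all
  then have "form_tuple S T e \<phi>"
    by (simp add: form_tuple_def)
  then show ?thesis
    by (rule that)
qed

lemma span_eq_if_minors_vanish:
  fixes a b :: "'j \<Rightarrow> 'a::field"
  assumes "a \<noteq> 0" "b \<noteq> 0" "\<And>i j. a i * b j = a j * b i"
  shows "vec.span {a} = vec.span {b}"
proof -
  obtain i where i: "b i \<noteq> 0"
    using assms by (auto simp: fun_eq_iff)
  have "a = vscale (a i / b i) b"
    using i assms(3) by (simp add: vscale_def fun_eq_iff field_simps)
  then show ?thesis
    using assms span_eq_iff[of b a] by blast
qed

lemma rational_equiv_span:
  assumes "rational_equiv X \<phi> \<psi>" "vec.span {v} \<in> X"
  shows "peval (\<phi> i) v * peval (\<psi> j) v = peval (\<phi> j) v * peval (\<psi> i) v"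
proof -
  have "v \<in> vec.span {v}"
    by (simp add: vec.span_base)
  then have "peval (\<phi> i * \<psi> j - \<phi> j * \<psi> i) v = 0"
    using assms unfolding rational_equiv_def vanishes_at_def by blast
  then show ?thesis
    by (simp add: peval_simps)
qed

text \<open>On an irreducible variety two representatives of the same rational map agree wherever both
  are defined, since each agrees with a third one on a dense open set.\<close>

lemma rational_equiv_trans:
  assumes X: "irreducible_closed S X" and \<chi>: "form_tuple S T n \<chi>" "\<exists>L\<in>X. defined_at \<chi> L"
    and \<phi>: "form_tuple S T d \<phi>" "rational_equiv X \<chi> \<phi>"
    and \<psi>: "form_tuple S T e \<psi>" "rational_equiv X \<chi> \<psi>"
  shows "rational_equiv X \<phi> \<psi>"
proof -
  have sub: "X \<subseteq> proj_space S"
    using X by (simp add: irreducible_closed_def)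
  obtain k where k: "\<not> vanishes_on (\<chi> k) X"
    using \<chi>(2) by (auto simp: defined_at_def vanishes_on_def)
  have "vanishes_on (\<phi> i * \<psi> j - \<phi> j * \<psi> i) X" (is "vanishes_on ?F X") for i j
  proof -
    have hom: "homogeneous (d + e) ?F"
      using \<phi>(1) \<psi>(1) by (intro homogeneous_diff homogeneous_mult) (simp_all add: form_tuple_def)
    have hom': "homogeneous n (\<chi> k)"
      using \<chi>(1) by (simp add: form_tuple_def)
    \<comment> \<open>Both tuples are proportional to \<open>\<chi>\<close>, so their minors vanish
      after multiplication by \<open>\<chi> k\<close>; irreducibility of \<open>X\<close> removes
      this factor.\<close>
    have "vanishes_on (?F * \<chi> k) X"
      unfolding vanishes_on_def
    proof
      fix L assume L: "L \<in> X"
      then obtain v where v: "L = vec.span {v}"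
        using sub by (meson proj_space_iff subsetD)
      have a: "peval (\<chi> k) v * peval (\<phi> l) v = peval (\<chi> l) v * peval (\<phi> k) v"
        and b: "peval (\<chi> i) v * peval (\<psi> j) v = peval (\<chi> j) v * peval (\<psi> i) v" for l
        using rational_equiv_span[OF \<phi>(2)] rational_equiv_span[OF \<psi>(2)] L v by blast+
      have "peval (?F * \<chi> k) v = (peval (\<chi> k) v * peval (\<phi> i) v) * peval (\<psi> j) v -
          (peval (\<chi> k) v * peval (\<phi> j) v) * peval (\<psi> i) v"
        by (simp add: peval_simps algebra_simps)
      also have "\<dots> = peval (\<phi> k) v *
          (peval (\<chi> i) v * peval (\<psi> j) v - peval (\<chi> j) v * peval (\<psi> i) v)"
        unfolding a by (simp add: algebra_simps)
      also have "\<dots> = 0"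
        unfolding b by simp
      finally show "vanishes_at (?F * \<chi> k) L"
        unfolding v by (simp add: vanishes_at_span[OF homogeneous_mult[OF hom hom']])
    qed
    moreover have "?F \<in> polys S" "\<chi> k \<in> polys S"
      using \<phi>(1) \<psi>(1) \<chi>(1) by (auto simp: form_tuple_def intro!: polys_diff polys_mult)
    ultimately show ?thesis
      using irreducible_closed_multD[OF X _ _ hom hom'] k by blast
  qed
  then show ?thesis
    by (simp add: rational_equiv_def vanishes_on_def)
qed

text \<open>Representatives in one class agree wherever both are defined, so the tuple given at one
  point is valid on its whole domain. Conversely, tuples valid on their domains are pairwise
  equivalent: where one is undefined the minors vanish trivially.\<close>

lemma variety_morphisms_iff:
  assumes X: "irreducible_closed S X"
  shows "g \<in> variety_morphisms S X T Y \<longleftrightarrow> regular_map S X T Y g"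
proof
  assume "g \<in> variety_morphisms S X T Y"
  then obtain \<chi> where g: "g \<in> X \<rightarrow>\<^sub>E Y" and \<chi>: "rational_rep S X T Y \<chi>"
    and loc: "\<And>L. L \<in> X \<Longrightarrow> \<exists>\<phi>. rational_rep S X T Y \<phi> \<and> rational_equiv X \<chi> \<phi> \<and>
      defined_at \<phi> L \<and> g L = value_at \<phi> L"
    unfolding variety_morphisms_def rational_maps_def by blast
  obtain n where n: "form_tuple S T n \<chi>"
    by (rule rational_rep_form_tuple[OF \<chi>])
  have \<chi>_def: "\<exists>L\<in>X. defined_at \<chi> L"
    using \<chi> by (simp add: rational_rep_def)
  have sub: "X \<subseteq> proj_space S"
    using X by (simp add: irreducible_closed_def)
  have "\<exists>\<phi> e. form_tuple S T e \<phi> \<and> defined_at \<phi> L \<and> (\<forall>M\<in>X. defined_at \<phi> M \<longrightarrow> g M = value_at \<phi> M)"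
    if L: "L \<in> X" for L
  proof -
    obtain \<phi> where \<phi>: "rational_rep S X T Y \<phi>" "rational_equiv X \<chi> \<phi>" "defined_at \<phi> L"
      using loc[OF L] by blast
    obtain d where d: "form_tuple S T d \<phi>"
      by (rule rational_rep_form_tuple[OF \<phi>(1)])
    have "g M = value_at \<phi> M" if M: "M \<in> X" "defined_at \<phi> M" for M
    proof -
      obtain \<psi> where \<psi>: "rational_rep S X T Y \<psi>" "rational_equiv X \<chi> \<psi>" "defined_at \<psi> M" "g M = value_at \<psi> M"
        using loc[OF M(1)] by blast
      obtain e where e: "form_tuple S T e \<psi>"
        by (rule rational_rep_form_tuple[OF \<psi>(1)])
      have equiv: "rational_equiv X \<psi> \<phi>"
        by (rule rational_equiv_trans[OF X n \<chi>_def e \<psi>(2) d \<phi>(2)])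
      obtain v where v: "M = vec.span {v}"
        using sub M(1) by (meson proj_space_iff subsetD)
      have "vec.span {\<lambda>j. peval (\<psi> j) v} = vec.span {\<lambda>j. peval (\<phi> j) v}"
        using M \<psi>(3) rational_equiv_span[OF equiv] unfolding v
        by (intro span_eq_if_minors_vanish) (simp_all add: form_tuple_defined_at[OF d] form_tuple_defined_at[OF e])
      then show ?thesis
        using \<psi>(4) by (simp add: v form_tuple_value_at[OF d] form_tuple_value_at[OF e])
    qed
    then show ?thesis
      using d \<phi>(3) by blast
  qed
  then show "regular_map S X T Y g"
    using g by (simp add: regular_map_def)
next
  assume reg: "regular_map S X T Y g"
  have sub: "X \<subseteq> proj_space S" and ne: "X \<noteq> {}"
    using X by (simp_all add: irreducible_closed_def)
  define good where "good \<phi> \<longleftrightarrow> (\<exists>e. form_tuple S T e \<phi>) \<and> (\<exists>L\<in>X. defined_at \<phi> L) \<and>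
    (\<forall>M\<in>X. defined_at \<phi> M \<longrightarrow> g M = value_at \<phi> M)" for \<phi>
  have gY: "g M \<in> Y" if "M \<in> X" for M
    using reg that by (auto simp: regular_map_def)
  have rep: "rational_rep S X T Y \<phi>" if \<phi>: "good \<phi>" for \<phi>
  proof -
    have "value_at \<phi> M \<in> Y" if "M \<in> X" "defined_at \<phi> M" for M
      using \<phi> gY that unfolding good_def by metis
    then show ?thesis
      using \<phi> unfolding rational_rep_def good_def form_tuple_def by blast
  qed
  have equiv: "rational_equiv X \<phi> \<psi>" if \<phi>: "good \<phi>" and \<psi>: "good \<psi>" for \<phi> \<psi>
    unfolding rational_equiv_def
  proof (intro allI ballI)
    fix i j M assume M: "M \<in> X"
    then obtain v where v: "M = vec.span {v}"
      using sub by (meson proj_space_iff subsetD)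
    obtain d e where d: "form_tuple S T d \<phi>" and e: "form_tuple S T e \<psi>"
      using \<phi> \<psi> by (auto simp: good_def)
    have hom: "homogeneous (d + e) (\<phi> i * \<psi> j - \<phi> j * \<psi> i)"
      using d e by (intro homogeneous_diff homogeneous_mult) (simp_all add: form_tuple_def)
    have "peval (\<phi> i) v * peval (\<psi> j) v = peval (\<phi> j) v * peval (\<psi> i) v"
    proof (cases "defined_at \<phi> M \<and> defined_at \<psi> M")
      case True
      then have "value_at \<phi> M = value_at \<psi> M"
        using \<phi> \<psi> M unfolding good_def by metis
      then have "vec.span {\<lambda>j. peval (\<phi> j) v} = vec.span {\<lambda>j. peval (\<psi> j) v}"
        by (simp add: v form_tuple_value_at[OF d] form_tuple_value_at[OF e])
      then have "(\<lambda>j. peval (\<phi> j) v) \<in> vec.span {\<lambda>j. peval (\<psi> j) v}"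
        using vec.span_base by blast
      then obtain c where "(\<lambda>j. peval (\<phi> j) v) = vscale c (\<lambda>j. peval (\<psi> j) v)"
        by (auto simp: in_span_singleton)
      then have "peval (\<phi> l) v = c * peval (\<psi> l) v" for l
        by (simp add: vscale_def fun_eq_iff)
      then show ?thesis
        by simp
    next
      case False
      then have "(\<lambda>j. peval (\<phi> j) v) = 0 \<or> (\<lambda>j. peval (\<psi> j) v) = 0"
        unfolding v form_tuple_defined_at[OF d] form_tuple_defined_at[OF e] by blast
      then show ?thesis
        by (auto simp: fun_eq_iff)
    qed
    then show "vanishes_at (\<phi> i * \<psi> j - \<phi> j * \<psi> i) M"
      unfolding v vanishes_at_span[OF hom] by (simp add: peval_simps)
  qed
  have loc: "\<exists>\<phi>. good \<phi> \<and> defined_at \<phi> L \<and> g L = value_at \<phi> L" if L: "L \<in> X" for L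
  proof -
    obtain \<phi> e where "form_tuple S T e \<phi>" "defined_at \<phi> L" "\<forall>M\<in>X. defined_at \<phi> M \<longrightarrow> g M = value_at \<phi> M"
      using reg L unfolding regular_map_def by blast
    then show ?thesis
      using L unfolding good_def by blast
  qed
  obtain \<chi> where \<chi>: "good \<chi>"
    using ne loc by blast
  let ?R = "{\<psi>. rational_rep S X T Y \<psi> \<and> rational_equiv X \<chi> \<psi>}"
  have "?R \<in> rational_maps S X T Y"
    using rep[OF \<chi>] unfolding rational_maps_def by blast
  moreover have "\<forall>L\<in>X. \<exists>\<phi>\<in>?R. defined_at \<phi> L \<and> g L = value_at \<phi> L"
    using loc rep equiv[OF \<chi>] by blast
  moreover have "g \<in> X \<rightarrow>\<^sub>E Y"
    using reg by (simp add: regular_map_def)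
  ultimately show "g \<in> variety_morphisms S X T Y"
    unfolding variety_morphisms_def by blast
qed

lemma regular_map_id:
  assumes "X \<subseteq> proj_space S"
  shows "regular_map S X S X (restrict id X)"
proof -
  define \<phi> where "\<phi> j = (if j \<in> S then Var j else 0 :: ('a, 'b) mpoly)" for j
  have \<phi>: "form_tuple S S 1 \<phi>"
    by (simp add: form_tuple_def \<phi>_def)
  have "defined_at \<phi> L \<and> value_at \<phi> L = L" if L: "L \<in> X" for L
  proof -
    obtain v where v: "v \<in> coord_space S" "v \<noteq> 0" "L = vec.span {v}"
      using assms L by (meson proj_space_iff subsetD)
    have "(\<lambda>j. peval (\<phi> j) v) = v"
      using v(1) by (auto simp: \<phi>_def fun_eq_iff peval_simps coord_space_def)
    then show ?thesis
      using v by (simp add: form_tuple_value_at[OF \<phi>] form_tuple_defined_at[OF \<phi>])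
  qed
  then show ?thesis
    using \<phi> by (auto simp: regular_map_def intro!: exI[of _ \<phi>])
qed

lemma regular_map_compose:
  assumes g: "regular_map S X T Y g" and h: "regular_map T Y U W h"
    and X: "X \<subseteq> proj_space S" and Y: "Y \<subseteq> proj_space T"
  shows "regular_map S X U W (compose X h g)"
proof -
  have "\<exists>\<chi> n. form_tuple S U n \<chi> \<and> defined_at \<chi> L \<and>
      (\<forall>M\<in>X. defined_at \<chi> M \<longrightarrow> compose X h g M = value_at \<chi> M)" if L: "L \<in> X" for L
  proof -
    obtain \<phi> d where \<phi>: "form_tuple S T d \<phi>" "defined_at \<phi> L" "\<And>M. M \<in> X \<Longrightarrow> defined_at \<phi> M \<Longrightarrow> g M = value_at \<phi> M"
      using g L unfolding regular_map_def by blast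
    have gY: "g M \<in> Y" if "M \<in> X" for M
      using g that by (auto simp: regular_map_def)
    obtain \<psi> e where \<psi>: "form_tuple T U e \<psi>" "defined_at \<psi> (g L)" "\<And>M. M \<in> Y \<Longrightarrow> defined_at \<psi> M \<Longrightarrow> h M = value_at \<psi> M"
      using h gY[OF L] unfolding regular_map_def by blast
    define \<chi> where "\<chi> j = psubst Const \<phi> (\<psi> j)" for j
    have \<chi>: "form_tuple S U (e * d) \<chi>"
      using \<phi>(1) \<psi>(1) by (auto simp: form_tuple_def \<chi>_def psubst_zero intro!: polys_psubst homogeneous_psubst)
    have \<chi>_val: "(\<lambda>j. peval (\<chi> j) v) = (\<lambda>j. peval (\<psi> j) (\<lambda>i. peval (\<phi> i) v))" for v
      by (simp add: \<chi>_def peval_psubst)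
    obtain v where v: "L = vec.span {v}"
      using X L by (meson proj_space_iff subsetD)
    have "g L = vec.span {\<lambda>i. peval (\<phi> i) v}"
      using \<phi>(3)[OF L \<phi>(2)] by (simp add: v form_tuple_value_at[OF \<phi>(1)])
    then have "defined_at \<chi> L"
      using \<psi>(2) by (simp add: v form_tuple_defined_at[OF \<chi>] form_tuple_defined_at[OF \<psi>(1)] \<chi>_val)
    moreover have "h (g M) = value_at \<chi> M" if M: "M \<in> X" "defined_at \<chi> M" for M
    proof -
      obtain w where w: "M = vec.span {w}"
        using X M(1) by (meson proj_space_iff subsetD)
      have ne: "(\<lambda>j. peval (\<psi> j) (\<lambda>i. peval (\<phi> i) w)) \<noteq> 0"
        using M(2) by (simp add: w form_tuple_defined_at[OF \<chi>] \<chi>_val)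
      show ?thesis
      proof (cases "defined_at \<phi> M")
        case True
        then have gM: "g M = vec.span {\<lambda>i. peval (\<phi> i) w}"
          using \<phi>(3) M(1) by (simp add: w form_tuple_value_at[OF \<phi>(1)])
        have "defined_at \<psi> (g M)"
          using ne by (simp add: gM form_tuple_defined_at[OF \<psi>(1)])
        then have "h (g M) = value_at \<psi> (g M)"
          using \<psi>(3) gY M(1) by blast
        also have "\<dots> = value_at \<chi> M"
          unfolding gM by (simp add: w form_tuple_value_at[OF \<psi>(1)] form_tuple_value_at[OF \<chi>] \<chi>_val)
        finally show ?thesis .
      next
        \<comment> \<open>The composite tuple may be defined where \<open>\<phi>\<close> is not.
          Then \<open>\<psi>\<close> is nonzero at the zero vector, hence has degree 0 and is
          constant, and it gives the same value at \<open>g M\<close>.\<close>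
        case False
        then have z: "(\<lambda>i. peval (\<phi> i) w) = 0"
          by (simp add: w form_tuple_defined_at[OF \<phi>(1)])
        have scale: "peval (\<psi> j) 0 = 0 ^ e * peval (\<psi> j) y" for j y
          using peval_scale[of e "\<psi> j" 0 y] \<psi>(1) by (simp add: form_tuple_def)
        have e: "e = 0"
        proof (rule ccontr)
          assume "e \<noteq> 0"
          then have "peval (\<psi> j) 0 = 0" for j
            using scale[of j 0] by (simp add: power_0_left)
          then have "(\<lambda>j. peval (\<psi> j) 0) = 0"
            by (simp add: fun_eq_iff)
          then show False
            using ne by (simp add: z)
        qed
        have const: "(\<lambda>j. peval (\<psi> j) y) = (\<lambda>j. peval (\<psi> j) 0)" for y
          using scale[of _ y] by (simp add: e)
        obtain y where y: "g M = vec.span {y}"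
          using Y gY[OF M(1)] by (meson proj_space_iff subsetD)
        have "defined_at \<psi> (g M)"
          using ne const[of y] by (simp add: y form_tuple_defined_at[OF \<psi>(1)] z)
        then have "h (g M) = value_at \<psi> (g M)"
          using \<psi>(3) gY M(1) by blast
        also have "\<dots> = value_at \<chi> M"
          unfolding y using const[of y]
          by (simp add: w form_tuple_value_at[OF \<psi>(1)] form_tuple_value_at[OF \<chi>] \<chi>_val z)
        finally show ?thesis .
      qed
    qed
    ultimately show ?thesis
      using \<chi> by (intro exI[of _ \<chi>] exI[of _ "e * d"]) (simp add: compose_def)
  qed
  moreover have "compose X h g \<in> X \<rightarrow>\<^sub>E W"
    using g h by (auto simp: regular_map_def compose_def)
  ultimately show ?thesis
    by (simp add: regular_map_def)
qed

section \<open>The Veronese map and its inverse are regular\<close>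

lemma regular_map_veronese:
  assumes X: "X \<subseteq> proj_space UNIV"
  shows "regular_map UNIV X (monomials d) (veronese d ` X) (restrict (veronese d) X)"
proof -
  have \<phi>: "form_tuple UNIV (monomials d) d (veronese_poly d)"
    by (simp add: form_tuple_def homogeneous_veronese_poly) (simp add: veronese_poly_def)
  have "defined_at (veronese_poly d) L" if L: "L \<in> X" for L
  proof -
    obtain v where "v \<noteq> 0" "L = vec.span {v}"
      using X L by (meson proj_space_iff subsetD)
    then show ?thesis
      using veronese_vec_nonzero[of v d] by (simp add: form_tuple_defined_at[OF \<phi>] veronese_vec_def[abs_def])
  qed
  then show ?thesis
    using \<phi> by (auto simp: regular_map_def veronese_def)
qed

text \<open>Near a point with \<open>v i\<close> nonzero the tuple of chart coordinates inverts the
  map, since it returns v_i^(d-1) v.\<close>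

lemma regular_map_inv_veronese:
  assumes d: "d > 0" and X: "X \<subseteq> proj_space UNIV"
  shows "regular_map (monomials d) (veronese d ` X) UNIV X
    (restrict (inv_into X (veronese d)) (veronese d ` X))"
proof -
  have inj: "inj_on (veronese d) X"
    by (rule inj_on_subset[OF inj_on_veronese[OF d] X])
  have "\<exists>\<phi> e. form_tuple (monomials d) UNIV e \<phi> \<and> defined_at \<phi> (veronese d L) \<and>
      (\<forall>M\<in>X. defined_at \<phi> (veronese d M) \<longrightarrow> M = value_at \<phi> (veronese d M))" if L: "L \<in> X" for L
  proof -
    obtain v where v: "v \<noteq> 0" "L = vec.span {v}"
      using X L by (meson proj_space_iff subsetD)
    obtain i where i: "v i \<noteq> 0"
      using v by (auto simp: fun_eq_iff)
    define \<phi> where "\<phi> j = (Var (base_expo d i j) :: (3 expo, 'a) mpoly)" for j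
    have \<phi>: "form_tuple (monomials d) UNIV 1 \<phi>"
      by (simp add: form_tuple_def \<phi>_def base_expo_monomials[OF d])
    have val: "(\<lambda>j. peval (\<phi> j) (veronese_vec d w)) = vscale (w i ^ (d - 1)) w" for w
      by (simp add: \<phi>_def peval_Var veronese_vec_base[OF d] vscale_def)
    have "(v i ^ (d - 1)) * v i \<noteq> 0"
      using i by simp
    then have "vscale (v i ^ (d - 1)) v \<noteq> 0"
      unfolding vscale_def fun_eq_iff by auto
    then have "defined_at \<phi> (veronese d L)"
      by (simp add: v veronese_span form_tuple_defined_at[OF \<phi>] val)
    moreover have "M = value_at \<phi> (veronese d M)" if M: "M \<in> X" "defined_at \<phi> (veronese d M)" for M
    proof -
      obtain w where w: "M = vec.span {w}"
        using X M(1) by (meson proj_space_iff subsetD)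
      have "vscale (w i ^ (d - 1)) w \<noteq> 0"
        using M(2) by (simp add: w veronese_span form_tuple_defined_at[OF \<phi>] val)
      then have "vec.span {vscale (w i ^ (d - 1)) w} = vec.span {w}"
        by (intro span_singleton_eq) (auto simp: in_span_singleton)
      then show ?thesis
        by (simp add: w veronese_span form_tuple_value_at[OF \<phi>] val)
    qed
    ultimately show ?thesis
      using \<phi> by blast
  qed
  then show ?thesis
    using inj by (auto simp: regular_map_def inv_into_into)
qed

section \<open>The quiver Grassmannians\<close>

lemma expo_split:
  fixes m :: "'i expo"
  assumes "tdeg m = Suc k"
  obtains n j where "m = n + Poly_Mapping.single j 1" "tdeg n = k"
proof -
  obtain j where j: "j \<in> Poly_Mapping.keys m"
    using assms by (fastforce simp: tdeg_def)
  define n where "n = m - Poly_Mapping.single j 1"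
  have m: "m = n + Poly_Mapping.single j 1"
    using j by (intro poly_mapping_eqI) (auto simp: n_def lookup_add lookup_minus lookup_single when_def in_keys_iff)
  then have "tdeg n = k"
    using assms tdeg_add[of n "Poly_Mapping.single j 1"] by (simp add: tdeg_single)
  then show ?thesis
    using m that by blast
qed

text \<open>The hypothesis on \<open>v\<close> says that the matrix \<open>A\<^sub>d(v)\<close> has rank one.\<close>

lemma rank_one_imp_veronese:
  fixes v w :: "3 expo \<Rightarrow> 'a::field"
  assumes d: "d > 0" and v: "v \<in> coord_space (monomials d)" "v \<noteq> 0"
    and vw: "\<And>i n. tdeg n + 1 = d \<Longrightarrow> v (n + Poly_Mapping.single i 1) = a i * w n"
  obtains c where "c \<noteq> 0" "v = vscale c (veronese_vec d a)" "a \<noteq> 0"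
proof -
  obtain m where m: "v m \<noteq> 0"
    using v by (auto simp: fun_eq_iff)
  then have "tdeg m = Suc (d - 1)"
    using v(1) d by (auto simp: coord_space_def monomials_def)
  then obtain n i where ni: "m = n + Poly_Mapping.single i 1" "tdeg n = d - 1"
    by (rule expo_split)
  have ai: "a i \<noteq> 0"
    using vw[of n i] ni m d by auto
  \<comment> \<open>The entry of \<open>v\<close> at n + e_i + e_j is read off from two rows of the
    matrix.\<close>
  have swap: "a i * w (n + Poly_Mapping.single j 1) = a j * w (n + Poly_Mapping.single i 1)"
    if "tdeg n + 2 = d" for n j
  proof -
    have deg: "tdeg (n + Poly_Mapping.single l 1) + 1 = d" for l
      using that by (simp add: tdeg_add tdeg_single)
    have "(n + Poly_Mapping.single j 1) + Poly_Mapping.single i 1 =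
        (n + Poly_Mapping.single i 1) + Poly_Mapping.single j 1"
      by (simp only: add_ac)
    then have "v (n + Poly_Mapping.single j 1 + Poly_Mapping.single i 1) =
        v (n + Poly_Mapping.single i 1 + Poly_Mapping.single j 1)"
      by (rule arg_cong)
    then show ?thesis
      unfolding vw[OF deg, of _ j] vw[OF deg, of _ i] .
  qed
  define W where "W = w (Poly_Mapping.single i (d - 1))"
  \<comment> \<open>By \<open>swap\<close>, the factors x_j of \<open>n\<close> are traded one by
    one for x_i. Here \<open>k\<close> counts those left and \<open>q\<close> the x_i already
    collected; k + q + 1 = d keeps the index in degree d - 1.\<close>
  have pure: "w (n + Poly_Mapping.single i q) * a i ^ k = monomial_value n a * W"
    if "tdeg n = k" "k + q + 1 = d" for n k q
    using that
  proof (induction k arbitrary: n q)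
    case 0
    then have "\<forall>l\<in>Poly_Mapping.keys n. Poly_Mapping.lookup n l = 0"
      by (simp add: tdeg_def)
    then have "Poly_Mapping.keys n = {}"
      by blast
    then have "n = 0"
      by simp
    then show ?case
      using 0 by (auto simp: monomial_value_def W_def)
  next
    case (Suc k)
    obtain n' j where n': "n = n' + Poly_Mapping.single j 1" "tdeg n' = k"
      using Suc.prems(1) by (rule expo_split)
    have e1: "n + Poly_Mapping.single i q = (n' + Poly_Mapping.single i q) + Poly_Mapping.single j 1"
      by (simp add: n' add_ac)
    have e2: "n' + Poly_Mapping.single i (Suc q) = (n' + Poly_Mapping.single i q) + Poly_Mapping.single i 1"
      by (simp add: add.assoc flip: single_add)
    have "a i * w (n + Poly_Mapping.single i q) = a j * w (n' + Poly_Mapping.single i (Suc q))"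
      unfolding e1 e2 using Suc.prems n' by (intro swap) (simp add: tdeg_add tdeg_single)
    then have "w (n + Poly_Mapping.single i q) * a i ^ Suc k =
        a j * (w (n' + Poly_Mapping.single i (Suc q)) * a i ^ k)"
      by (simp add: mult_ac)
    also have "\<dots> = a j * (monomial_value n' a * W)"
      using Suc.IH[OF n'(2), of "Suc q"] Suc.prems by simp
    also have "\<dots> = monomial_value n a * W"
      unfolding n'(1) monomial_value_plus monomial_value_single by (simp add: mult_ac)
    finally show ?case .
  qed
  have "v m * a i ^ (d - 1) = W * veronese_vec d a m" for m
  proof (cases "m \<in> monomials d")
    case True
    then have "tdeg m = Suc (d - 1)"
      using d by (simp add: monomials_def)
    then obtain n j where n: "m = n + Poly_Mapping.single j 1" "tdeg n = d - 1"
      by (rule expo_split)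
    have "w n * a i ^ (d - 1) = monomial_value n a * W"
      using pure[of n "d - 1" 0] n d by simp
    then have "v m * a i ^ (d - 1) = a j * (monomial_value n a * W)"
      using vw[of n j] n d by (simp add: mult_ac)
    also have "\<dots> = W * veronese_vec d a m"
      using True unfolding veronese_vec_eq n(1) monomial_value_plus monomial_value_single by (simp add: mult_ac)
    finally show ?thesis .
  qed (use v in \<open>simp add: coord_space_def veronese_vec_eq\<close>)
  then have eq: "v = vscale (W / a i ^ (d - 1)) (veronese_vec d a)"
    using ai by (simp add: vscale_def fun_eq_iff field_simps)
  then have "W / a i ^ (d - 1) \<noteq> 0"
    using v(2) by auto
  moreover have "a \<noteq> 0"
    using ai by auto
  ultimately show ?thesis
    using eq that by blast
qed

lemma homogeneous_form_polynomial: "homogeneous d (form_polynomial d c)"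
  unfolding form_polynomial_def
  by (rule homogeneous_sum) (auto simp: homogeneous_def monomials_def)

lemma peval_form_polynomial: "peval (form_polynomial d c) v = linear_form d c (veronese_vec d v)"
  by (simp add: form_polynomial_def linear_form_def peval_simps peval_single veronese_vec_eq monomial_value_def)

lemma form_polynomial_lookup:
  fixes F :: "(3, 'a::field) mpoly"
  assumes "homogeneous d F"
  shows "form_polynomial d (Poly_Mapping.lookup F) = F"
proof -
  have "form_polynomial d (Poly_Mapping.lookup F) =
      (\<Sum>m\<in>Poly_Mapping.keys F. Poly_Mapping.single m (Poly_Mapping.lookup F m))"
    unfolding form_polynomial_def
    by (rule sum.mono_neutral_right)
      (use assms finite_monomials in \<open>auto simp: homogeneous_def monomials_def in_keys_iff\<close>)
  then show ?thesis
    using mpoly_sum_single[of F] by simp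
qed

lemma linear_form_scale: "linear_form d c (vscale r v) = r * linear_form d c v"
  by (simp add: linear_form_def vscale_def sum_distrib_left mult_ac)

text \<open>\<open>vec.dim\<close> is the cardinality of a basis and is 0 for infinite bases too, so
  the finite ambient index set matters.\<close>

lemma dim_0_imp_zero:
  fixes U :: "('i \<Rightarrow> 'a::field) set"
  assumes "vec.dim U = 0" "U \<subseteq> coord_space S" "finite S"
  shows "U \<subseteq> {0}"
proof -
  obtain B where B: "B \<subseteq> U" "vec.independent B" "U \<subseteq> vec.span B" "card B = vec.dim U"
    using vec.basis_exists by blast
  obtain A :: "('i \<Rightarrow> 'a) set" where A: "finite A" "coord_space S \<subseteq> vec.span A"
    using coord_space_fin_dim[OF assms(3)] by blast
  have "finite B"
    using vec.independent_span_bound[OF A(1) B(2)] B(1) A(2) assms(2) by blast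
  then have "B = {}"
    using B(4) assms(1) by simp
  then show ?thesis
    using B(3) by simp
qed

lemma vec_dim_zero: "vec.dim {0 :: 'i \<Rightarrow> 'a::field} = 0"
  using vec.dim_span_eq_card_independent[OF vec.independent_empty] by simp

text \<open>The lines at vertices 2 and 3 amount to \<phi>_i(v) = a_i w with scalars a_i, which are
  the homogeneous coordinates of the plane point. The zero space at vertex 1 says that the linear
  form kills \<open>v\<close>, that is, the polynomial vanishes at \<open>a\<close>.\<close>

lemma GrV_eq:
  assumes d: "d > 0"
  shows "GrV d c = veronese d ` plane_curve (form_polynomial d c)"
proof (intro equalityI subsetI)
  fix L assume "L \<in> GrV d c"
  then obtain U where U: "U \<in> quiver_Grassmannian quiverQ (repV d c) (case_vertex 0 1 1)" and L: "L = U Vertex2"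
    by (auto simp: GrV_def)
  have sub: "vec.subspace (U x)" "U x \<subseteq> rep_space (repV d c) x" "vec.dim (U x) = (case x of Vertex1 \<Rightarrow> 0 | _ \<Rightarrow> 1)" for x
    using U by (auto simp: quiver_Grassmannian_def subrepresentation_def quiverQ_def split: vertex.splits)
  have maps: "rep_map (repV d c) e ` U Vertex2 \<subseteq> U (case e of Arrow_f \<Rightarrow> Vertex1 | _ \<Rightarrow> Vertex3)" for e
    using U by (auto simp: quiver_Grassmannian_def subrepresentation_def quiverQ_def)
  have "U Vertex2 \<in> proj_space (monomials d)"
    using sub[of Vertex2] by (simp add: proj_space_def repV_def)
  then obtain v where v: "v \<in> coord_space (monomials d)" "v \<noteq> 0" "U Vertex2 = vec.span {v}"
    by (auto simp: proj_space_iff)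
  have "U Vertex3 \<in> proj_space {n. tdeg n + 1 = d}"
    using sub[of Vertex3] by (simp add: proj_space_def repV_def)
  then obtain w where w: "U Vertex3 = vec.span {w}"
    by (auto simp: proj_space_iff)
  have vU: "v \<in> U Vertex2"
    by (simp add: v(3) vec.span_base)
  have "\<exists>a. \<forall>i. rep_map (repV d c) (Arrow_phi i) v = vscale (a i) w"
  proof -
    have "\<exists>r. rep_map (repV d c) (Arrow_phi i) v = vscale r w" for i
      using maps[of "Arrow_phi i"] vU by (auto simp: w in_span_singleton)
    then show ?thesis
      by metis
  qed
  then obtain a where a: "rep_map (repV d c) (Arrow_phi i) v = vscale (a i) w" for i
    by blast
  have "v (n + Poly_Mapping.single i 1) = a i * w n" if "tdeg n + 1 = d" for i n
    using fun_cong[OF a[of i], of n] that by (simp add: repV_def vscale_def)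
  then obtain r where r: "r \<noteq> 0" "v = vscale r (veronese_vec d a)" "a \<noteq> 0"
    using rank_one_imp_veronese[OF d v(1,2)] by metis
  have "U Vertex1 \<subseteq> {0}"
    using sub[of Vertex1] by (intro dim_0_imp_zero[of _ "{0}"]) (simp_all add: repV_def)
  then have "rep_map (repV d c) Arrow_f v = 0"
    using maps[of Arrow_f] vU by auto
  then have "linear_form d c v = 0"
    by (auto simp: repV_def fun_eq_iff dest: spec[of _ 0])
  then have "peval (form_polynomial d c) a = 0"
    using r by (simp add: peval_form_polynomial linear_form_scale)
  then have "vec.span {a} \<in> plane_curve (form_polynomial d c)"
    using r(3) by (simp add: plane_curve_def span_in_proj_space_UNIV vanishes_at_span[OF homogeneous_form_polynomial])
  moreover have "L = veronese d (vec.span {a})"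
    unfolding L v(3) veronese_span using span_eq_iff[OF veronese_vec_nonzero[OF r(3)] v(2)] r(2) by blast
  ultimately show "L \<in> veronese d ` plane_curve (form_polynomial d c)"
    by blast
next
  fix L assume "L \<in> veronese d ` plane_curve (form_polynomial d c)"
  then obtain a where a: "a \<noteq> 0" "L = vec.span {veronese_vec d a}" "peval (form_polynomial d c) a = 0"
    by (auto simp: plane_curve_def proj_space_iff veronese_span vanishes_at_span[OF homogeneous_form_polynomial])
  \<comment> \<open>The Veronese vector of \<open>a\<close> in degree d - 1: by a^(n + e_j) = a_j
    a^n all three maps send the Veronese vector of degree d into its span.\<close>
  define w where "w n = (if tdeg n + 1 = d then monomial_value n a else 0)" for n
  obtain i where i: "a i \<noteq> 0"
    using a(1) by (auto simp: fun_eq_iff)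
  have "w (Poly_Mapping.single i (d - 1)) \<noteq> 0"
    using d i by (simp add: w_def tdeg_single monomial_value_single)
  then have "w \<noteq> 0"
    by auto
  moreover have "w \<in> coord_space {n. tdeg n + 1 = d}"
    by (simp add: w_def coord_space_def)
  ultimately have U3: "vec.span {w} \<in> proj_space {n. tdeg n + 1 = d}"
    by (auto simp: proj_space_iff)
  have U2: "vec.span {veronese_vec d a} \<in> proj_space (monomials d)"
    using veronese_vec_nonzero[OF a(1)] veronese_vec_coord_space by (auto simp: proj_space_iff)
  define U where "U = case_vertex {0} (vec.span {veronese_vec d a}) (vec.span {w})"
  have phi: "rep_map (repV d c) (Arrow_phi j) (veronese_vec d a) = vscale (a j) w" for j
  proof
    fix n
    show "rep_map (repV d c) (Arrow_phi j) (veronese_vec d a) n = vscale (a j) w n"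
      by (simp add: repV_def vscale_def w_def veronese_vec_eq monomials_def tdeg_add tdeg_single)
        (auto simp: monomial_value_plus monomial_value_single simp del: One_nat_def)
  qed
  have lin: "rep_map (repV d c) e (vscale r v) = vscale r (rep_map (repV d c) e v)" for e r v
    by (cases e) (auto simp: repV_def vscale_def fun_eq_iff linear_form_def sum_distrib_left mult_ac)
  have f: "rep_map (repV d c) Arrow_f (veronese_vec d a) = 0"
    using a(3) by (simp add: repV_def peval_form_polynomial fun_eq_iff)
  have "rep_map (repV d c) e ` U Vertex2 \<subseteq> U (case e of Arrow_f \<Rightarrow> Vertex1 | _ \<Rightarrow> Vertex3)" for e
  proof (cases e)
    case Arrow_f
    then show ?thesis
      by (auto simp: U_def in_span_singleton lin f)
  next
    case (Arrow_phi j)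
    have "vscale r (vscale (a j) w) \<in> vec.span {w}" for r
      by (intro vec.span_scale vec.span_base) simp
    then show ?thesis
      by (auto simp: U_def in_span_singleton[of _ "veronese_vec d a"] Arrow_phi lin phi)
  qed
  moreover have "vec.subspace (U x) \<and> U x \<subseteq> rep_space (repV d c) x" for x
    using U2 U3 by (cases x) (auto simp: U_def repV_def proj_space_def coord_space_def vec.subspace_single_0)
  moreover have "vec.dim (U x) = (case x of Vertex1 \<Rightarrow> 0 | _ \<Rightarrow> 1)" for x
    using U2 U3 vec_dim_zero by (cases x) (simp_all add: U_def proj_space_def)
  ultimately have "U \<in> quiver_Grassmannian quiverQ (repV d c) (case_vertex 0 1 1)"
    by (simp add: quiver_Grassmannian_def subrepresentation_def quiverQ_def split: vertex.splits)
  then show "L \<in> GrV d c"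
    unfolding GrV_def a(2) by (rule rev_image_eqI) (simp add: U_def)
qed

section \<open>The isomorphism of categories\<close>

lemma variety_category_simps [simp]:
  "Obj (variety_category Os) = Os"
  "Hom (variety_category Os) (S, X) (T, Y) = variety_morphisms S X T Y"
  "Ident (variety_category Os) (S, X) = restrict id X"
  "Comp (variety_category Os) (S, X) (T, Y) (U, Z) g f = compose X g f"
  by (simp_all add: variety_category_def)

lemma category_variety_category:
  assumes "\<And>S X. (S, X) \<in> Os \<Longrightarrow> irreducible_closed S X"
  shows "category (variety_category Os)"
proof -
  have sub: "X \<subseteq> proj_space S" if "(S, X) \<in> Os" for S X
    using assms[OF that] by (simp add: irreducible_closed_def)
  have mor: "g \<in> variety_morphisms S X T Y \<longleftrightarrow> regular_map S X T Y g"
    if "(S, X) \<in> Os" for S X T Y g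
    by (rule variety_morphisms_iff[OF assms[OF that]])
  have ext: "g \<in> X \<rightarrow>\<^sub>E Y" if "g \<in> variety_morphisms S X T Y" for S X T Y g
    using that by (simp add: variety_morphisms_def)
  show ?thesis
  proof
    fix A assume "A \<in> Obj (variety_category Os)"
    then show "Ident (variety_category Os) A \<in> Hom (variety_category Os) A A"
      by (cases A) (simp add: mor regular_map_id sub)
  next
    fix A B C f g
    assume A: "A \<in> Obj (variety_category Os)" and B: "B \<in> Obj (variety_category Os)"
      and C: "C \<in> Obj (variety_category Os)"
      and f: "f \<in> Hom (variety_category Os) A B" and g: "g \<in> Hom (variety_category Os) B C"
    obtain S X T Y U Z where eq: "A = (S, X)" "B = (T, Y)" "C = (U, Z)"
      by (meson surj_pair)
    have "regular_map S X U Z (compose X g f)"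
      by (rule regular_map_compose[where T = T and Y = Y]) (use A B C f g in \<open>simp_all add: eq mor sub\<close>)
    then show "Comp (variety_category Os) A B C g f \<in> Hom (variety_category Os) A C"
      using A by (simp add: eq mor)
  next
    fix A B f
    assume "A \<in> Obj (variety_category Os)" "B \<in> Obj (variety_category Os)" "f \<in> Hom (variety_category Os) A B"
    then show "Comp (variety_category Os) A B B (Ident (variety_category Os) B) f = f"
      "Comp (variety_category Os) A A B f (Ident (variety_category Os) A) = f"
      by (cases A; cases B; auto dest!: ext simp: compose_def fun_eq_iff restrict_def extensional_def PiE_def)+
  next
    fix A B C D f g h
    assume "A \<in> Obj (variety_category Os)" "B \<in> Obj (variety_category Os)" "C \<in> Obj (variety_category Os)"
      "D \<in> Obj (variety_category Os)" "f \<in> Hom (variety_category Os) A B"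
      "g \<in> Hom (variety_category Os) B C" "h \<in> Hom (variety_category Os) C D"
    then show "Comp (variety_category Os) A B D (Comp (variety_category Os) B C D h g) f =
        Comp (variety_category Os) A C D h (Comp (variety_category Os) A B C g f)"
      by (cases A; cases B; cases C; cases D) (auto dest!: ext simp: compose_def fun_eq_iff)
  qed
qed

lemma full_subcategory_variety_category:
  "full_subcategory (variety_category Os) P = variety_category {A \<in> Os. P A}"
  by (simp add: full_subcategory_def variety_category_def)

definition smooth_irreducible_form :: "nat \<Rightarrow> (3, 'a::field) mpoly \<Rightarrow> bool" where
  "smooth_irreducible_form d F \<longleftrightarrow>
     Factorial_Ring.irreducible F \<and> homogeneous d F \<and> smooth UNIV (plane_curve F)"

lemma plane_curve_subset: "plane_curve F \<subseteq> proj_space UNIV"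
  by (auto simp: plane_curve_def)

lemma smooth_plane_curves_eq:
  "(smooth_plane_curves :: (3, 'a::{alg_closed_field, factorial_ring_gcd, semiring_gcd_mult_normalize}) variety_cat) =
    variety_category {(UNIV, plane_curve F) | F. \<exists>d. smooth_irreducible_form d F}"
proof -
  have "{(UNIV, X) | X. projective_plane_curve X \<and> smooth UNIV X} =
      {(UNIV :: 3 set, plane_curve F :: (3, 'a) point set) | F. \<exists>d. smooth_irreducible_form d F}"
  proof (intro equalityI subsetI)
    fix A assume "A \<in> {(UNIV :: 3 set, X :: (3, 'a) point set) | X. projective_plane_curve X \<and> smooth UNIV X}"
    then obtain X where X: "A = (UNIV, X)" "projective_plane_curve X" "smooth UNIV X"
      by blast
    obtain F d where "Factorial_Ring.irreducible F" "homogeneous d F" "X = plane_curve F"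
      by (rule projective_plane_curve_is_plane_curve[OF X(2)])
    then show "A \<in> {(UNIV, plane_curve F) | F. \<exists>d. smooth_irreducible_form d F}"
      using X unfolding smooth_irreducible_form_def by blast
  next
    fix A assume "A \<in> {(UNIV :: 3 set, plane_curve F :: (3, 'a) point set) | F. \<exists>d. smooth_irreducible_form d F}"
    then obtain F d where "A = (UNIV, plane_curve F)" "smooth_irreducible_form d F"
      by blast
    then show "A \<in> {(UNIV, X) | X. projective_plane_curve X \<and> smooth UNIV X}"
      using projective_variety_plane_curve variety_dim_plane_curve
      unfolding smooth_irreducible_form_def projective_plane_curve_def by blast
  qed
  then show ?thesis
    by (simp add: smooth_plane_curves_def)
qed

text \<open>Irreducibility forces d > 0, so \<open>GrV_eq\<close> covers every object. Conversely,
  any form of degree d arises as \<open>form_polynomial\<close> from its own coefficients.\<close>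

lemma GR_smooth_category_eq:
  "(GR_smooth_category :: (3 expo, 'a::alg_closed_field) variety_cat) =
    variety_category {(monomials d, veronese d ` plane_curve F) | d F. smooth_irreducible_form d F}"
proof -
  have GrV: "GrV d c = veronese d ` plane_curve (form_polynomial d c) \<and>
      (smooth (monomials d) (GrV d c) \<longleftrightarrow> smooth UNIV (plane_curve (form_polynomial d c)))"
    if "Factorial_Ring.irreducible (form_polynomial d c)" for d and c :: "3 expo \<Rightarrow> 'a"
  proof -
    have "d > 0"
      by (rule irreducible_homogeneous_degree_pos[OF that homogeneous_form_polynomial])
    then show ?thesis
      using smooth_veronese_iff[OF _ plane_curve_subset] by (simp add: GrV_eq)
  qed
  have "{A \<in> {(monomials d, GrV d c) | d c. Factorial_Ring.irreducible (form_polynomial d c)}.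
      case A of (S, X) \<Rightarrow> smooth S X} =
      {(monomials d, veronese d ` plane_curve F :: (3 expo, 'a) point set) | d F. smooth_irreducible_form d F}"
    (is "?A = ?B")
  proof (intro equalityI subsetI)
    fix A assume "A \<in> ?A"
    then obtain d c where A: "A = (monomials d, GrV d c)" "Factorial_Ring.irreducible (form_polynomial d c)"
      "smooth (monomials d) (GrV d c)"
      by auto
    then have "smooth_irreducible_form d (form_polynomial d c)"
      using GrV homogeneous_form_polynomial unfolding smooth_irreducible_form_def by blast
    moreover have "A = (monomials d, veronese d ` plane_curve (form_polynomial d c))"
      using A GrV by blast
    ultimately show "A \<in> ?B"
      by blast
  next
    fix A assume "A \<in> ?B"
    then obtain d F where A: "A = (monomials d, veronese d ` plane_curve F)" and F: "smooth_irreducible_form d F"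
      by blast
    have eq: "form_polynomial d (Poly_Mapping.lookup F) = F"
      using F by (intro form_polynomial_lookup) (simp add: smooth_irreducible_form_def)
    have irr: "Factorial_Ring.irreducible (form_polynomial d (Poly_Mapping.lookup F))"
      unfolding eq using F by (simp add: smooth_irreducible_form_def)
    note GrV_F = GrV[OF irr, unfolded eq]
    have "veronese d ` plane_curve F = GrV d (Poly_Mapping.lookup F)"
      using GrV_F by simp
    moreover have "smooth (monomials d) (GrV d (Poly_Mapping.lookup F))"
      using conjunct2[OF GrV_F] F unfolding smooth_irreducible_form_def by blast
    ultimately have "A = (monomials d, GrV d (Poly_Mapping.lookup F))"
      "smooth (monomials d) (GrV d (Poly_Mapping.lookup F))"
      using A by simp_all
    then show "A \<in> ?A"
      using irr by auto
  qed
  then show ?thesis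
    by (simp add: GR_smooth_category_def GR_category_def full_subcategory_variety_category)
qed

lemma monomials_inj: "monomials d = monomials e \<Longrightarrow> d = e"
proof -
  assume "monomials d = monomials e"
  then have "Poly_Mapping.single 1 d \<in> monomials e"
    by (metis (mono_tags) mem_Collect_eq monomials_def tdeg_single)
  then show "d = e"
    by (simp add: monomials_def tdeg_single)
qed

text \<open>Conjugation by isomorphisms \<open>n A\<close> of the objects onto their images. Both
  \<open>n\<close> and the ambient index set \<open>V A\<close> may depend on the object, as the
  Veronese degree depends on the curve.\<close>

lemma isomorphism_of_variety_categories:
  fixes Xs :: "('i set \<times> ('i, 'a::field) point set) set" and Ys :: "('j set \<times> ('j, 'a) point set) set"
  assumes irrX: "\<And>S X. (S, X) \<in> Xs \<Longrightarrow> irreducible_closed S X"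
    and irrY: "\<And>T Y. (T, Y) \<in> Ys \<Longrightarrow> irreducible_closed T Y"
    and bij: "bij_betw (\<lambda>A. (V A, n A ` snd A)) Xs Ys"
    and inj: "\<And>S X. (S, X) \<in> Xs \<Longrightarrow> inj_on (n (S, X)) X"
    and reg: "\<And>S X. (S, X) \<in> Xs \<Longrightarrow> regular_map S X (V (S, X)) (n (S, X) ` X) (restrict (n (S, X)) X)"
    and reg_inv: "\<And>S X. (S, X) \<in> Xs \<Longrightarrow> regular_map (V (S, X)) (n (S, X) ` X) S X
      (restrict (inv_into X (n (S, X))) (n (S, X) ` X))"
  shows "isomorphic_categories (variety_category Xs) (variety_category Ys)"
proof -
  define \<nu> where "\<nu> A = restrict (n A) (snd A)" for A
  define \<mu> where "\<mu> A = restrict (inv_into (snd A) (n A)) (n A ` snd A)" for A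
  define \<Phi> where "\<Phi> A = (V A, n A ` snd A)" for A
  \<comment> \<open>This is n_B g n_A^(-1). Nested \<open>compose\<close> keeps it extensional, so
    that morphisms are equal once they agree on points.\<close>
  define \<Gamma> where "\<Gamma> A B g = compose (n A ` snd A) (compose (snd A) (\<nu> B) g) (\<mu> A)" for A B g
  have Y: "(V A, n A ` snd A) \<in> Ys" if "A \<in> Xs" for A
    using bij that by (auto simp: bij_betw_def)
  have subX: "snd A \<subseteq> proj_space (fst A)" if "A \<in> Xs" for A
    using irrX[of "fst A" "snd A"] that by (simp add: irreducible_closed_def)
  have subY: "n A ` snd A \<subseteq> proj_space (V A)" if "A \<in> Xs" for A
    using irrY[OF Y[OF that]] by (simp add: irreducible_closed_def)
  have \<mu>\<nu>: "\<mu> A (n A x) = x" if "A \<in> Xs" "x \<in> snd A" for A x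
    using inj[of "fst A" "snd A"] that by (simp add: \<mu>_def)
  have reg\<nu>: "regular_map (fst A) (snd A) (V A) (n A ` snd A) (\<nu> A)" if "A \<in> Xs" for A
    using reg[of "fst A" "snd A"] that by (simp add: \<nu>_def)
  have reg\<mu>: "regular_map (V A) (n A ` snd A) (fst A) (snd A) (\<mu> A)" if "A \<in> Xs" for A
    using reg_inv[of "fst A" "snd A"] that by (simp add: \<mu>_def)
  have HomX: "f \<in> Hom (variety_category Xs) A B \<longleftrightarrow> regular_map (fst A) (snd A) (fst B) (snd B) f"
    if "A \<in> Xs" for A B f
    using variety_morphisms_iff[OF irrX, of "fst A" "snd A"] that by (cases A; cases B) simp
  have HomY: "f \<in> Hom (variety_category Ys) (\<Phi> A) (\<Phi> B) \<longleftrightarrow>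
      regular_map (V A) (n A ` snd A) (V B) (n B ` snd B) f"
    if "A \<in> Xs" for A B f
    using variety_morphisms_iff[OF irrY[OF Y[OF that]]] by (simp add: \<Phi>_def)
  have ext: "f \<in> X \<rightarrow>\<^sub>E Z" if "regular_map S X T Z f" for S X T Z f
    using that by (simp add: regular_map_def)
  have \<Gamma>_apply: "\<Gamma> A B g (n A x) = n B (g x)"
    if "A \<in> Xs" "x \<in> snd A" "g x \<in> snd B" for A B g x
    using that \<mu>\<nu>[of A x] by (simp add: \<Gamma>_def compose_def \<nu>_def)
  have \<Gamma>_ext: "\<Gamma> A B g \<in> extensional (n A ` snd A)" for A B g
    by (simp add: \<Gamma>_def)
  have \<Gamma>_eqI: "\<Gamma> A B g = h" if "A \<in> Xs" "h \<in> extensional (n A ` snd A)"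
    "\<And>x. x \<in> snd A \<Longrightarrow> g x \<in> snd B \<and> n B (g x) = h (n A x)" for A B g h
    using that by (intro extensionalityI[OF \<Gamma>_ext]) (auto simp: \<Gamma>_apply)
  have bij_hom: "bij_betw (\<Gamma> A B) (Hom (variety_category Xs) A B) (Hom (variety_category Ys) (\<Phi> A) (\<Phi> B))"
    if A: "A \<in> Xs" and B: "B \<in> Xs" for A B
  proof (rule bij_betw_byWitness[where f' = "\<lambda>h. compose (snd A) (compose (n A ` snd A) (\<mu> B) h) (\<nu> A)"])
    show "\<forall>g\<in>Hom (variety_category Xs) A B.
        compose (snd A) (compose (n A ` snd A) (\<mu> B) (\<Gamma> A B g)) (\<nu> A) = g"
    proof
      fix g assume gH: "g \<in> Hom (variety_category Xs) A B"
      have g: "g \<in> snd A \<rightarrow>\<^sub>E snd B"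
        by (rule ext[OF iffD1[OF HomX[OF A] gH]])
      then have gB: "g x \<in> snd B" if "x \<in> snd A" for x
        using that by (rule PiE_mem)
      show "compose (snd A) (compose (n A ` snd A) (\<mu> B) (\<Gamma> A B g)) (\<nu> A) = g"
      proof (rule extensionalityI[of _ "snd A"])
        fix x assume x: "x \<in> snd A"
        then show "compose (snd A) (compose (n A ` snd A) (\<mu> B) (\<Gamma> A B g)) (\<nu> A) x = g x"
          by (simp add: compose_def \<nu>_def \<Gamma>_apply[of A x g B, OF A x gB] \<mu>\<nu>[OF B gB])
      qed (use g in \<open>auto simp: PiE_def\<close>)
    qed
    show "\<forall>h\<in>Hom (variety_category Ys) (\<Phi> A) (\<Phi> B).
        \<Gamma> A B (compose (snd A) (compose (n A ` snd A) (\<mu> B) h) (\<nu> A)) = h"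
    proof
      fix h assume hH: "h \<in> Hom (variety_category Ys) (\<Phi> A) (\<Phi> B)"
      have h: "h \<in> n A ` snd A \<rightarrow>\<^sub>E n B ` snd B"
        by (rule ext[OF iffD1[OF HomY[OF A] hH]])
      show "\<Gamma> A B (compose (snd A) (compose (n A ` snd A) (\<mu> B) h) (\<nu> A)) = h"
      proof (rule \<Gamma>_eqI[OF A])
        show "h \<in> extensional (n A ` snd A)"
          using h by (simp add: PiE_def)
        fix x assume x: "x \<in> snd A"
        then have "h (n A x) \<in> n B ` snd B"
          using h by blast
        then obtain y where "y \<in> snd B" "h (n A x) = n B y"
          by blast
        then show "compose (snd A) (compose (n A ` snd A) (\<mu> B) h) (\<nu> A) x \<in> snd B \<and>
            n B (compose (snd A) (compose (n A ` snd A) (\<mu> B) h) (\<nu> A) x) = h (n A x)"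
          using x \<mu>\<nu>[OF B] by (simp add: compose_def \<nu>_def)
      qed
    qed
    show "\<Gamma> A B ` Hom (variety_category Xs) A B \<subseteq> Hom (variety_category Ys) (\<Phi> A) (\<Phi> B)"
    proof
      fix h assume "h \<in> \<Gamma> A B ` Hom (variety_category Xs) A B"
      then obtain g where g: "regular_map (fst A) (snd A) (fst B) (snd B) g" and h: "h = \<Gamma> A B g"
        using HomX[OF A] by blast
      have "regular_map (V A) (n A ` snd A) (V B) (n B ` snd B) (\<Gamma> A B g)"
        unfolding \<Gamma>_def
        by (rule regular_map_compose[OF reg\<mu>[OF A] regular_map_compose[OF g reg\<nu>[OF B] subX[OF A] subX[OF B]]
              subY[OF A] subX[OF A]])
      then show "h \<in> Hom (variety_category Ys) (\<Phi> A) (\<Phi> B)"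
        using HomY[OF A] h by blast
    qed
    show "(\<lambda>h. compose (snd A) (compose (n A ` snd A) (\<mu> B) h) (\<nu> A)) `
        Hom (variety_category Ys) (\<Phi> A) (\<Phi> B) \<subseteq> Hom (variety_category Xs) A B"
    proof
      fix g assume "g \<in> (\<lambda>h. compose (snd A) (compose (n A ` snd A) (\<mu> B) h) (\<nu> A)) `
        Hom (variety_category Ys) (\<Phi> A) (\<Phi> B)"
      then obtain h where h: "regular_map (V A) (n A ` snd A) (V B) (n B ` snd B) h"
        and g: "g = compose (snd A) (compose (n A ` snd A) (\<mu> B) h) (\<nu> A)"
        using HomY[OF A] by blast
      have "regular_map (fst A) (snd A) (fst B) (snd B) g"
        unfolding g
        by (rule regular_map_compose[OF reg\<nu>[OF A] regular_map_compose[OF h reg\<mu>[OF B] subY[OF A] subY[OF B]]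
              subX[OF A] subY[OF A]])
      then show "g \<in> Hom (variety_category Xs) A B"
        using HomX[OF A] by blast
    qed
  qed
  have ident: "\<Gamma> A A (Ident (variety_category Xs) A) = Ident (variety_category Ys) (\<Phi> A)" if A: "A \<in> Xs" for A
    by (rule \<Gamma>_eqI[OF A]; cases A) (auto simp: \<Phi>_def)
  have comp: "\<Gamma> A C (Comp (variety_category Xs) A B C g f) =
      Comp (variety_category Ys) (\<Phi> A) (\<Phi> B) (\<Phi> C) (\<Gamma> B C g) (\<Gamma> A B f)"
    if A: "A \<in> Xs" and B: "B \<in> Xs" and C: "C \<in> Xs"
      and f: "f \<in> Hom (variety_category Xs) A B" and g: "g \<in> Hom (variety_category Xs) B C" for A B C f g
  proof (rule \<Gamma>_eqI[OF A])
    have Comps: "Comp (variety_category Xs) A B C g f = compose (snd A) g f"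
      "Comp (variety_category Ys) (\<Phi> A) (\<Phi> B) (\<Phi> C) (\<Gamma> B C g) (\<Gamma> A B f) =
        compose (n A ` snd A) (\<Gamma> B C g) (\<Gamma> A B f)"
      by (cases A; cases B; cases C; simp add: \<Phi>_def)+
    show "Comp (variety_category Ys) (\<Phi> A) (\<Phi> B) (\<Phi> C) (\<Gamma> B C g) (\<Gamma> A B f) \<in> extensional (n A ` snd A)"
      unfolding Comps by simp
    fix x assume x: "x \<in> snd A"
    have fx: "f x \<in> snd B"
      by (rule PiE_mem[OF ext[OF iffD1[OF HomX[OF A] f]] x])
    have gfx: "g (f x) \<in> snd C"
      by (rule PiE_mem[OF ext[OF iffD1[OF HomX[OF B] g]] fx])
    show "Comp (variety_category Xs) A B C g f x \<in> snd C \<and> n C (Comp (variety_category Xs) A B C g f x) =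
        Comp (variety_category Ys) (\<Phi> A) (\<Phi> B) (\<Phi> C) (\<Gamma> B C g) (\<Gamma> A B f) (n A x)"
      unfolding Comps using x gfx \<Gamma>_apply[of A x f B, OF A x fx]
        \<Gamma>_apply[of B "f x" g C, OF B fx gfx] by (simp add: compose_def)
  qed
  have "isomorphism_of_categories (variety_category Xs) (variety_category Ys) \<Phi> \<Gamma>"
    unfolding isomorphism_of_categories_def
  proof (intro conjI ballI)
    show "bij_betw \<Phi> (Obj (variety_category Xs)) (Obj (variety_category Ys))"
      using bij by (simp add: \<Phi>_def[abs_def])
  qed (use bij_hom ident comp in simp_all)
  moreover have "category (variety_category Xs)" "category (variety_category Ys)"
    by (rule category_variety_category, erule irrX, rule category_variety_category, erule irrY)
  ultimately show ?thesis
    unfolding isomorphic_categories_def by blast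
qed

theorem theorem3p1:
  assumes "perfect_field TYPE('k::field)"
  shows "isomorphic_categories
    (smooth_plane_curves :: (3, 'k alg_closure) variety_cat)
    (GR_smooth_category :: (3 expo, 'k alg_closure) variety_cat)"
proof -
  \<comment> \<open>The choice is harmless: by \<open>deg_eq\<close> all irreducible forms of a
    given curve have the same degree.\<close>
  define deg where "deg X = (SOME d. \<exists>F. smooth_irreducible_form d F \<and> X = plane_curve F)"
    for X :: "(3, 'k alg_closure) point set"
  let ?Xs = "{(UNIV, plane_curve F) | F. \<exists>d. smooth_irreducible_form d F} :: (3 set \<times> (3, 'k alg_closure) point set) set"
  let ?Ys = "{(monomials d, veronese d ` plane_curve F) | d F. smooth_irreducible_form d F} ::
    (3 expo set \<times> (3 expo, 'k alg_closure) point set) set"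
  have deg_eq: "deg (plane_curve F) = d" if F: "smooth_irreducible_form d F" for d F
  proof -
    have "\<exists>G. smooth_irreducible_form (deg (plane_curve F)) G \<and> plane_curve F = plane_curve G"
      unfolding deg_def by (rule someI[of _ d]) (use F in blast)
    then obtain G where G: "smooth_irreducible_form (deg (plane_curve F)) G" and eq: "plane_curve F = plane_curve G"
      by blast
    show ?thesis
      by (rule plane_curve_eq_imp_degree_eq[OF _ _ _ _ eq[symmetric]])
        (use F G in \<open>simp_all add: smooth_irreducible_form_def\<close>)
  qed
  have pos: "d > 0" if "smooth_irreducible_form d F" for d and F :: "(3, 'k alg_closure) mpoly"
    using that irreducible_homogeneous_degree_pos by (auto simp: smooth_irreducible_form_def)
  have irr: "irreducible_closed UNIV (plane_curve F)" if "smooth_irreducible_form d F"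
    for d and F :: "(3, 'k alg_closure) mpoly"
    using that irreducible_closed_plane_curve by (auto simp: smooth_irreducible_form_def)
  have "isomorphic_categories (variety_category ?Xs) (variety_category ?Ys)"
  proof (rule isomorphism_of_variety_categories[where V = "\<lambda>A. monomials (deg (snd A))"
        and n = "\<lambda>A. veronese (deg (snd A))"])
    show "irreducible_closed S X" if "(S, X) \<in> ?Xs" for S X
      using that irr by auto
    show "irreducible_closed T Y" if "(T, Y) \<in> ?Ys" for T Y
      using that irreducible_closed_veronese[OF pos irr] by auto
    show "inj_on (veronese (deg (snd (S, X)))) X" if "(S, X) \<in> ?Xs" for S X
      using that inj_on_subset[OF inj_on_veronese[OF pos] plane_curve_subset] by (auto simp: deg_eq)
    show "regular_map S X (monomials (deg (snd (S, X)))) (veronese (deg (snd (S, X))) ` X)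
        (restrict (veronese (deg (snd (S, X)))) X)" if "(S, X) \<in> ?Xs" for S X
      using that regular_map_veronese[OF plane_curve_subset] by auto
    show "regular_map (monomials (deg (snd (S, X)))) (veronese (deg (snd (S, X))) ` X) S X
        (restrict (inv_into X (veronese (deg (snd (S, X))))) (veronese (deg (snd (S, X))) ` X))"
      if "(S, X) \<in> ?Xs" for S X
      using that regular_map_inv_veronese[OF pos plane_curve_subset] by (auto simp: deg_eq)
    show "bij_betw (\<lambda>A. (monomials (deg (snd A)), veronese (deg (snd A)) ` snd A)) ?Xs ?Ys"
      unfolding bij_betw_def
    proof
      show "inj_on (\<lambda>A. (monomials (deg (snd A)), veronese (deg (snd A)) ` snd A)) ?Xs"
      proof (rule inj_onI)
        fix A B
        assume A: "A \<in> ?Xs" and B: "B \<in> ?Xs"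
          and eq: "(monomials (deg (snd A)), veronese (deg (snd A)) ` snd A) =
            (monomials (deg (snd B)), veronese (deg (snd B)) ` snd B)"
        obtain F d where F: "A = (UNIV, plane_curve F)" "smooth_irreducible_form d F"
          using A by blast
        obtain G e where G: "B = (UNIV, plane_curve G)" "smooth_irreducible_form e G"
          using B by blast
        \<comment> \<open>The ambient index set \<open>monomials d\<close> is part of an object and
          reveals the degree; injectivity of a single Veronese map then finishes.\<close>
        have "d = e"
          using eq by (simp add: F G deg_eq[OF F(2)] deg_eq[OF G(2)] monomials_inj)
        then have "veronese d ` plane_curve F = veronese d ` plane_curve G"
          using eq by (simp add: F G deg_eq[OF F(2)] deg_eq[OF G(2)])
        then show "A = B"
          using inj_on_image_eq_iff[OF inj_on_veronese[OF pos[OF F(2)]] plane_curve_subset[of F] plane_curve_subset[of G]]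
          by (simp add: F G)
      qed
      show "(\<lambda>A. (monomials (deg (snd A)), veronese (deg (snd A)) ` snd A)) ` ?Xs = ?Ys"
      proof (intro equalityI subsetI)
        fix B assume "B \<in> (\<lambda>A. (monomials (deg (snd A)), veronese (deg (snd A)) ` snd A)) ` ?Xs"
        then obtain F d where F: "smooth_irreducible_form d F"
          "B = (monomials (deg (plane_curve F)), veronese (deg (plane_curve F)) ` plane_curve F)"
          by auto
        then show "B \<in> ?Ys"
          unfolding deg_eq[OF F(1)] by blast
      next
        fix B assume "B \<in> ?Ys"
        then obtain d F where F: "B = (monomials d, veronese d ` plane_curve F)" "smooth_irreducible_form d F"
          by blast
        show "B \<in> (\<lambda>A. (monomials (deg (snd A)), veronese (deg (snd A)) ` snd A)) ` ?Xs"
          by (rule image_eqI[of _ _ "(UNIV, plane_curve F)"]) (use F in \<open>auto simp: deg_eq[OF F(2)]\<close>)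
      qed
    qed
  qed
  then show ?thesis
    unfolding smooth_plane_curves_eq GR_smooth_category_eq .
qed

end
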